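(* For each $n\in\mathbb{N}$ let $X_1,\ldots,X_n$ be independent random variables, each uniformly distributed on $\{1,\ldots,n\}$, and let $P_n$ be the law of $\frac{1}{n^{2}}\sum_{1\leq i,j\leq n}1_{\gcd(X_{i},X_{j})=1}$ on $[0,1]$. Then $(P_n)_{n\in\mathbb{N}}$ satisfies a large deviation principle (with speed $n$) with rate function \[ I_{1}(x)=\inf\left\{H(\mu\,|\,\nu):\ \mu\text{ a Borel probability measure on }[0,1],\ \iint_{[0,1]^{2}}f(u,v)\,\mu(du)\,\mu(dv)=x\right\}, \] with $\inf\emptyset=+\infty$.
   Context: Let $p_1<p_2<\cdots$ be the primes in increasing order. For $a\in[0,1]$ and $i\in\mathbb{N}$, $\chi_i(a)$ denotes the $i$-th digit of the binary expansion of $a$, where for numbers with two binary expansions the finite one is used. $\nu$ is the Borel probability measure on $[0,1]$ under which the digits $\chi_1,\chi_2,\ldots$ are independent and $\chi_i$ is Bernoulli with parameter $1/p_i$ (i.e. $\nu(\chi_i=1)=1/p_i$); equivalently $\nu$ is the weak limit of the measures $\nu_k$ with $\nu_k([0,b])=\sum_{i=1}^{k}\prod_{j=1}^{i-1}(1-1/p_j)\,(1-1/p_i)^{b_i}$, $b=0.b_1b_2\ldots$. The function $f:[0,1]^2\to\{0,1\}$ is $f(u,v)=1-\max_{i\in\mathbb{N}}\chi_i(u)\chi_i(v)$, i.e. $f(u,v)=1$ iff $u,v$ have no common digit $1$ at the same position of their binary expansions. $H(\mu|\nu)=\int\log\frac{d\mu}{d\nu}\,d\mu$ if $\mu\ll\nu$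 and $\log\frac{d\mu}{d\nu}\in L^1(\mu)$, and $+\infty$ otherwise. A sequence of probability measures $P_n$ on a topological space satisfies a large deviation principle with rate function $I$ if $I\ge0$ is lower semicontinuous and for every measurable $A$: $-\inf_{A^{o}}I\leq\liminf_n\frac1n\log P_n(A)\leq\limsup_n\frac1n\log P_n(A)\leq-\inf_{\overline{A}}I$. *)

theory Defs
  imports "HOL-Probability.Probability" "HOL-Library.Infinite_Set"
begin

definition prime_seq :: "nat \<Rightarrow> nat" where
  "prime_seq i = enumerate {p::nat. prime p} (i - 1)"

text \<open>i-th binary digit (i \<ge> 1) of a \<in> [0,1]; the finite expansion is used for dyadic
  rationals, and 1 = 0.111... has all digits equal to 1.\<close>
definition bdigit :: "nat \<Rightarrow> real \<Rightarrow> nat" where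
  "bdigit i a = (if a = 1 then 1 else nat (\<lfloor>a * 2 ^ i\<rfloor> mod 2))"

text \<open>f(u,v) = 1 - max_{i \<ge> 1} chi_i(u) chi_i(v)\<close>
definition fcop :: "real \<Rightarrow> real \<Rightarrow> real" where
  "fcop u v = (if \<exists>i\<ge>1. bdigit i u = 1 \<and> bdigit i v = 1 then 0 else 1)"

definition borel01 :: "real measure" where
  "borel01 = restrict_space borel {0..1}"

text \<open>The measure nu: law of the number with independent binary digits,
  digit i being Bernoulli(1/p_i). Coordinate k of omega is digit k+1.\<close>
definition bin_value :: "(nat \<Rightarrow> bool) \<Rightarrow> real" where
  "bin_value \<omega> = (\<Sum>k. (if \<omega> k then 1 else 0) / 2 ^ Suc k)"

definition nu :: "real measure" where
  "nu = distr (\<Pi>\<^sub>M k\<in>(UNIV::nat set). measure_pmf (bernoulli_pmf (1 / real (prime_seq (Suc k)))))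
              borel01 bin_value"

definition rel_entropy :: "'a measure \<Rightarrow> 'a measure \<Rightarrow> ereal" where
  "rel_entropy \<mu> \<nu> =
     (if absolutely_continuous \<nu> \<mu> \<and> integrable \<mu> (\<lambda>x. ln (enn2real (RN_deriv \<nu> \<mu> x)))
      then ereal (\<integral>x. ln (enn2real (RN_deriv \<nu> \<mu> x)) \<partial>\<mu>)
      else \<infinity>)"

text \<open>Rate function I_1; Inf of the empty set of ereals is +infinity.\<close>
definition I1 :: "real \<Rightarrow> ereal" where
  "I1 x = (INF \<mu> \<in> {\<mu>. prob_space \<mu> \<and> sets \<mu> = sets borel01 \<and>
                       (\<integral>u. (\<integral>v. fcop u v \<partial>\<mu>) \<partial>\<mu>) = x}. rel_entropy \<mu> nu)"

definition Pn :: "nat \<Rightarrow> real pmf" where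
  "Pn n = map_pmf (\<lambda>X. (\<Sum>i<n. \<Sum>j<n. if gcd (X i) (X j) = (1::nat) then 1 else 0) / (real n)\<^sup>2)
                  (Pi_pmf {..<n} 0 (\<lambda>_. pmf_of_set {1..n}))"

definition eln :: "real \<Rightarrow> ereal" where
  "eln x = (if x = 0 then -\<infinity> else ereal (ln x))"

definition lsc_on :: "'a::topological_space set \<Rightarrow> ('a \<Rightarrow> ereal) \<Rightarrow> bool" where
  "lsc_on S I \<longleftrightarrow> (\<forall>c. closedin (top_of_set S) {x\<in>S. I x \<le> c})"

definition LDP_on :: "'a::topological_space set \<Rightarrow> (nat \<Rightarrow> 'a measure) \<Rightarrow> ('a \<Rightarrow> ereal) \<Rightarrow> bool" where
  "LDP_on S P I \<longleftrightarrow>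
     (\<forall>x\<in>S. 0 \<le> I x) \<and> lsc_on S I \<and>
     (\<forall>A. A \<in> sets (restrict_space borel S) \<longrightarrow>
        - (INF x \<in> (top_of_set S) interior_of A. I x)
            \<le> liminf (\<lambda>n. ereal (1 / real n) * eln (measure (P n) A))
        \<and> liminf (\<lambda>n. ereal (1 / real n) * eln (measure (P n) A))
            \<le> limsup (\<lambda>n. ereal (1 / real n) * eln (measure (P n) A))
        \<and> limsup (\<lambda>n. ereal (1 / real n) * eln (measure (P n) A))
            \<le> - (INF x \<in> (top_of_set S) closure_of A. I x))"

end

theory Submission
  imports Defs "HOL-Real_Asymp.Real_Asymp"
begin

text \<open>Only finitely many digits matter, up to superexponentially small errors. For a sample
  $X_1,\ldots,X_n$ the set of $l \le k$ with $p_l \mid X_i$ takes finitely many values, and its law converges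
  to the law of the first $k$ digits under nu, so Sanov's theorem on a finite alphabet governs the
  fraction of pairs without a common prime factor among $p_1,\ldots,p_k$.

  Discarding the other primes changes this fraction by at most the sum of $(N_l/n)^2$ over $l > k$, where
  $N_l$ counts the multiples of $p_l$. The $l$ with $N_l \le e^\theta n/p_l$ contribute at most $e^{2\theta}/k$.
  For the remaining ones, a union bound over the at most $2^n$ sets of indices and an exponential
  moment show that the sum of their $N_l$ exceeds $\epsilon n$ with probability at most
  $2^n e^{-(\theta-1)\epsilon n}$, and $\theta$ is arbitrary. The variational formula for the relative
  entropy turns the same computation into uniform convergence of the truncated functionals
  on the set of measures of entropy at most $c$.

  For lower semicontinuity, the marginals of a minimising sequence converge along a subsequence; the
  densities of the limiting marginals form a martingale of bounded entropy, and since entropy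
  increments dominate squared Hellinger distances, it is Cauchy in $L^1$.\<close>

section \<open>Large prime factors in a uniform sample\<close>

text \<open>Squares of frequencies appear because a discarded prime must divide both members of a
  pair. The sum of 1/p_l diverges, but p_l > l makes the squares summable. The threshold
  e^\<theta>/p_l is matched to the exponential moment: tilting by \<theta> costs at most e^\<theta>
  - 1 times the sum of 1/p_l over the selected primes, and above the threshold this is at most the
  sum of their frequencies. One unit of \<theta> is lost, which explains the factor \<theta> - 1.
  Since f is discontinuous, weak convergence of measures does not pass to its double integral.
  Limits are therefore taken in the finite digit marginals, on which the truncated functional is a
  polynomial; uniformity on entropy level sets then permits the interchange with k tending to
  infinity. Closed sublevel sets also drive the upper bound: a compact set on which
  \<open>I1\<close> exceeds c has positive distance d from the sublevel set at c, and two
  approximation errors of d/3 cannot bridge it.\<close>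

text \<open>Expanding the product of the factors 1 + (e^\<theta> - 1) 1_B over subsets of T gives
  nonnegative coefficients, so upper bounds on joint probabilities suffice; then 1 + x \<le> e^x. It
  is applied to divisibility events of a uniform integer and to digit events under
  \<open>nu\<close>.\<close>

lemma (in prob_space) exp_card_moment:
  fixes B :: "'b \<Rightarrow> 'a set" and a :: "'b \<Rightarrow> real"  and \<theta> :: real
  assumes fin: "finite T" and B: "\<And>i. i \<in> T \<Longrightarrow> B i \<in> events" and th: "\<theta> \<ge> 0"
    and pr: "\<And>S. S \<subseteq> T \<Longrightarrow> prob {x \<in> space M. \<forall>i\<in>S. x \<in> B i} \<le> prod a S"
  shows "integrable M (\<lambda>x. exp (\<theta> * card {i\<in>T. x \<in> B i}))"
    and "expectation (\<lambda>x. exp (\<theta> * card {i\<in>T. x \<in> B i})) \<le> exp ((exp \<theta> - 1) * sum a T)"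
proof -
  define c where "c = exp \<theta> - 1"
  have c: "c \<ge> 0" using th by (simp add: c_def)
  have a0: "a i \<ge> 0" if "i \<in> T" for i
    using pr[of "{i}"] that measure_nonneg[of M] by (simp, meson order_trans)
  have eq: "exp (\<theta> * card {i\<in>T. x \<in> B i}) =
      (\<Sum>S\<in>Pow T. c ^ card S * indicator {x \<in> space M. \<forall>i\<in>S. x \<in> B i} x)" if "x \<in> space M" for x
  proof -
    have "exp (\<theta> * card {i\<in>T. x \<in> B i}) = (\<Prod>i\<in>{i\<in>T. x \<in> B i}. exp \<theta>)"
      by (simp add: exp_of_nat_mult[symmetric] mult.commute)
    also have "\<dots> = (\<Prod>i\<in>T. if x \<in> B i then exp \<theta> else 1)"
      by (intro prod.mono_neutral_cong_left) (use fin in auto)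
    also have "\<dots> = (\<Prod>i\<in>T. c * indicator (B i) x + 1)"
      by (intro prod.cong) (auto simp: c_def)
    also have "\<dots> = (\<Sum>S\<in>Pow T. (\<Prod>i\<in>S. c * indicator (B i) x))"
      by (subst prod_add[OF fin]) simp
    also have "\<dots> = (\<Sum>S\<in>Pow T. c ^ card S * indicator {x \<in> space M. \<forall>i\<in>S. x \<in> B i} x)"
    proof (intro sum.cong refl)
      fix S assume "S \<in> Pow T"
      hence "finite S" using fin finite_subset by blast
      hence "(\<Prod>i\<in>S. indicator (B i) x :: real) = (if \<forall>i\<in>S. x \<in> B i then 1 else 0)"
        by (auto intro!: prod_zero bexI simp: indicator_def)
      thus "(\<Prod>i\<in>S. c * indicator (B i) x) = c ^ card S * indicator {x \<in> space M. \<forall>i\<in>S. x \<in> B i} x"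
        using that by (simp add: prod.distrib indicator_def)
    qed
    finally show ?thesis .
  qed
  have ev: "{x \<in> space M. \<forall>i\<in>S. x \<in> B i} \<in> events" if "S \<subseteq> T" for S
  proof -
    have "{x \<in> space M. \<forall>i\<in>S. x \<in> B i} = space M \<inter> (\<Inter>i\<in>S. B i)" by auto
    also have "\<dots> \<in> events"
      by (cases "S = {}") (use that fin B in \<open>auto intro!: sets.finite_INT sets.Int dest: finite_subset\<close>)
    finally show ?thesis .
  qed
  have int: "integrable M (\<lambda>x. \<Sum>S\<in>Pow T. c ^ card S * indicator {x \<in> space M. \<forall>i\<in>S. x \<in> B i} x)"
    by (intro Bochner_Integration.integrable_sum integrable_mult_right integrable_real_indicator)
       (use ev in \<open>auto simp: emeasure_eq_measure\<close>)
  show "integrable M (\<lambda>x. exp (\<theta> * card {i\<in>T. x \<in> B i}))"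
    using int by (subst Bochner_Integration.integrable_cong[OF refl eq])
  have "expectation (\<lambda>x. exp (\<theta> * card {i\<in>T. x \<in> B i})) =
      expectation (\<lambda>x. \<Sum>S\<in>Pow T. c ^ card S * indicator {x \<in> space M. \<forall>i\<in>S. x \<in> B i} x)"
    by (rule Bochner_Integration.integral_cong[OF refl eq])
  also have "\<dots> = (\<Sum>S\<in>Pow T. expectation (\<lambda>x. c ^ card S * indicator {x \<in> space M. \<forall>i\<in>S. x \<in> B i} x))"
    by (intro Bochner_Integration.integral_sum integrable_mult_right integrable_real_indicator)
       (use ev in \<open>auto simp: emeasure_eq_measure\<close>)
  also have "\<dots> = (\<Sum>S\<in>Pow T. c ^ card S * prob {x \<in> space M. \<forall>i\<in>S. x \<in> B i})"
    by (intro sum.cong refl) (use ev in \<open>simp add: Int_absorb2\<close>)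
  also have "\<dots> \<le> (\<Sum>S\<in>Pow T. c ^ card S * prod a S)"
    by (intro sum_mono mult_left_mono pr) (use c in auto)
  also have "\<dots> = (\<Prod>i\<in>T. c * a i + 1)"
    by (subst prod_add[OF fin]) (simp add: prod.distrib)
  also have "\<dots> \<le> (\<Prod>i\<in>T. exp (c * a i))"
    by (intro prod_mono) (use c a0 in \<open>auto simp: add.commute exp_ge_add_one_self_aux\<close>)
  also have "\<dots> = exp (c * sum a T)"
    by (simp add: exp_sum[OF fin] sum_distrib_left)
  finally show "expectation (\<lambda>x. exp (\<theta> * card {i\<in>T. x \<in> B i})) \<le> exp ((exp \<theta> - 1) * sum a T)"
    by (simp add: c_def)
qed

section \<open>The increasing enumeration of the primes and divisibility in {1..n}\<close>

lemma infinite_primes_nat: "infinite {p::nat. prime p}"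
  using primes_infinite by blast

lemma prime_prime_seq [simp]: "prime (prime_seq i)"
  unfolding prime_seq_def using enumerate_in_set[OF infinite_primes_nat] by blast

lemma prime_seq_gt_1: "prime_seq i > 1"
  using prime_prime_seq prime_gt_1_nat by blast

text \<open>The growth estimate behind two facts: the squares of 1/p_i beyond k sum to at most 1/k,
  and a prime dividing a number in {1..n} has index below n.\<close>

lemma prime_seq_gt:
  assumes "i \<ge> 1" shows "prime_seq i > i"
proof -
  have "enumerate {p::nat. prime p} m \<ge> m + 2" for m
  proof (induction m)
    case 0
    have "enumerate {p::nat. prime p} 0 \<in> {p::nat. prime p}"
      by (rule enumerate_in_set[OF infinite_primes_nat])
    hence "prime (enumerate {p::nat. prime p} 0)" by (rule CollectD)
    from prime_ge_2_nat[OF this] show ?case by simp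
  next
    case (Suc m)
    thus ?case using enumerate_step[OF infinite_primes_nat, of m] by simp
  qed
  from this[of "i - 1"] assms show ?thesis by (simp add: prime_seq_def)
qed

text \<open>Truncated subtraction makes \<open>prime_seq 0\<close> equal to
  \<open>prime_seq 1\<close>, so index 0 has to be excluded. This is the origin of the conditions
  \<open>0 \<notin> S\<close> below.\<close>

lemma prime_seq_inj:
  assumes "i \<ge> 1" "j \<ge> 1" "prime_seq i = prime_seq j" shows "i = j"
  using assms inj_enumerate[OF infinite_primes_nat] unfolding prime_seq_def
  by (metis One_nat_def Suc_pred injD less_eq_Suc_le)

lemma prime_seq_surj:
  assumes "prime p" obtains i where "i \<ge> 1" "prime_seq i = p"
proof -
  obtain m where "enumerate {p::nat. prime p} m = p"
    using enumerate_Ex[of "{p::nat. prime p}" p] infinite_primes_nat assms by auto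
  thus ?thesis using that[of "Suc m"] by (simp add: prime_seq_def)
qed

lemma prod_prime_seq_dvd_iff:
  assumes "finite S" "0 \<notin> S"
  shows "(\<Prod>i\<in>S. prime_seq i) dvd m \<longleftrightarrow> (\<forall>i\<in>S. prime_seq i dvd m)"
  using assms
proof (induction S)
  case (insert i S)
  have "coprime (prime_seq i) (\<Prod>j\<in>S. prime_seq j)"
  proof (intro prod_coprime_right)
    fix j assume "j \<in> S"
    hence "prime_seq i \<noteq> prime_seq j" using insert.hyps insert.prems prime_seq_inj[of i j]
      by (metis One_nat_def Suc_leI insertCI neq0_conv)
    thus "coprime (prime_seq i) (prime_seq j)" by (simp add: primes_coprime)
  qed
  thus ?case using insert by (auto intro: divides_mult dest: dvd_mult_left dvd_mult_right)
qed auto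

lemma card_multiples:
  assumes "d > 0" shows "card {m\<in>{1..n}. d dvd m} = n div (d::nat)"
proof -
  have "{m\<in>{1..n}. d dvd m} = (\<lambda>j. d * j) ` {1..n div d}"
  proof (intro equalityI subsetI)
    fix m assume "m \<in> {m\<in>{1..n}. d dvd m}"
    then obtain j where j: "m = d * j" "1 \<le> m" "m \<le> n" by auto
    hence "j \<le> n div d" using assms by (simp add: less_eq_div_iff_mult_less_eq mult.commute)
    moreover have "j \<ge> 1" using j by (cases j) auto
    ultimately show "m \<in> (\<lambda>j. d * j) ` {1..n div d}" using j by auto
  next
    fix m assume "m \<in> (\<lambda>j. d * j) ` {1..n div d}"
    thus "m \<in> {m\<in>{1..n}. d dvd m}" using assms
      by (auto simp: less_eq_div_iff_mult_less_eq mult.commute)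
  qed
  thus ?thesis using assms by (simp add: card_image inj_on_def)
qed

abbreviation unif :: "nat \<Rightarrow> nat pmf" where "unif n \<equiv> pmf_of_set {1..n}"

lemma prob_unif:
  assumes "n > 0" shows "measure_pmf.prob (unif n) {m. P m} = card {m\<in>{1..n}. P m} / n"
  using assms by (subst measure_pmf_of_set) (auto simp: Int_def)

text \<open>A product d of distinct primes divides floor(n/d) of the numbers up to n. Rounding down
  only helps, so independence holds as an inequality for every n.\<close>

lemma prob_unif_dvd_le:
  assumes "n > 0" "finite S" "0 \<notin> S"
  shows "measure_pmf.prob (unif n) {m. \<forall>i\<in>S. prime_seq i dvd m} \<le> (\<Prod>i\<in>S. 1 / prime_seq i)"
proof -
  define d where "d = (\<Prod>i\<in>S. prime_seq i)"
  have d: "d > 0" by (simp add: d_def prime_gt_0_nat prod_pos)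
  have "measure_pmf.prob (unif n) {m. \<forall>i\<in>S. prime_seq i dvd m} = (n div d) / n"
    unfolding prob_unif[OF assms(1)] prod_prime_seq_dvd_iff[OF assms(2,3), symmetric]
      d_def[symmetric] card_multiples[OF d] ..
  also have "\<dots> \<le> (n / d) / n"
    by (intro divide_right_mono) (auto simp: of_nat_div_le_of_nat)
  also have "\<dots> = 1 / d" using assms by simp
  also have "\<dots> = (\<Prod>i\<in>S. 1 / prime_seq i)" by (simp add: d_def prod_dividef)
  finally show ?thesis .
qed

lemma sum_inverse_squares_le:
  assumes "k \<ge> 1" shows "(\<Sum>i\<in>{k<..K}. 1 / real i ^ 2) \<le> 1 / k"
proof -
  \<comment> \<open>The telescoping remainder 1/K closes the induction; the case distinction covers
    the empty sums with K < k.\<close>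
  have "(\<Sum>i\<in>{k<..K}. 1 / real i ^ 2) \<le> 1 / k - (if K \<ge> k then 1 / K else 0)"
  proof (induction K)
    case (Suc K)
    show ?case
    proof (cases "Suc K > k")
      case True
      hence "{k<..Suc K} = insert (Suc K) {k<..K}" by auto
      hence "(\<Sum>i\<in>{k<..Suc K}. 1 / real i ^ 2) = 1 / real (Suc K) ^ 2 + (\<Sum>i\<in>{k<..K}. 1 / real i ^ 2)"
        by simp
      also have "\<dots> \<le> 1 / real (Suc K) ^ 2 + (1 / k - 1 / K)" using Suc True by simp
      also have "1 / real (Suc K) ^ 2 \<le> 1 / K - 1 / Suc K"
      proof -
        have "1 / real K - 1 / Suc K = 1 / (real K * Suc K)" using True assms by (simp add: field_simps)
        moreover have "1 / real (Suc K) ^ 2 \<le> 1 / (real K * Suc K)"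
          unfolding power2_eq_square using True assms by (intro divide_left_mono mult_right_mono) auto
        ultimately show ?thesis by simp
      qed
      finally show ?thesis using True by simp
    next
      case False
      thus ?thesis using assms by auto
    qed
  qed (use assms in auto)
  also have "\<dots> \<le> 1 / k" by simp
  finally show ?thesis .
qed

text \<open>Where q i \<le> A/p_i, the square is at most A^2/i^2; elsewhere (q i)^2 \<le> q i. Being
  deterministic, the split serves both the sampled frequencies and the digit probabilities of a
  law.\<close>

lemma sum_squares_le_split:
  assumes "k \<ge> 1" "A \<ge> 0" and q: "\<And>i. i \<in> {k<..K} \<Longrightarrow> 0 \<le> q i \<and> q i \<le> 1"
  shows "(\<Sum>i\<in>{k<..K}. (q i)\<^sup>2) \<le>
    A\<^sup>2 / k + (\<Sum>i\<in>{i\<in>{k<..K}. q i > A / prime_seq i}. q i)"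
proof -
  have "(\<Sum>i\<in>{k<..K}. (q i)\<^sup>2) \<le>
      (\<Sum>i\<in>{k<..K}. A\<^sup>2 * (1 / real i ^ 2) + (if q i > A / prime_seq i then q i else 0))"
  proof (intro sum_mono)
    fix i assume i: "i \<in> {k<..K}"
    show "(q i)\<^sup>2 \<le> A\<^sup>2 * (1 / real i ^ 2) + (if q i > A / prime_seq i then q i else 0)"
    proof (cases "q i > A / prime_seq i")
      case True
      have "(q i)\<^sup>2 \<le> q i" using q[OF i] by (simp add: power2_eq_square mult_left_le)
      thus ?thesis using True by (simp add: add_increasing)
    next
      case False
      hence "q i \<le> A / prime_seq i" by simp
      also have "\<dots> \<le> A / i" using prime_seq_gt[of i] i assms by (intro divide_left_mono) auto
      finally have "(q i)\<^sup>2 \<le> (A / i)\<^sup>2" using q[OF i] by (intro power_mono) auto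
      thus ?thesis using False by (simp add: power_divide)
    qed
  qed
  also have "\<dots> = A\<^sup>2 * (\<Sum>i\<in>{k<..K}. 1 / real i ^ 2) + (\<Sum>i\<in>{i\<in>{k<..K}. q i > A / prime_seq i}. q i)"
    by (simp add: sum.distrib sum_distrib_left sum.If_cases Int_def)
  also have "A\<^sup>2 * (\<Sum>i\<in>{k<..K}. 1 / real i ^ 2) \<le> A\<^sup>2 * (1 / k)"
    using sum_inverse_squares_le[OF assms(1)] by (intro mult_left_mono) auto
  finally show ?thesis by simp
qed

section \<open>Superexponential bound for the squared frequencies of large primes\<close>

abbreviation sample :: "nat \<Rightarrow> (nat \<Rightarrow> nat) pmf" where
  "sample n \<equiv> Pi_pmf {..<n} 0 (\<lambda>_. unif n)"

definition frac_dvd :: "nat \<Rightarrow> (nat \<Rightarrow> nat) \<Rightarrow> nat \<Rightarrow> real" where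
  "frac_dvd n X i = card {j\<in>{..<n}. prime_seq i dvd X j} / n"

text \<open>Markov's inequality for the exponential of \<theta> times the total number of
  divisibilities. On the event, the sum of 1/p_i over T is at most e^(-\<theta>) times the total
  frequency, so the logarithmic moment uses up at most one unit of \<theta>.\<close>

lemma prob_many_multiples_fixed:
  assumes n: "n > 0" and T: "finite T" "0 \<notin> T" and th: "\<theta> \<ge> 1"
  shows "measure_pmf.prob (sample n)
      {X. (\<forall>i\<in>T. frac_dvd n X i > exp \<theta> / prime_seq i) \<and> (\<Sum>i\<in>T. frac_dvd n X i) \<ge> \<epsilon>}
      \<le> exp (- real n * ((\<theta> - 1) * \<epsilon>))" (is "measure_pmf.prob _ ?E \<le> _")
proof -
  let ?a = "\<lambda>i. 1 / real (prime_seq i)"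
  let ?c = "\<lambda>m. card {i\<in>T. m \<in> {m. prime_seq i dvd m}}"
  have h: "measure_pmf.prob (unif n) {x \<in> space (unif n). \<forall>i\<in>S. x \<in> {m. prime_seq i dvd m}} \<le> prod ?a S"
    if "S \<subseteq> T" for S
    using prob_unif_dvd_le[OF n finite_subset[OF that T(1)]] that T(2) by auto
  have int: "integrable (measure_pmf (unif n)) (\<lambda>m. exp (\<theta> * ?c m))"
   and mom: "measure_pmf.expectation (unif n) (\<lambda>m. exp (\<theta> * ?c m)) \<le> exp ((exp \<theta> - 1) * sum ?a T)"
    using measure_pmf.exp_card_moment[where T = T and B = "\<lambda>i. {m. prime_seq i dvd m}" and \<theta> = \<theta> and M = "unif n" and a = ?a]
      h T th by auto
  let ?Y = "\<lambda>X. \<Prod>j<n. exp (\<theta> * ?c (X j))"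
  have intY: "integrable (measure_pmf (sample n)) ?Y"
    using integrable_prod_Pi_pmf[of "{..<n}" "\<lambda>_. unif n" "\<lambda>_ m. exp (\<theta> * ?c m)"] int by simp
  have "measure_pmf.expectation (sample n) ?Y = (\<Prod>j<n. measure_pmf.expectation (unif n) (\<lambda>m. exp (\<theta> * ?c m)))"
    by (rule expectation_prod_Pi_pmf) (use int in auto)
  also have "\<dots> \<le> (\<Prod>j<n. exp ((exp \<theta> - 1) * sum ?a T))"
    by (intro prod_mono conjI mom Bochner_Integration.integral_nonneg) auto
  finally have EY: "measure_pmf.expectation (sample n) ?Y \<le> exp (n * ((exp \<theta> - 1) * sum ?a T))"
    by (simp add: exp_of_nat_mult)
  \<comment> \<open>The moment bound times exp(n (\<theta> - 1) \<epsilon>), so that Markov's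
    inequality yields exactly the claimed probability.\<close>
  define L where "L = exp (n * ((exp \<theta> - 1) * sum ?a T) + n * ((\<theta> - 1) * \<epsilon>))"
  have Y: "?Y X \<ge> L" if "X \<in> ?E" for X
  proof -
    have "(\<Sum>j<n. real (?c (X j))) = (\<Sum>j<n. \<Sum>i\<in>T. if prime_seq i dvd X j then 1 else 0)"
      using T by (intro sum.cong refl) (simp add: sum.If_cases Int_def)
    also have "\<dots> = (\<Sum>i\<in>T. \<Sum>j<n. if prime_seq i dvd X j then 1 else 0)" by (rule sum.swap)
    also have "\<dots> = (\<Sum>i\<in>T. n * frac_dvd n X i)"
      using n by (intro sum.cong refl) (simp add: frac_dvd_def sum.If_cases Int_def)
    finally have c: "(\<Sum>j<n. real (?c (X j))) = n * (\<Sum>i\<in>T. frac_dvd n X i)"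
      by (simp add: sum_distrib_left)
    have "exp \<theta> * sum ?a T \<le> (\<Sum>i\<in>T. frac_dvd n X i)"
      unfolding sum_distrib_left using that by (intro sum_mono) (auto simp: less_imp_le)
    moreover have "sum ?a T \<ge> 0" by (intro sum_nonneg) auto
    moreover have "(\<theta> - 1) * \<epsilon> \<le> (\<theta> - 1) * (\<Sum>i\<in>T. frac_dvd n X i)"
      using that th by (intro mult_left_mono) auto
    ultimately have "(exp \<theta> - 1) * sum ?a T + (\<theta> - 1) * \<epsilon> \<le> \<theta> * (\<Sum>i\<in>T. frac_dvd n X i)"
      by (simp add: algebra_simps)
    hence "real n * ((exp \<theta> - 1) * sum ?a T + (\<theta> - 1) * \<epsilon>) \<le> n * (\<theta> * (\<Sum>i\<in>T. frac_dvd n X i))"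
      by (intro mult_left_mono) auto
    also have "\<dots> = \<theta> * (\<Sum>j<n. real (?c (X j)))" using c by simp
    also have "\<dots> = (\<Sum>j<n. \<theta> * ?c (X j))" by (rule sum_distrib_left)
    finally show ?thesis unfolding L_def exp_sum[symmetric, OF finite_lessThan]
      by (simp add: distrib_left)
  qed
  have "L * measure_pmf.prob (sample n) ?E = measure_pmf.expectation (sample n) (\<lambda>X. L * indicator ?E X)"
    by simp
  also have "\<dots> \<le> measure_pmf.expectation (sample n) ?Y"
  proof (intro integral_mono intY)
    fix X show "L * indicator ?E X \<le> ?Y X"
      using Y[of X] by (cases "X \<in> ?E") (auto intro: prod_nonneg simp: indicator_def)
  next
    show "integrable (measure_pmf (sample n)) (\<lambda>X. L * indicator ?E X)"
      by (intro integrable_mult_right measure_pmf.integrable_const_bound[where B = 1]) auto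
  qed
  also have "\<dots> \<le> exp (n * ((exp \<theta> - 1) * sum ?a T))" by (rule EY)
  finally have "measure_pmf.prob (sample n) ?E \<le> exp (n * ((exp \<theta> - 1) * sum ?a T)) / L"
    by (simp add: L_def field_simps)
  thus ?thesis by (simp add: L_def exp_diff[symmetric])
qed

text \<open>The set of over-represented primes is random, so the bound for a fixed set is summed
  over all subsets of {k<..n}. As k0 does not depend on n and M is arbitrary, the tail is negligible
  at every exponential rate.\<close>

lemma prob_sum_squares_tail:
  assumes e: "\<epsilon> > 0"
  shows "\<exists>k0. \<forall>k\<ge>k0. \<forall>n>0. measure_pmf.prob (sample n) {X. (\<Sum>i\<in>{k<..n}. (frac_dvd n X i)\<^sup>2) > \<epsilon>} \<le> exp (- real n * M)"
proof -
  \<comment> \<open>Chosen so that (\<theta> - 1) \<epsilon>/2 = |M| + ln 2; the ln 2 pays for the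
    at most 2^n subsets.\<close>
  define \<theta> where "\<theta> = 1 + (2 / \<epsilon>) * (\<bar>M\<bar> + ln 2)"
  have th: "\<theta> \<ge> 1" using e by (simp add: \<theta>_def)
  define A where "A = exp \<theta>"
  \<comment> \<open>From k0 on, the primes of ordinary frequency contribute at most A^2/k \<le>
    \<epsilon>/2.\<close>
  obtain k0 where k0: "real k0 > 2 * A\<^sup>2 / \<epsilon>" using reals_Archimedean2 by blast
  show ?thesis
  proof (intro exI[of _ "max 1 k0"] allI impI)
    fix k n :: nat assume k: "k \<ge> max 1 k0" and n: "n > 0"
    let ?T = "\<lambda>X. {i\<in>{k<..n}. frac_dvd n X i > A / prime_seq i}"
    let ?E = "\<lambda>T. {X. (\<forall>i\<in>T. frac_dvd n X i > A / prime_seq i) \<and> (\<Sum>i\<in>T. frac_dvd n X i) \<ge> \<epsilon> / 2}"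
    have "2 * A\<^sup>2 / \<epsilon> < real k" using k0 k by linarith
    hence Ak: "A\<^sup>2 / k \<le> \<epsilon> / 2" using e k by (simp add: field_simps)
    have sub: "{X. (\<Sum>i\<in>{k<..n}. (frac_dvd n X i)\<^sup>2) > \<epsilon>} \<subseteq> (\<Union>T\<in>Pow {k<..n}. ?E T)"
    proof
      fix X assume X: "X \<in> {X. (\<Sum>i\<in>{k<..n}. (frac_dvd n X i)\<^sup>2) > \<epsilon>}"
      have "(\<Sum>i\<in>{k<..n}. (frac_dvd n X i)\<^sup>2) \<le> A\<^sup>2 / k + (\<Sum>i\<in>?T X. frac_dvd n X i)"
      proof (rule sum_squares_le_split)
        fix i
        have "card {j\<in>{..<n}. prime_seq i dvd X j} \<le> card {..<n}" by (intro card_mono) auto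
        thus "0 \<le> frac_dvd n X i \<and> frac_dvd n X i \<le> 1" using n by (simp add: frac_dvd_def)
      qed (use k in \<open>auto simp: A_def\<close>)
      moreover have "\<epsilon> < (\<Sum>i\<in>{k<..n}. (frac_dvd n X i)\<^sup>2)" using X by simp
      ultimately have "(\<Sum>i\<in>?T X. frac_dvd n X i) \<ge> \<epsilon> / 2" using Ak by linarith
      hence "X \<in> ?E (?T X)" by blast
      moreover have "?T X \<in> Pow {k<..n}" by auto
      ultimately show "X \<in> (\<Union>T\<in>Pow {k<..n}. ?E T)" by (rule UN_I[rotated])
    qed
    have "measure_pmf.prob (sample n) {X. (\<Sum>i\<in>{k<..n}. (frac_dvd n X i)\<^sup>2) > \<epsilon>} \<le>
        measure_pmf.prob (sample n) (\<Union>T\<in>Pow {k<..n}. ?E T)"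
      by (intro measure_pmf.finite_measure_mono sub) auto
    also have "\<dots> \<le> (\<Sum>T\<in>Pow {k<..n}. measure_pmf.prob (sample n) (?E T))"
      by (intro measure_pmf.finite_measure_subadditive_finite) auto
    also have "\<dots> \<le> (\<Sum>T\<in>Pow {k<..n}. exp (- real n * ((\<theta> - 1) * (\<epsilon> / 2))))"
      unfolding A_def by (intro sum_mono prob_many_multiples_fixed n th) (auto dest: finite_subset)
    also have "\<dots> = 2 ^ (n - k) * exp (- real n * (\<bar>M\<bar> + ln 2))"
      using e by (simp add: card_Pow \<theta>_def)
    also have "\<dots> \<le> 2 ^ n * exp (- real n * (\<bar>M\<bar> + ln 2))"
      by (intro mult_right_mono power_increasing) auto
    also have "2 ^ n = exp (real n * ln 2)" by (simp add: exp_of_nat_mult)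
    also have "exp (real n * ln 2) * exp (- real n * (\<bar>M\<bar> + ln 2)) = exp (- real n * \<bar>M\<bar>)"
      by (simp add: exp_add[symmetric] algebra_simps)
    also have "\<dots> \<le> exp (- real n * M)" by (simp add: mult_left_mono)
    finally show "measure_pmf.prob (sample n) {X. (\<Sum>i\<in>{k<..n}. (frac_dvd n X i)\<^sup>2) > \<epsilon>} \<le> exp (- real n * M)" .
  qed
qed

section \<open>Limiting joint law of divisibility by the first k primes\<close>

definition prime_idx :: "nat \<Rightarrow> nat \<Rightarrow> nat set" where
  "prime_idx k m = {i\<in>{1..k}. prime_seq i dvd m}"

text \<open>The law of the first k digits under \<open>nu\<close> (see \<open>marg_nu\<close>) and
  at the same time the limit law of \<open>prime_idx k\<close> of a uniform integer; this double
  role links the samples to \<open>nu\<close>.\<close>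

definition wt :: "nat \<Rightarrow> nat set \<Rightarrow> real" where
  "wt k S = (\<Prod>i\<in>{1..k}. if i \<in> S then 1 / prime_seq i else 1 - 1 / prime_seq i)"

lemma wt_pos: "wt k S > 0"
  unfolding wt_def using prime_seq_gt_1 by (intro prod_pos) (auto simp: prime_gt_0_nat)

text \<open>Inclusion-exclusion, one excluded prime at a time: forbidding t subtracts the
  probability of the pattern in which t is required. Hence the induction on T with S
  arbitrary.\<close>

lemma density_divisibility_pattern:
  assumes "finite T" "finite S" "0 \<notin> S \<union> T" "S \<inter> T = {}"
  shows "(\<lambda>n. measure_pmf.prob (unif n) {m. (\<forall>i\<in>S. prime_seq i dvd m) \<and> (\<forall>i\<in>T. \<not> prime_seq i dvd m)})
    \<longlonglongrightarrow> (\<Prod>i\<in>S. 1 / prime_seq i) * (\<Prod>i\<in>T. 1 - 1 / prime_seq i)"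
  using assms
proof (induction T arbitrary: S)
  case empty
  define d where "d = (\<Prod>i\<in>S. prime_seq i)"
  have d: "d > 0" by (simp add: d_def prime_gt_0_nat prod_pos)
  have "(\<lambda>n. real (n div d) / n) \<longlonglongrightarrow> 1 / d"
  \<comment> \<open>Rounding n/d down costs at most 1, that is at most 1/n after division.\<close>
  proof (rule tendsto_sandwich[of "\<lambda>n. 1 / d - 1 / real n"])
    show "\<forall>\<^sub>F n in sequentially. 1 / d - 1 / real n \<le> real (n div d) / n"
      using eventually_gt_at_top[of 0]
    proof eventually_elim
      case (elim n)
      have "n = d * (n div d) + n mod d" by simp
      also have "\<dots> \<le> d * (n div d) + d" using d by (intro add_left_mono) (simp add: less_imp_le)
      finally have "real n \<le> d * (n div d) + d" by (metis of_nat_add of_nat_le_iff of_nat_mult)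
      hence "real n / (d * n) \<le> (d * (n div d) + d) / (d * n)" by (intro divide_right_mono) auto
      thus ?case using elim d by (simp add: add_divide_distrib)
    qed
    show "\<forall>\<^sub>F n in sequentially. real (n div d) / n \<le> 1 / d"
      using eventually_gt_at_top[of 0]
    proof eventually_elim
      case (elim n)
      have "real (n div d) / n \<le> (n / d) / n" by (intro divide_right_mono) (auto simp: of_nat_div_le_of_nat)
      thus ?case using elim by simp
    qed
    show "(\<lambda>n. 1 / d - 1 / real n) \<longlonglongrightarrow> 1 / d"
      using tendsto_diff[OF tendsto_const[of "1 / real d"] lim_1_over_n] by simp
  qed auto
  moreover have "\<forall>\<^sub>F n in sequentially. real (n div d) / n = measure_pmf.prob (unif n) {m. \<forall>i\<in>S. prime_seq i dvd m}"
    using eventually_gt_at_top[of 0]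
    by eventually_elim
      (use empty d in \<open>simp add: prob_unif[unfolded One_nat_def] prod_prime_seq_dvd_iff[symmetric]
         d_def[symmetric] card_multiples[unfolded One_nat_def, simplified]\<close>)
  ultimately show ?case
    by (simp add: d_def prod_dividef Lim_transform_eventually)
next
  case (insert t T)
  let ?P = "\<lambda>n S T. measure_pmf.prob (unif n) {m. (\<forall>i\<in>S. prime_seq i dvd m) \<and> (\<forall>i\<in>T. \<not> prime_seq i dvd m)}"
  have eq: "?P n S (insert t T) = ?P n S T - ?P n (insert t S) T" for n
  proof -
    have "{m. (\<forall>i\<in>S. prime_seq i dvd m) \<and> (\<forall>i\<in>insert t T. \<not> prime_seq i dvd m)} =
        {m. (\<forall>i\<in>S. prime_seq i dvd m) \<and> (\<forall>i\<in>T. \<not> prime_seq i dvd m)} -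
        {m. (\<forall>i\<in>insert t S. prime_seq i dvd m) \<and> (\<forall>i\<in>T. \<not> prime_seq i dvd m)}" by auto
    thus ?thesis by (subst measure_pmf.finite_measure_Diff[symmetric]) (auto intro!: arg_cong[of _ _ "measure_pmf.prob _"])
  qed
  have "(\<lambda>n. ?P n S T - ?P n (insert t S) T) \<longlonglongrightarrow>
     (\<Prod>i\<in>S. 1 / prime_seq i) * (\<Prod>i\<in>T. 1 - 1 / prime_seq i) -
     (\<Prod>i\<in>insert t S. 1 / prime_seq i) * (\<Prod>i\<in>T. 1 - 1 / prime_seq i)"
    by (intro tendsto_diff insert.IH) (use insert in auto)
  also have "(\<Prod>i\<in>S. 1 / prime_seq i) * (\<Prod>i\<in>T. 1 - 1 / prime_seq i) -
     (\<Prod>i\<in>insert t S. 1 / prime_seq i) * (\<Prod>i\<in>T. 1 - 1 / prime_seq i) =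
     (\<Prod>i\<in>S. 1 / prime_seq i) * (\<Prod>i\<in>insert t T. 1 - 1 / real (prime_seq i))"
  proof -
    have "t \<notin> S" "finite S" "t \<notin> T" "finite T" using insert by auto
    thus ?thesis by (simp add: algebra_simps diff_divide_distrib)
  qed
  finally show ?case unfolding eq .
qed

lemma pmf_prime_idx_tendsto:
  assumes "S \<subseteq> {1..k}"
  shows "(\<lambda>n. pmf (map_pmf (prime_idx k) (unif n)) S) \<longlonglongrightarrow> wt k S"
proof -
  have "(\<lambda>n. measure_pmf.prob (unif n) {m. (\<forall>i\<in>S. prime_seq i dvd m) \<and> (\<forall>i\<in>{1..k} - S. \<not> prime_seq i dvd m)})
    \<longlonglongrightarrow> (\<Prod>i\<in>S. 1 / prime_seq i) * (\<Prod>i\<in>{1..k} - S. 1 - 1 / prime_seq i)"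
    by (intro density_divisibility_pattern) (use assms in \<open>auto dest: finite_subset\<close>)
  also have "(\<lambda>n. measure_pmf.prob (unif n) {m. (\<forall>i\<in>S. prime_seq i dvd m) \<and> (\<forall>i\<in>{1..k} - S. \<not> prime_seq i dvd m)})
     = (\<lambda>n. pmf (map_pmf (prime_idx k) (unif n)) S)"
    using assms by (intro ext) (auto simp: pmf_map prime_idx_def vimage_def intro!: arg_cong[of _ _ "measure_pmf.prob _"])
  also have "(\<Prod>i\<in>S. 1 / prime_seq i) * (\<Prod>i\<in>{1..k} - S. 1 - 1 / real (prime_seq i)) = wt k S"
  proof -
    have "{1..k} \<inter> S = S" "{1..k} \<inter> - S = {1..k} - S" using assms by auto
    thus ?thesis unfolding wt_def by (subst prod.If_cases) auto
  qed
  finally show ?thesis .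
qed

section \<open>Sanov's theorem for a triangular array on a finite alphabet\<close>

definition emp :: "nat \<Rightarrow> (nat \<Rightarrow> 'a) \<Rightarrow> 'a \<Rightarrow> real" where
  "emp n s a = card {i\<in>{..<n}. s i = a} / n"

text \<open>Terms with \<open>q a = 0\<close> vanish, the usual convention 0 ln 0 = 0. The estimates
  below take w positive on A, so no infinite value is concealed.\<close>

definition KL :: "'a set \<Rightarrow> ('a \<Rightarrow> real) \<Rightarrow> ('a \<Rightarrow> real) \<Rightarrow> real" where
  "KL A q w = (\<Sum>a\<in>A. q a * ln (q a / w a))"

definition distr_on :: "'a set \<Rightarrow> ('a \<Rightarrow> real) \<Rightarrow> bool" where
  "distr_on A q \<longleftrightarrow> (\<forall>a\<in>A. 0 \<le> q a) \<and> sum q A = 1"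

lemma distr_on_le_1:
  assumes "finite A" "distr_on A q" "a \<in> A" shows "q a \<le> 1"
  using assms member_le_sum[of a A q] by (auto simp: distr_on_def)

lemma sum_emp:
  fixes h :: "'a \<Rightarrow> real"
  assumes "n > 0" "finite A" "s ` {..<n} \<subseteq> A"
  shows "(\<Sum>i<n. h (s i)) = n * (\<Sum>a\<in>A. emp n s a * h a)"
proof -
  have "(\<Sum>i<n. h (s i)) = (\<Sum>a\<in>A. \<Sum>i\<in>{i\<in>{..<n}. s i = a}. h (s i))"
    by (rule sum.group[symmetric]) (use assms in auto)
  also have "\<dots> = (\<Sum>a\<in>A. n * (emp n s a * h a))"
    using assms by (intro sum.cong refl) (simp add: emp_def)
  finally show ?thesis by (simp add: sum_distrib_left)
qed

lemma distr_on_emp: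
  assumes "n > 0" "finite A" "s ` {..<n} \<subseteq> A"
  shows "distr_on A (emp n s)"
  using sum_emp[OF assms, of "\<lambda>_. 1"] assms(1) by (simp add: distr_on_def emp_def)

lemma emp_pos:
  assumes "i < n" shows "emp n s (s i) > 0"
proof -
  have "card {j\<in>{..<n}. s j = s i} > 0" using assms by (subst card_gt_0_iff) auto
  thus ?thesis using assms by (simp add: emp_def)
qed

text \<open>The logarithmic likelihood ratio is additive over positions, hence a function of the
  type alone. The upper bound uses it with r the type itself, the lower bound with r the target
  law.\<close>

lemma prod_change_of_measure:
  assumes "n > 0" "finite A" "s ` {..<n} \<subseteq> A"
    and "\<And>i. i < n \<Longrightarrow> q (s i) > 0" "\<And>i. i < n \<Longrightarrow> r (s i) > 0"
  shows "(\<Prod>i<n. q (s i)) = exp (- real n * (\<Sum>a\<in>A. emp n s a * ln (r a / q a))) * (\<Prod>i<n. r (s i))"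
proof -
  have "(\<Prod>i<n. q (s i)) = (\<Prod>i<n. exp (- ln (r (s i) / q (s i))) * r (s i))"
  proof (intro prod.cong refl)
    fix i assume "i \<in> {..<n}"
    hence "q (s i) > 0" "r (s i) > 0" using assms by auto
    thus "q (s i) = exp (- ln (r (s i) / q (s i))) * r (s i)" by (simp add: exp_minus)
  qed
  also have "\<dots> = exp (- (\<Sum>i<n. ln (r (s i) / q (s i)))) * (\<Prod>i<n. r (s i))"
    by (simp add: prod.distrib exp_sum sum_negf[symmetric])
  also have "(\<Sum>i<n. ln (r (s i) / q (s i))) = n * (\<Sum>a\<in>A. emp n s a * ln (r a / q a))"
    by (rule sum_emp[OF assms(1-3)])
  finally show ?thesis by simp
qed

lemma set_Pi_pmf_const_subset:
  fixes n :: nat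
  assumes "set_pmf Q \<subseteq> A" "s \<in> set_pmf (Pi_pmf {..<n} d (\<lambda>_. Q))"
  shows "s ` {..<n} \<subseteq> A"
  using assms set_Pi_pmf_subset'[OF finite_lessThan, of n d "\<lambda>_. Q"] by (auto simp: PiE_dflt_def)

lemma finite_set_Pi_pmf_const:
  assumes "finite (set_pmf Q)"
  shows "finite (set_pmf (Pi_pmf {..<n::nat} d (\<lambda>_. Q)))"
  using assms by (intro finite_subset[OF set_Pi_pmf_subset'] finite_PiE_dflt) auto

lemma prob_ge_by_density:
  assumes "finite (set_pmf R)" "c \<ge> 0"
    and "\<And>s. s \<in> set_pmf R \<Longrightarrow> s \<in> E \<Longrightarrow> pmf P s \<ge> c * pmf R s"
  shows "measure_pmf.prob P E \<ge> c * measure_pmf.prob R E"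
proof -
  have "c * measure_pmf.prob R E = (\<Sum>s\<in>E \<inter> set_pmf R. c * pmf R s)"
    using assms(1) by (simp add: measure_measure_pmf_finite[symmetric] sum_distrib_left[symmetric] measure_Int_set_pmf)
  also have "\<dots> \<le> (\<Sum>s\<in>E \<inter> set_pmf R. pmf P s)" by (intro sum_mono assms) auto
  also have "\<dots> = measure_pmf.prob P (E \<inter> set_pmf R)"
    using assms(1) by (simp add: measure_measure_pmf_finite)
  also have "\<dots> \<le> measure_pmf.prob P E" by (intro measure_pmf.finite_measure_mono) auto
  finally show ?thesis .
qed

text \<open>On this class the product of Q and the product of the type of t have the constant
  likelihood ratio exp(-n KL), and the latter gives the class probability at most 1.\<close>

lemma prob_type_class_le:
  assumes n: "n > 0" and A: "finite A" "set_pmf Q = A" and t: "t ` {..<n} \<subseteq> A"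
  shows "measure_pmf.prob (Pi_pmf {..<n} d (\<lambda>_. Q)) {s. emp n s = emp n t}
    \<le> exp (- real n * KL A (emp n t) (pmf Q))" (is "measure_pmf.prob ?P ?E \<le> ?c")
proof -
  \<comment> \<open>The type of t as a law: the value of t at a uniformly chosen position.\<close>
  define r where "r = map_pmf t (pmf_of_set {..<n})"
  let ?R = "Pi_pmf {..<n} d (\<lambda>_. r)"
  have pr: "pmf r a = emp n t a" for a
    using n unfolding r_def pmf_map emp_def
    by (subst measure_pmf_of_set) (auto simp: Int_def lessThan_empty_iff)
  have fin: "finite (set_pmf ?P)" using A by (intro finite_set_Pi_pmf_const) auto
  \<comment> \<open>Here the original law is the reference and the tilted law the larger one, which
    turns \<open>prob_ge_by_density\<close> into an upper bound for the class.\<close>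
  have "(1 / ?c) * measure_pmf.prob ?P ?E \<le> measure_pmf.prob ?R ?E"
  proof (rule prob_ge_by_density[OF fin])
    fix s assume s: "s \<in> set_pmf ?P" "s \<in> ?E"
    have sA: "s ` {..<n} \<subseteq> A" by (rule set_Pi_pmf_const_subset[OF _ s(1)]) (use A in simp)
    have d: "\<forall>x. x \<notin> {..<n} \<longrightarrow> s x = d" using s(1) set_Pi_pmf_subset[of "{..<n}" d] by auto
    have "(\<Prod>i<n. pmf Q (s i)) = exp (- real n * (\<Sum>a\<in>A. emp n s a * ln (pmf r a / pmf Q a))) * (\<Prod>i<n. pmf r (s i))"
    proof (rule prod_change_of_measure[OF n A(1) sA])
      fix i assume i: "i < n"
      show "pmf Q (s i) > 0" using sA A i by (auto simp: pmf_positive)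
      show "pmf r (s i) > 0" using s(2) i emp_pos[OF i, of s] by (simp add: pr)
    qed
    also have "(\<Sum>a\<in>A. emp n s a * ln (pmf r a / pmf Q a)) = KL A (emp n t) (pmf Q)"
      using s(2) by (simp add: KL_def pr)
    finally have "pmf ?P s = ?c * pmf ?R s" using d by (subst (1 2) pmf_Pi') auto
    thus "pmf ?R s \<ge> 1 / ?c * pmf ?P s" by (simp add: exp_minus field_simps)
  qed simp
  also have "\<dots> \<le> 1" by simp
  finally show ?thesis by (simp add: field_simps)
qed

text \<open>A type is determined by one count in {0..n} per letter, so a union bound over types
  costs only a polynomial factor.\<close>

lemma card_types_le:
  assumes "finite A"
  shows "finite (emp n ` {s. s ` {..<n} \<subseteq> A})" "card (emp n ` {s. s ` {..<n} \<subseteq> A}) \<le> (n + 1) ^ card A"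
proof -
  let ?f = "\<lambda>f a. if a \<in> A then real (f a) / n else 0"
  have sub: "emp n ` {s. s ` {..<n} \<subseteq> A} \<subseteq> ?f ` (A \<rightarrow>\<^sub>E {..n})"
  proof
    fix q assume "q \<in> emp n ` {s. s ` {..<n} \<subseteq> A}"
    then obtain s where s: "s ` {..<n} \<subseteq> A" "q = emp n s" by auto
    have "q a = ?f (restrict (\<lambda>a. card {i\<in>{..<n}. s i = a}) A) a" for a
    proof -
      have "a \<notin> A \<Longrightarrow> {i\<in>{..<n}. s i = a} = {}" using s(1) by auto
      thus ?thesis by (simp add: s(2) emp_def)
    qed
    moreover have "restrict (\<lambda>a. card {i\<in>{..<n}. s i = a}) A \<in> A \<rightarrow>\<^sub>E {..n}"
      using card_mono[of "{..<n}" "{i\<in>{..<n}. s i = _}"] by fastforce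
    ultimately show "q \<in> ?f ` (A \<rightarrow>\<^sub>E {..n})" by blast
  qed
  have fin: "finite (A \<rightarrow>\<^sub>E {..n})" using assms by (intro finite_PiE) auto
  show "finite (emp n ` {s. s ` {..<n} \<subseteq> A})" by (rule finite_subset[OF sub finite_imageI[OF fin]])
  have "card (emp n ` {s. s ` {..<n} \<subseteq> A}) \<le> card (?f ` (A \<rightarrow>\<^sub>E {..n}))"
    by (rule card_mono[OF finite_imageI[OF fin] sub])
  also have "\<dots> \<le> card (A \<rightarrow>\<^sub>E {..n})" by (rule card_image_le[OF fin])
  also have "\<dots> = (n + 1) ^ card A" using assms by (simp add: card_PiE)
  finally show "card (emp n ` {s. s ` {..<n} \<subseteq> A}) \<le> (n + 1) ^ card A" .
qed

lemma prob_emp_le: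
  assumes n: "n > 0" and A: "finite A" "set_pmf Q = A"
    and c: "\<And>q. distr_on A q \<Longrightarrow> E q \<Longrightarrow> KL A q (pmf Q) \<ge> c"
  shows "measure_pmf.prob (Pi_pmf {..<n} d (\<lambda>_. Q)) {s. E (emp n s)} \<le> real ((n + 1) ^ card A) * exp (- real n * c)"
proof -
  let ?P = "Pi_pmf {..<n} d (\<lambda>_. Q)"
  let ?W = "{q \<in> emp n ` {s. s ` {..<n} \<subseteq> A}. E q}"
  have finW: "finite ?W" using card_types_le(1)[OF A(1), of n] by simp
  have "measure_pmf.prob ?P {s. E (emp n s)} = measure_pmf.prob ?P ({s. E (emp n s)} \<inter> set_pmf ?P)"
    by (simp add: measure_Int_set_pmf)
  also have "\<dots> \<le> measure_pmf.prob ?P (\<Union>q\<in>?W. {s. emp n s = q})"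
    using set_Pi_pmf_const_subset[of Q A _ n d] A by (intro measure_pmf.finite_measure_mono) auto
  also have "\<dots> \<le> (\<Sum>q\<in>?W. measure_pmf.prob ?P {s. emp n s = q})"
    by (intro measure_pmf.finite_measure_subadditive_finite finW) auto
  also have "\<dots> \<le> (\<Sum>q\<in>?W. exp (- real n * c))"
  proof (intro sum_mono)
    fix q assume "q \<in> ?W"
    then obtain t where t: "t ` {..<n} \<subseteq> A" "q = emp n t" "E q" by auto
    have "measure_pmf.prob ?P {s. emp n s = q} \<le> exp (- real n * KL A q (pmf Q))"
      unfolding t(2) by (rule prob_type_class_le[OF n A t(1)])
    also have "\<dots> \<le> exp (- real n * c)"
      using c[of q] distr_on_emp[OF n A(1) t(1)] t by (simp add: mult_left_mono)
    finally show "measure_pmf.prob ?P {s. emp n s = q} \<le> exp (- real n * c)" .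
  qed
  also have "\<dots> = card ?W * exp (- real n * c)" by simp
  also have "\<dots> \<le> real ((n + 1) ^ card A) * exp (- real n * c)"
  proof (intro mult_right_mono)
    have "card ?W \<le> card (emp n ` {s. s ` {..<n} \<subseteq> A})"
      using card_types_le(1)[OF A(1), of n] by (intro card_mono) auto
    also have "\<dots> \<le> (n + 1) ^ card A" by (rule card_types_le(2)[OF A(1)])
    finally show "real (card ?W) \<le> real ((n + 1) ^ card A)" by (rule of_nat_mono)
  qed simp
  finally show ?thesis .
qed

text \<open>The two divergences differ by the q-average of ln(v/w), so exchanging the reference law
  costs \<eta> uniformly in q. This is how the varying laws \<open>Q n\<close> of the triangular
  array are replaced by their limit.\<close>

lemma KL_perturb:
  assumes "finite A" "distr_on A q" and "\<And>a. a \<in> A \<Longrightarrow> w a > 0" "\<And>a. a \<in> A \<Longrightarrow> v a > 0"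
    and "\<And>a. a \<in> A \<Longrightarrow> \<bar>ln (v a / w a)\<bar> \<le> \<eta>"
  shows "KL A q v \<ge> KL A q w - \<eta>"
proof -
  have "KL A q w - KL A q v = (\<Sum>a\<in>A. q a * ln (v a / w a))"
    unfolding KL_def sum_subtractf[symmetric]
  proof (intro sum.cong refl)
    fix a assume a: "a \<in> A"
    show "q a * ln (q a / w a) - q a * ln (q a / v a) = q a * ln (v a / w a)"
    proof (cases "q a = 0")
      case False
      hence "q a > 0" using assms(2) a by (auto simp: distr_on_def less_le)
      thus ?thesis using assms(3,4)[OF a] by (simp add: ln_div algebra_simps)
    qed simp
  qed
  also have "\<dots> \<le> (\<Sum>a\<in>A. q a * \<eta>)"
    using assms by (intro sum_mono mult_left_mono) (auto simp: distr_on_def abs_le_iff)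
  also have "\<dots> = \<eta>" using assms(2) by (simp add: distr_on_def sum_distrib_right[symmetric])
  finally show ?thesis by simp
qed

lemma eventually_ln_ratio:
  assumes A: "finite A" and lim: "\<And>a. a \<in> A \<Longrightarrow> (\<lambda>n. pmf (Q n) a) \<longlonglongrightarrow> w a"
    and w: "\<And>a. a \<in> A \<Longrightarrow> w a > 0" and sub: "\<And>n. n > 0 \<Longrightarrow> set_pmf (Q n) \<subseteq> A" and e: "\<eta> > 0"
  shows "\<forall>\<^sub>F n in sequentially. set_pmf (Q n) = A \<and> (\<forall>a\<in>A. \<bar>ln (pmf (Q n) a / w a)\<bar> \<le> \<eta>)"
proof -
  have "\<forall>\<^sub>F n in sequentially. \<forall>a\<in>A. pmf (Q n) a > 0 \<and> \<bar>ln (pmf (Q n) a / w a)\<bar> < \<eta>"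
  proof (intro eventually_ball_finite[OF A] ballI eventually_conj)
    fix a assume a: "a \<in> A"
    show "\<forall>\<^sub>F n in sequentially. pmf (Q n) a > 0" using order_tendstoD(1)[OF lim[OF a] w[OF a]] .
    have "(\<lambda>n. \<bar>ln (pmf (Q n) a / w a)\<bar>) \<longlonglongrightarrow> \<bar>ln (w a / w a)\<bar>"
      using w[OF a] by (intro tendsto_intros lim a) auto
    thus "\<forall>\<^sub>F n in sequentially. \<bar>ln (pmf (Q n) a / w a)\<bar> < \<eta>"
      using w[OF a] e by (intro order_tendstoD(2)) auto
  qed
  thus ?thesis using eventually_gt_at_top[of 0]
    by eventually_elim (use sub in \<open>auto simp: set_pmf_iff less_imp_le\<close>)
qed

lemma sanov_upper:
  assumes A: "finite A" and lim: "\<And>a. a \<in> A \<Longrightarrow> (\<lambda>n. pmf (Q n) a) \<longlonglongrightarrow> w a"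
    and w: "\<And>a. a \<in> A \<Longrightarrow> w a > 0" and sub: "\<And>n. n > 0 \<Longrightarrow> set_pmf (Q n) \<subseteq> A" and e: "\<eta> > 0"
    and c: "\<And>q. distr_on A q \<Longrightarrow> E q \<Longrightarrow> KL A q w \<ge> c"
  shows "\<forall>\<^sub>F n in sequentially.
    measure_pmf.prob (Pi_pmf {..<n} d (\<lambda>_. Q n)) {s. E (emp n s)} \<le> exp (- real n * (c - \<eta>))"
proof -
  \<comment> \<open>Half of \<eta> absorbs the polynomial number of types, the other half the
    replacement of \<open>Q n\<close> by w.\<close>
  have "(\<lambda>n. real (card A) * (ln (real (n + 1)) / real n)) \<longlonglongrightarrow> real (card A) * 0"
    by (intro tendsto_intros) real_asymp
  hence "\<forall>\<^sub>F n in sequentially. real (card A) * (ln (real (n + 1)) / real n) < \<eta> / 2"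
    using e by (intro order_tendstoD(2)) auto
  moreover have "\<forall>\<^sub>F n in sequentially. set_pmf (Q n) = A \<and> (\<forall>a\<in>A. \<bar>ln (pmf (Q n) a / w a)\<bar> \<le> \<eta> / 2)"
    using e by (intro eventually_ln_ratio[OF A lim w sub]) auto
  ultimately show ?thesis using eventually_gt_at_top[of 0]
  proof eventually_elim
    case (elim n)
    have "real (card A) * ln (real (n + 1)) \<le> real n * (\<eta> / 2)"
      using elim by (simp add: field_simps)
    hence "exp (real (card A) * ln (real (n + 1))) \<le> exp (real n * (\<eta> / 2))" by simp
    hence 1: "real ((n + 1) ^ card A) \<le> exp (real n * (\<eta> / 2))" by (simp add: exp_of_nat_mult)
    have "measure_pmf.prob (Pi_pmf {..<n} d (\<lambda>_. Q n)) {s. E (emp n s)} \<le>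
        real ((n + 1) ^ card A) * exp (- real n * (c - \<eta> / 2))"
    proof (rule prob_emp_le)
      fix q assume q: "distr_on A q" "E q"
      have "KL A q (pmf (Q n)) \<ge> KL A q w - \<eta> / 2"
        by (rule KL_perturb[OF A q(1) w]) (use elim in \<open>auto simp: pmf_positive\<close>)
      thus "KL A q (pmf (Q n)) \<ge> c - \<eta> / 2" using c[OF q] by simp
    qed (use elim A in auto)
    also have "\<dots> \<le> exp (real n * (\<eta> / 2)) * exp (- real n * (c - \<eta> / 2))"
      by (rule mult_right_mono[OF 1]) simp
    also have "\<dots> = exp (- real n * (c - \<eta>))" by (simp add: exp_add[symmetric] algebra_simps)
    finally show ?case by simp
  qed
qed

text \<open>The number of positions carrying the letter a is binomial with parameter
  \<open>pmf r a\<close>, so Hoeffding's inequality applies. It supplies the law of large numbers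
  for the lower bound.\<close>

lemma prob_emp_deviation:
  assumes n: "n > 0" and d: "\<delta> \<ge> 0"
  shows "measure_pmf.prob (Pi_pmf {..<n} d (\<lambda>_. r)) {s. \<bar>emp n s a - pmf r a\<bar> \<ge> \<delta>} \<le> 2 * exp (- 2 * real n * \<delta>\<^sup>2)"
proof -
  interpret binomial_distribution n "pmf r a" by unfold_locales (simp add: pmf_le_1)
  have b: "map_pmf (\<lambda>b. b = a) r = bernoulli_pmf (pmf r a)"
  proof (rule pmf_eqI)
    fix x
    have "measure_pmf.prob r {b. b \<noteq> a} = 1 - pmf r a"
    proof -
      have "{b. b \<noteq> a} = space (measure_pmf r) - {a}" by auto
      thus ?thesis using measure_pmf.prob_compl[of "{a}" r] by (simp add: measure_pmf_single)
    qed
    thus "pmf (map_pmf (\<lambda>b. b = a) r) x = pmf (bernoulli_pmf (pmf r a)) x"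
      by (cases x) (simp_all add: pmf_map vimage_def measure_pmf_single pmf_le_1)
  qed
  have "binomial_pmf n (pmf r a) = map_pmf (\<lambda>f. card {i\<in>{..<n}. f i}) (Pi_pmf {..<n} (d = a) (\<lambda>_. bernoulli_pmf (pmf r a)))"
    by (rule binomial_pmf_altdef') (auto simp: pmf_le_1)
  also have "Pi_pmf {..<n} (d = a) (\<lambda>_. bernoulli_pmf (pmf r a)) = map_pmf (\<lambda>h. (\<lambda>b. b = a) \<circ> h) (Pi_pmf {..<n} d (\<lambda>_. r))"
    unfolding b[symmetric] by (rule Pi_pmf_map) auto
  finally have eq: "binomial_pmf n (pmf r a) = map_pmf (\<lambda>s. card {i\<in>{..<n}. s i = a}) (Pi_pmf {..<n} d (\<lambda>_. r))"
    by (simp add: map_pmf_comp o_def)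
  show ?thesis using prob_abs_ge'[OF n d]
    unfolding eq by (simp add: emp_def vimage_def)
qed

text \<open>Tilting: under the product of q the type is eventually close to q with probability at
  least 1/2, and there the likelihood ratio is at least exp(-n (KL + 3/4 \<eta>)). The last quarter
  of \<eta> absorbs the factor 1/2.\<close>

lemma sanov_lower:
  assumes A: "finite A" and lim: "\<And>a. a \<in> A \<Longrightarrow> (\<lambda>n. pmf (Q n) a) \<longlonglongrightarrow> w a"
    and w: "\<And>a. a \<in> A \<Longrightarrow> w a > 0" and sub: "\<And>n. n > 0 \<Longrightarrow> set_pmf (Q n) \<subseteq> A"
    and e: "\<eta> > 0" "\<delta> > 0" and q: "distr_on A q"
  shows "\<forall>\<^sub>F n in sequentially.
    measure_pmf.prob (Pi_pmf {..<n} d (\<lambda>_. Q n)) {s. \<forall>a\<in>A. \<bar>emp n s a - q a\<bar> \<le> \<delta>} \<ge> exp (- real n * (KL A q w + \<eta>))"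
proof -
  define r where "r = embed_pmf (\<lambda>a. if a \<in> A then q a else 0)"
  have pr: "pmf r a = (if a \<in> A then q a else 0)" for a
    unfolding r_def
  proof (rule pmf_embed_pmf)
    have "(\<integral>\<^sup>+ x. ennreal (if x \<in> A then q x else 0) \<partial>count_space UNIV) = (\<Sum>x\<in>A. ennreal (q x))"
      using A by (subst nn_integral_count_space'[of A]) (auto intro!: sum.cong)
    also have "\<dots> = ennreal (sum q A)" using q by (subst sum_ennreal) (auto simp: distr_on_def)
    finally show "(\<integral>\<^sup>+ x. ennreal (if x \<in> A then q x else 0) \<partial>count_space UNIV) = 1"
      using q by (simp add: distr_on_def)
  qed (use q in \<open>auto simp: distr_on_def\<close>)
  have set_r: "set_pmf r \<subseteq> A" by (auto simp: set_pmf_iff pr split: if_splits)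
  define C where "C = (\<Sum>a\<in>A. \<bar>ln (q a / w a)\<bar>)"
  have C: "C \<ge> 0" by (auto simp: C_def intro: sum_nonneg)
  \<comment> \<open>Keeps \<delta>' C below \<eta>/4, the cost of replacing the type by q in the sum
    of logarithms; \<eta>/2 is reserved for replacing \<open>Q n\<close> by w.\<close>
  define \<delta>' where "\<delta>' = min \<delta> (\<eta> / 4 / (C + 1))"
  have d': "\<delta>' > 0" "\<delta>' \<le> \<delta>" using e C by (auto simp: \<delta>'_def)
  have "\<delta>' * C \<le> \<eta> / 4 / (C + 1) * C" using C by (intro mult_right_mono) (auto simp: \<delta>'_def)
  also have "\<dots> \<le> \<eta> / 4" using C e by (simp add: field_simps)
  finally have dC: "\<delta>' * C \<le> \<eta> / 4" .
  let ?E = "\<lambda>n. {s. \<forall>a\<in>A. \<bar>emp n s a - q a\<bar> \<le> \<delta>'}"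
  have "(\<lambda>n. real (card A) * (2 * exp (- 2 * \<delta>'\<^sup>2 * real n))) \<longlonglongrightarrow> real (card A) * 0"
  proof (intro tendsto_intros)
    have "-2 * \<delta>'\<^sup>2 < 0" using d' by simp
    thus "(\<lambda>n. 2 * exp (- 2 * \<delta>'\<^sup>2 * real n)) \<longlonglongrightarrow> 0" by real_asymp
  qed
  hence ev1: "\<forall>\<^sub>F n in sequentially. real (card A) * (2 * exp (- 2 * \<delta>'\<^sup>2 * real n)) < 1/2"
    by (intro order_tendstoD(2)) auto
  have "(\<lambda>n. exp (- (\<eta> / 4) * real n)) \<longlonglongrightarrow> 0" using e by real_asymp
  hence ev2: "\<forall>\<^sub>F n in sequentially. exp (- (\<eta> / 4) * real n) < 1/2"
    by (intro order_tendstoD(2)) auto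
  have ev3: "\<forall>\<^sub>F n in sequentially. set_pmf (Q n) = A \<and> (\<forall>a\<in>A. \<bar>ln (pmf (Q n) a / w a)\<bar> \<le> \<eta> / 2)"
    using e by (intro eventually_ln_ratio[OF A lim w sub]) auto
  show ?thesis using ev1 ev2 ev3 eventually_gt_at_top[of 0]
  proof eventually_elim
    case (elim n)
    let ?P = "Pi_pmf {..<n} d (\<lambda>_. Q n)" and ?R = "Pi_pmf {..<n} d (\<lambda>_. r)"
    have "measure_pmf.prob ?R (- ?E n) \<le> measure_pmf.prob ?R (\<Union>a\<in>A. {s. \<bar>emp n s a - pmf r a\<bar> \<ge> \<delta>'})"
      by (intro measure_pmf.finite_measure_mono) (auto simp: pr not_le intro: less_imp_le)
    also have "\<dots> \<le> (\<Sum>a\<in>A. measure_pmf.prob ?R {s. \<bar>emp n s a - pmf r a\<bar> \<ge> \<delta>'})"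
      by (intro measure_pmf.finite_measure_subadditive_finite A) auto
    also have "\<dots> \<le> (\<Sum>a\<in>A. 2 * exp (- 2 * real n * \<delta>'\<^sup>2))"
      using d' elim by (intro sum_mono prob_emp_deviation) auto
    also have "\<dots> < 1 / 2" using elim by (simp add: mult_ac)
    finally have R: "measure_pmf.prob ?R (?E n) \<ge> 1 / 2"
      using measure_pmf.prob_compl[of "?E n" ?R] by (simp add: Compl_eq_Diff_UNIV)
    let ?c = "exp (- real n * (KL A q w + 3 / 4 * \<eta>))"
    have "?c * measure_pmf.prob ?R (?E n) \<le> measure_pmf.prob ?P (?E n)"
    proof (rule prob_ge_by_density)
      show "finite (set_pmf ?R)" using set_r A by (intro finite_set_Pi_pmf_const) (auto dest: finite_subset)
      fix s assume s: "s \<in> set_pmf ?R" "s \<in> ?E n"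
      have sr: "s ` {..<n} \<subseteq> set_pmf r" by (rule set_Pi_pmf_const_subset[OF subset_refl s(1)])
      hence sA: "s ` {..<n} \<subseteq> A" using set_r by blast
      have d: "\<forall>x. x \<notin> {..<n} \<longrightarrow> s x = d" using s(1) set_Pi_pmf_subset[of "{..<n}" d] by auto
      have "(\<Prod>i<n. pmf (Q n) (s i)) = exp (- real n * (\<Sum>a\<in>A. emp n s a * ln (pmf r a / pmf (Q n) a))) * (\<Prod>i<n. pmf r (s i))"
        using sr sA elim by (intro prod_change_of_measure[OF _ A sA]) (auto simp: pmf_positive)
      moreover have "(\<Sum>a\<in>A. emp n s a * ln (pmf r a / pmf (Q n) a)) \<le> KL A q w + 3 / 4 * \<eta>"
      proof -
        have "(\<Sum>a\<in>A. emp n s a * ln (pmf r a / pmf (Q n) a)) \<le>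
            (\<Sum>a\<in>A. q a * ln (q a / w a) + \<delta>' * \<bar>ln (q a / w a)\<bar> + emp n s a * (\<eta> / 2))"
        proof (intro sum_mono)
          fix a assume a: "a \<in> A"
          have p: "pmf (Q n) a > 0" "w a > 0" using elim a w by (auto simp: pmf_positive)
          have e0: "emp n s a \<ge> 0" by (simp add: emp_def)
          show "emp n s a * ln (pmf r a / pmf (Q n) a) \<le> q a * ln (q a / w a) + \<delta>' * \<bar>ln (q a / w a)\<bar> + emp n s a * (\<eta> / 2)"
          proof (cases "q a = 0")
            \<comment> \<open>The logarithms are \<open>ln 0\<close>, which HOL evaluates to 0, so
              only the nonnegative last summand remains.\<close>
            case True
            thus ?thesis using a e0 e by (simp add: pr)
          next
            case False
            hence qa: "q a > 0" using q a by (auto simp: distr_on_def less_le)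
            have "ln (pmf r a / pmf (Q n) a) = ln (q a / w a) - ln (pmf (Q n) a / w a)"
              using qa p a by (simp add: pr ln_div)
            also have "\<dots> \<le> ln (q a / w a) + \<eta> / 2" using elim a by (auto simp: abs_le_iff)
            finally have "emp n s a * ln (pmf r a / pmf (Q n) a) \<le> emp n s a * (ln (q a / w a) + \<eta> / 2)"
              using e0 by (rule mult_left_mono)
            also have "\<dots> = q a * ln (q a / w a) + (emp n s a - q a) * ln (q a / w a) + emp n s a * (\<eta> / 2)"
              by (simp add: algebra_simps)
            also have "(emp n s a - q a) * ln (q a / w a) \<le> \<bar>emp n s a - q a\<bar> * \<bar>ln (q a / w a)\<bar>"
              by (metis abs_ge_self abs_mult)
            also have "\<dots> \<le> \<delta>' * \<bar>ln (q a / w a)\<bar>" using s(2) a by (intro mult_right_mono) auto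
            finally show ?thesis by simp
          qed
        qed
        also have "\<dots> = KL A q w + \<delta>' * C + \<eta> / 2 * sum (emp n s) A"
          by (simp add: sum.distrib KL_def C_def sum_distrib_left mult_ac)
        also have "sum (emp n s) A = 1" using distr_on_emp[OF _ A sA] elim by (simp add: distr_on_def)
        finally show ?thesis using dC by simp
      qed
      ultimately show "?c * pmf ?R s \<le> pmf ?P s"
        using d by (subst (1 2) pmf_Pi') (auto intro!: mult_right_mono mult_left_mono prod_nonneg)
    qed simp
    hence "?c * (1 / 2) \<le> measure_pmf.prob ?P (?E n)"
      using order_trans[OF mult_left_mono[OF R, of ?c]] by simp
    moreover have "exp (- real n * (KL A q w + \<eta>)) = ?c * exp (- (\<eta> / 4) * real n)"
      by (simp add: exp_add[symmetric] algebra_simps)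
    moreover have "\<dots> \<le> ?c * (1 / 2)" using elim by (intro mult_left_mono) auto
    moreover have "measure_pmf.prob ?P (?E n) \<le> measure_pmf.prob ?P {s. \<forall>a\<in>A. \<bar>emp n s a - q a\<bar> \<le> \<delta>}"
      using d' by (intro measure_pmf.finite_measure_mono) auto
    ultimately show ?case by linarith
  qed
qed

section \<open>Binary digits\<close>

definition digits :: "nat \<Rightarrow> real \<Rightarrow> nat set" where
  "digits k u = {i\<in>{1..k}. bdigit i u = 1}"

text \<open>One functional for both sides: at an empirical law it is the fraction of pairs without a
  common prime among the first k, at a digit marginal it is the truncated double integral.\<close>

definition trunc_frac :: "nat \<Rightarrow> (nat set \<Rightarrow> real) \<Rightarrow> real" where
  "trunc_frac k q = (\<Sum>S\<in>Pow {1..k}. \<Sum>T\<in>Pow {1..k}. if S \<inter> T = {} then q S * q T else 0)"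

definition marg :: "real measure \<Rightarrow> nat \<Rightarrow> nat set \<Rightarrow> real" where
  "marg \<mu> k S = measure \<mu> {u \<in> space \<mu>. digits k u = S}"

definition digit_prob :: "real measure \<Rightarrow> nat \<Rightarrow> real" where
  "digit_prob \<mu> i = measure \<mu> {u \<in> space \<mu>. bdigit i u = 1}"

lemma digits_subset: "digits k u \<in> Pow {1..k}" by (auto simp: digits_def)

lemma digits_eq_iff:
  assumes "S \<in> Pow {1..k}"
  shows "digits k u = S \<longleftrightarrow> (\<forall>i\<in>{1..k}. bdigit i u = 1 \<longleftrightarrow> i \<in> S)"
  using assms unfolding digits_def by blast

lemma measurable_bdigit [measurable]: "bdigit i \<in> borel \<rightarrow>\<^sub>M count_space UNIV"
proof -
  have [measurable]: "(\<lambda>a::real. \<lfloor>a * 2 ^ i\<rfloor>) \<in> borel \<rightarrow>\<^sub>M count_space UNIV"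
    by measurable
  have "(\<lambda>a::real. if a = 1 then 1 else nat (\<lfloor>a * 2 ^ i\<rfloor> mod 2)) \<in> borel \<rightarrow>\<^sub>M count_space UNIV"
    by measurable
  thus ?thesis by (simp add: bdigit_def[abs_def])
qed

locale law01 = prob_space \<mu> for \<mu> :: "real measure" +
  assumes sets_mu [measurable_cong]: "sets \<mu> = sets borel01"
begin

lemma space_mu: "space \<mu> = {0..1}"
  using sets_eq_imp_space_eq[OF sets_mu] by (simp add: borel01_def space_restrict_space)

lemma bdigit_meas [measurable]: "bdigit i \<in> \<mu> \<rightarrow>\<^sub>M count_space UNIV"
  unfolding measurable_cong_sets[OF sets_mu refl] borel01_def
  by (rule measurable_restrict_space1) (rule measurable_bdigit)

lemma digits_meas [measurable]: "digits k \<in> \<mu> \<rightarrow>\<^sub>M count_space (Pow {1..k})"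
proof (subst measurable_count_space_eq2, simp, intro conjI ballI)
  show "digits k \<in> space \<mu> \<rightarrow> Pow {1..k}" using digits_subset by blast
  fix S assume S: "S \<in> Pow {1..k}"
  have "digits k -` {S} \<inter> space \<mu> = {u\<in>space \<mu>. \<forall>i\<in>{1..k}. bdigit i u = 1 \<longleftrightarrow> i \<in> S}"
    using digits_eq_iff[OF S] by blast
  also have "\<dots> \<in> sets \<mu>" by measurable
  finally show "digits k -` {S} \<inter> space \<mu> \<in> sets \<mu>" .
qed

lemma sets_digits [measurable]: "{u \<in> space \<mu>. digits k u = S} \<in> sets \<mu>"
proof (cases "S \<in> Pow {1..k}")
  case True
  have "{u \<in> space \<mu>. digits k u = S} = digits k -` {S} \<inter> space \<mu>" by auto
  thus ?thesis using measurable_sets[OF digits_meas, of "{S}" k] True by simp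
next
  case False
  hence "{u \<in> space \<mu>. digits k u = S} = {}" using digits_subset by blast
  thus ?thesis by (metis sets.empty_sets)
qed

lemma fun_digits_meas [measurable]: "(\<lambda>u. h (digits k u)) \<in> borel_measurable \<mu>"
  by (rule measurable_compose[OF digits_meas]) simp

lemma fun_digits_expand:
  assumes "u \<in> space \<mu>"
  shows "h (digits k u) = (\<Sum>S\<in>Pow {1..k}. h S * indicator {u \<in> space \<mu>. digits k u = S} u :: real)"
proof -
  have "(\<Sum>S\<in>Pow {1..k}. h S * indicator {u \<in> space \<mu>. digits k u = S} u) = (\<Sum>S\<in>Pow {1..k}. if digits k u = S then h S else 0)"
    using assms by (intro sum.cong) auto
  thus ?thesis using digits_subset[of k u] by (simp add: sum.delta)
qed

text \<open>A function of the first k digits is a finite combination of indicators, so its integral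
  becomes a finite sum over the marginal. The iterated integrals of truncated quantities are all
  reduced to this.\<close>

lemma integral_digits:
  fixes h :: "nat set \<Rightarrow> real"
  shows "integrable \<mu> (\<lambda>u. h (digits k u))"
    and "(\<integral>u. h (digits k u) \<partial>\<mu>) = (\<Sum>S\<in>Pow {1..k}. h S * marg \<mu> k S)"
proof -
  have i: "integrable \<mu> (\<lambda>u. h S * indicator {u \<in> space \<mu>. digits k u = S} u)" for S
    by (intro integrable_mult_right integrable_real_indicator) (auto simp: emeasure_eq_measure)
  show "integrable \<mu> (\<lambda>u. h (digits k u))"
    by (rule Bochner_Integration.integrable_cong[OF refl fun_digits_expand, THEN iffD2], assumption)
      (intro Bochner_Integration.integrable_sum i)
  have "(\<integral>u. h (digits k u) \<partial>\<mu>) = (\<integral>u. (\<Sum>S\<in>Pow {1..k}. h S * indicator {u \<in> space \<mu>. digits k u = S} u) \<partial>\<mu>)"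
    by (rule Bochner_Integration.integral_cong[OF refl fun_digits_expand])
  also have "\<dots> = (\<Sum>S\<in>Pow {1..k}. h S * marg \<mu> k S)"
    by (subst Bochner_Integration.integral_sum[OF i]) (simp add: marg_def Int_absorb2)
  finally show "(\<integral>u. h (digits k u) \<partial>\<mu>) = (\<Sum>S\<in>Pow {1..k}. h S * marg \<mu> k S)" .
qed

lemma distr_on_marg: "distr_on (Pow {1..k}) (marg \<mu> k)"
  using integral_digits(2)[of "\<lambda>_. 1" k] prob_space by (simp add: distr_on_def marg_def)

lemma integral_integral_digits:
  fixes h :: "nat set \<Rightarrow> nat set \<Rightarrow> real"
  shows "integrable \<mu> (\<lambda>u. \<integral>v. h (digits k u) (digits k v) \<partial>\<mu>)"
    and "(\<integral>u. (\<integral>v. h (digits k u) (digits k v) \<partial>\<mu>) \<partial>\<mu>) =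
      (\<Sum>S\<in>Pow {1..k}. \<Sum>T\<in>Pow {1..k}. h S T * marg \<mu> k S * marg \<mu> k T)"
proof -
  have eq: "(\<integral>v. h (digits k u) (digits k v) \<partial>\<mu>) = (\<Sum>T\<in>Pow {1..k}. h (digits k u) T * marg \<mu> k T)" for u
    by (rule integral_digits)
  show "integrable \<mu> (\<lambda>u. \<integral>v. h (digits k u) (digits k v) \<partial>\<mu>)"
    unfolding eq by (rule integral_digits)
  show "(\<integral>u. (\<integral>v. h (digits k u) (digits k v) \<partial>\<mu>) \<partial>\<mu>) =
      (\<Sum>S\<in>Pow {1..k}. \<Sum>T\<in>Pow {1..k}. h S T * marg \<mu> k S * marg \<mu> k T)"
    unfolding eq integral_digits(2)[of "\<lambda>S. \<Sum>T\<in>Pow {1..k}. h S T * marg \<mu> k T"]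
    by (simp add: sum_distrib_left sum_distrib_right mult_ac)
qed

abbreviation trunc_fcop :: "nat \<Rightarrow> real \<Rightarrow> real \<Rightarrow> real" where
  "trunc_fcop k u v \<equiv> (if digits k u \<inter> digits k v = {} then 1 else 0)"

lemma integral_trunc_fcop: "(\<integral>u. (\<integral>v. trunc_fcop k u v \<partial>\<mu>) \<partial>\<mu>) = trunc_frac k (marg \<mu> k)"
  using integral_integral_digits(2)[of "\<lambda>S T. if S \<inter> T = {} then 1 else 0" k]
  by (simp add: trunc_frac_def if_distrib[of "\<lambda>x. x * _"] cong: if_cong)

lemma trunc_fcop_antimono: "k \<le> K \<Longrightarrow> trunc_fcop K u v \<le> trunc_fcop k u v"
  by (fastforce simp: digits_def)

lemma digits_restrict: "k \<le> K \<Longrightarrow> digits k u = digits K u \<inter> {1..k}"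
  by (auto simp: digits_def)

lemma marg_pushforward:
  assumes "k \<le> K"
  shows "marg \<mu> k S = (\<Sum>T\<in>Pow {1..K}. if T \<inter> {1..k} = S then marg \<mu> K T else 0)"
proof -
  have "marg \<mu> k S = (\<integral>u. indicator {u\<in>space \<mu>. digits k u = S} u \<partial>\<mu>)"
    by (simp add: marg_def Int_absorb2)
  also have "\<dots> = (\<integral>u. (if digits K u \<inter> {1..k} = S then 1 else 0) \<partial>\<mu>)"
    by (intro Bochner_Integration.integral_cong) (use digits_restrict[OF assms] in auto)
  also have "\<dots> = (\<Sum>T\<in>Pow {1..K}. if T \<inter> {1..k} = S then marg \<mu> K T else 0)"
    by (subst integral_digits(2)[of "\<lambda>T. if T \<inter> {1..k} = S then 1 else 0"])
       (simp add: if_distrib[of "\<lambda>x. x * _"] cong: if_cong)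
  finally show ?thesis .
qed

lemma digit_prob_integral: "(\<integral>u. (if i \<in> digits k u then 1 else 0) \<partial>\<mu>) = (if i \<in> {1..k} then digit_prob \<mu> i else 0)"
proof (cases "i \<in> {1..k}")
  case True
  have "(\<integral>u. (if i \<in> digits k u then 1 else 0 :: real) \<partial>\<mu>) = (\<integral>u. indicator {u\<in>space \<mu>. bdigit i u = 1} u \<partial>\<mu>)"
    by (intro Bochner_Integration.integral_cong) (use True in \<open>auto simp: digits_def\<close>)
  thus ?thesis using True by (simp add: digit_prob_def Int_absorb2)
next
  case False
  hence "i \<notin> digits k u" for u using digits_subset[of k u] by blast
  thus ?thesis using False by auto
qed

lemma trunc_frac_antimono:
  assumes "k \<le> K" shows "trunc_frac K (marg \<mu> K) \<le> trunc_frac k (marg \<mu> k)"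
proof -
  have 1: "trunc_fcop k u v = (\<lambda>S T. if (S \<inter> {1..k}) \<inter> (T \<inter> {1..k}) = {} then 1 else 0) (digits K u) (digits K v)" for u v
    using digits_restrict[OF assms] by simp
  show ?thesis
    unfolding integral_trunc_fcop[symmetric]
  proof (intro integral_mono)
    show "integrable \<mu> (\<lambda>u. \<integral>v. trunc_fcop K u v \<partial>\<mu>)" for K
      by (rule integral_integral_digits(1)[of "\<lambda>S T. if S \<inter> T = {} then 1 else 0"])
    show "integrable \<mu> (\<lambda>u. \<integral>v. trunc_fcop k u v \<partial>\<mu>)"
      by (rule integral_integral_digits(1)[of "\<lambda>S T. if S \<inter> T = {} then 1 else 0"])
    show "integrable \<mu> (\<lambda>v. trunc_fcop k u v)" for u k
      by (rule integral_digits(1)[of "\<lambda>T. if digits k u \<inter> T = {} then 1 else 0"])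
    show "integrable \<mu> (\<lambda>v. trunc_fcop k u v)" for u
      by (rule integral_digits(1)[of "\<lambda>T. if digits k u \<inter> T = {} then 1 else 0"])
  qed (rule trunc_fcop_antimono[OF assms])
qed

text \<open>A collision missed at level k but seen at level K involves a common digit 1 at some i in
  {k<..K}. In the double integral the product of the two digit indicators factorises into the square
  of a digit probability.\<close>

lemma trunc_frac_le_tail:
  assumes "k \<le> K"
  shows "trunc_frac k (marg \<mu> k) \<le> trunc_frac K (marg \<mu> K) + (\<Sum>i\<in>{k<..K}. (digit_prob \<mu> i)\<^sup>2)"
proof -
  let ?c = "\<lambda>i S. if i \<in> S then 1 else 0 :: real"
  let ?g = "\<lambda>S T. (if S \<inter> T = {} then 1 else 0) + (\<Sum>i\<in>{k<..K}. ?c i S * ?c i T)"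
  have "trunc_frac k (marg \<mu> k) \<le> (\<integral>u. (\<integral>v. ?g (digits K u) (digits K v) \<partial>\<mu>) \<partial>\<mu>)"
    unfolding integral_trunc_fcop[symmetric]
  proof (intro integral_mono)
    show "integrable \<mu> (\<lambda>u. \<integral>v. trunc_fcop k u v \<partial>\<mu>)"
      by (rule integral_integral_digits(1)[of "\<lambda>S T. if S \<inter> T = {} then 1 else 0"])
    show "integrable \<mu> (\<lambda>v. trunc_fcop k u v)" for u
      by (rule integral_digits(1)[of "\<lambda>T. if digits k u \<inter> T = {} then 1 else 0"])
    show "integrable \<mu> (\<lambda>u. (\<integral>v. ?g (digits K u) (digits K v) \<partial>\<mu>))"
      by (rule integral_integral_digits(1))
    show "integrable \<mu> (\<lambda>v. ?g (digits K u) (digits K v))" for u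
      by (rule integral_digits(1))
    fix u v
    show "trunc_fcop k u v \<le> ?g (digits K u) (digits K v)"
    \<comment> \<open>Only in this case does the left side exceed the first summand; the collision
      then sits beyond k, where the sum picks up a 1.\<close>
    proof (cases "digits k u \<inter> digits k v = {} \<and> digits K u \<inter> digits K v \<noteq> {}")
      case True
      then obtain i where i: "i \<in> digits K u" "i \<in> digits K v" by blast
      hence "i \<in> {k<..K}" using True by (auto simp: digits_def disjoint_iff)
      moreover have "?c i (digits K u) * ?c i (digits K v) = 1" using i by simp
      ultimately have "1 \<le> (\<Sum>i\<in>{k<..K}. ?c i (digits K u) * ?c i (digits K v))"
        using member_le_sum[of i "{k<..K}" "\<lambda>i. ?c i (digits K u) * ?c i (digits K v)"] by simp
      thus ?thesis using True by simp
    next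
      case False
      have "(\<Sum>i\<in>{k<..K}. ?c i (digits K u) * ?c i (digits K v)) \<ge> 0"
        by (intro sum_nonneg) auto
      thus ?thesis using False by auto
    qed
  qed
  also have "\<dots> = (\<integral>u. (\<integral>v. trunc_fcop K u v \<partial>\<mu>) + (\<Sum>i\<in>{k<..K}. ?c i (digits K u) * digit_prob \<mu> i) \<partial>\<mu>)"
  proof (intro Bochner_Integration.integral_cong refl)
    fix u
    have "(\<integral>v. ?g (digits K u) (digits K v) \<partial>\<mu>) =
      (\<integral>v. trunc_fcop K u v \<partial>\<mu>) + (\<integral>v. (\<Sum>i\<in>{k<..K}. ?c i (digits K u) * ?c i (digits K v)) \<partial>\<mu>)"
      by (rule Bochner_Integration.integral_add)
         (rule integral_digits(1)[of "\<lambda>T. if digits K u \<inter> T = {} then 1 else 0"]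
           integral_digits(1)[of "\<lambda>T. \<Sum>i\<in>{k<..K}. ?c i (digits K u) * ?c i T"])+
    also have "(\<integral>v. (\<Sum>i\<in>{k<..K}. ?c i (digits K u) * ?c i (digits K v)) \<partial>\<mu>) =
      (\<Sum>i\<in>{k<..K}. \<integral>v. ?c i (digits K u) * ?c i (digits K v) \<partial>\<mu>)"
      by (rule Bochner_Integration.integral_sum) (rule integral_digits(1))
    also have "\<dots> = (\<Sum>i\<in>{k<..K}. ?c i (digits K u) * digit_prob \<mu> i)"
      by (intro sum.cong refl) (use digit_prob_integral in auto)
    finally show "(\<integral>v. ?g (digits K u) (digits K v) \<partial>\<mu>) =
      (\<integral>v. trunc_fcop K u v \<partial>\<mu>) + (\<Sum>i\<in>{k<..K}. ?c i (digits K u) * digit_prob \<mu> i)" .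
  qed
  also have "\<dots> = trunc_frac K (marg \<mu> K) + (\<integral>u. (\<Sum>i\<in>{k<..K}. ?c i (digits K u) * digit_prob \<mu> i) \<partial>\<mu>)"
    unfolding integral_trunc_fcop[symmetric]
    by (rule Bochner_Integration.integral_add)
         (rule integral_integral_digits(1)[of "\<lambda>S T. if S \<inter> T = {} then 1 else 0"]
           integral_digits(1)[of "\<lambda>S. \<Sum>i\<in>{k<..K}. ?c i S * digit_prob \<mu> i"])+
  also have "(\<integral>u. (\<Sum>i\<in>{k<..K}. ?c i (digits K u) * digit_prob \<mu> i) \<partial>\<mu>) =
      (\<Sum>i\<in>{k<..K}. \<integral>u. ?c i (digits K u) * digit_prob \<mu> i \<partial>\<mu>)"
    by (rule Bochner_Integration.integral_sum) (rule integral_digits(1))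
  also have "\<dots> = (\<Sum>i\<in>{k<..K}. (digit_prob \<mu> i)\<^sup>2)"
    by (intro sum.cong refl) (use digit_prob_integral in \<open>auto simp: power2_eq_square\<close>)
  finally show ?thesis .
qed

text \<open>The sequence is eventually constant: a common digit at position i is seen from k = i
  on.\<close>

lemma trunc_fcop_tendsto: "(\<lambda>k. trunc_fcop k u v) \<longlonglongrightarrow> fcop u v"
proof (cases "\<exists>i\<ge>1. bdigit i u = 1 \<and> bdigit i v = 1")
  case True
  then obtain i where i: "i \<ge> 1" "bdigit i u = 1" "bdigit i v = 1" by blast
  have "\<forall>\<^sub>F k in sequentially. trunc_fcop k u v = fcop u v"
    using eventually_ge_at_top[of i]
    by eventually_elim (use True i in \<open>auto simp: fcop_def digits_def disjoint_iff\<close>)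
  thus ?thesis by (rule tendsto_eventually)
next
  case False
  hence "trunc_fcop k u v = fcop u v" for k by (auto simp: fcop_def digits_def disjoint_iff)
  thus ?thesis by simp
qed

lemma trunc_frac_tendsto: "(\<lambda>k. trunc_frac k (marg \<mu> k)) \<longlonglongrightarrow> (\<integral>u. (\<integral>v. fcop u v \<partial>\<mu>) \<partial>\<mu>)"
proof -
  have m: "(\<lambda>v. trunc_fcop k u v) \<in> borel_measurable \<mu>" for k u
    using integral_digits(1)[of "\<lambda>T. if digits k u \<inter> T = {} then 1 else 0" k] by auto
  \<comment> \<open>Measurability of \<open>fcop u\<close> is inherited from its truncations as a
    pointwise limit.\<close>
  have m': "fcop u \<in> borel_measurable \<mu>" for u
    by (rule borel_measurable_LIMSEQ_real[of \<mu> "\<lambda>k. trunc_fcop k u"], rule trunc_fcop_tendsto, rule m)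
  have M: "(\<lambda>u. \<integral>v. trunc_fcop k u v \<partial>\<mu>) \<in> borel_measurable \<mu>" for k
    using integral_integral_digits(1)[of "\<lambda>S T. if S \<inter> T = {} then 1 else 0" k] by auto
  have inner: "(\<lambda>k. \<integral>v. trunc_fcop k u v \<partial>\<mu>) \<longlonglongrightarrow> (\<integral>v. fcop u v \<partial>\<mu>)" for u
    by (rule integral_dominated_convergence[where w = "\<lambda>_. 1", OF m' m _ AE_I2[OF trunc_fcop_tendsto]]) auto
  have M': "(\<lambda>u. \<integral>v. fcop u v \<partial>\<mu>) \<in> borel_measurable \<mu>"
    by (rule borel_measurable_LIMSEQ_real[of \<mu> "\<lambda>k u. \<integral>v. trunc_fcop k u v \<partial>\<mu>"], rule inner, rule M)
  have "(\<lambda>k. \<integral>u. (\<integral>v. trunc_fcop k u v \<partial>\<mu>) \<partial>\<mu>) \<longlonglongrightarrow> (\<integral>u. (\<integral>v. fcop u v \<partial>\<mu>) \<partial>\<mu>)"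
  proof (rule integral_dominated_convergence[where w = "\<lambda>_. 1", OF M' M _ AE_I2[OF inner]])
    fix k
    have "norm (\<integral>v. trunc_fcop k u v \<partial>\<mu>) \<le> 1" for u
    proof -
      have "(\<integral>v. trunc_fcop k u v \<partial>\<mu>) \<le> (\<integral>v. 1 \<partial>\<mu>)"
        by (intro integral_mono integral_digits(1)[of "\<lambda>T. if digits k u \<inter> T = {} then 1 else 0"]) auto
      moreover have "(\<integral>v. trunc_fcop k u v \<partial>\<mu>) \<ge> 0" by (intro Bochner_Integration.integral_nonneg) auto
      ultimately show ?thesis using prob_space by simp
    qed
    thus "AE u in \<mu>. norm (\<integral>v. trunc_fcop k u v \<partial>\<mu>) \<le> 1" by simp
  qed simp
  thus ?thesis unfolding integral_trunc_fcop .
qed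

text \<open>The truncations decrease to the double integral, so a bound for all finite tails bounds
  the whole error.\<close>

lemma trunc_frac_error_le:
  assumes "\<And>K. (\<Sum>i\<in>{k<..K}. (digit_prob \<mu> i)\<^sup>2) \<le> \<epsilon>"
  shows "\<bar>trunc_frac k (marg \<mu> k) - (\<integral>u. (\<integral>v. fcop u v \<partial>\<mu>) \<partial>\<mu>)\<bar> \<le> \<epsilon>"
proof -
  have "(\<integral>u. (\<integral>v. fcop u v \<partial>\<mu>) \<partial>\<mu>) \<le> trunc_frac k (marg \<mu> k)"
    by (rule LIMSEQ_le_const2[OF trunc_frac_tendsto]) (use trunc_frac_antimono in blast)
  moreover have "(\<integral>u. (\<integral>v. fcop u v \<partial>\<mu>) \<partial>\<mu>) \<ge> trunc_frac k (marg \<mu> k) - \<epsilon>"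
    by (rule LIMSEQ_le_const[OF trunc_frac_tendsto], rule exI[of _ k])
       (use trunc_frac_le_tail assms in \<open>fastforce intro: order_trans simp: algebra_simps\<close>)
  ultimately show ?thesis by linarith
qed

end

section \<open>The digits of a number drawn from \<open>nu\<close>\<close>

lemma bin_value_summable: "summable (\<lambda>k. (if \<omega> k then 1 else 0) / 2 ^ Suc k :: real)"
proof (rule summable_comparison_test')
  show "summable (\<lambda>k. (1/2) ^ Suc k :: real)" using summable_geometric[of "1/2::real"] by (simp add: summable_Suc_iff)
  show "norm ((if \<omega> n then 1 else 0) / 2 ^ Suc n :: real) \<le> (1/2) ^ Suc n" if "n \<ge> 0" for n
    by (simp add: power_divide)
qed

lemma bin_value_rec: "bin_value \<omega> = ((if \<omega> 0 then 1 else 0) + bin_value (\<lambda>k. \<omega> (Suc k))) / 2"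
proof -
  have "bin_value \<omega> = (if \<omega> 0 then 1 else 0) / 2 + (\<Sum>k. (if \<omega> (Suc k) then 1 else 0) / 2 ^ Suc (Suc k))"
    unfolding bin_value_def using suminf_split_head[OF bin_value_summable[of \<omega>]] by simp
  also have "(\<Sum>k. (if \<omega> (Suc k) then 1 else 0) / 2 ^ Suc (Suc k) :: real) =
      (\<Sum>k. ((if \<omega> (Suc k) then 1 else 0) / 2 ^ Suc k) / 2)"
    by (intro suminf_cong) simp
  also have "\<dots> = bin_value (\<lambda>k. \<omega> (Suc k)) / 2"
    unfolding bin_value_def by (rule suminf_divide) (rule bin_value_summable)
  finally show ?thesis by (simp add: add_divide_distrib)
qed

lemma bin_value_bounds: "0 \<le> bin_value \<omega>" "bin_value \<omega> \<le> 1"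
proof -
  show "0 \<le> bin_value \<omega>" unfolding bin_value_def by (intro suminf_nonneg bin_value_summable) auto
  have "bin_value \<omega> \<le> (\<Sum>k. (1/2) ^ Suc k)"
    unfolding bin_value_def
  proof (intro suminf_le bin_value_summable)
    show "summable (\<lambda>k. (1/2) ^ Suc k :: real)" using summable_geometric[of "1/2::real"] by (simp add: summable_Suc_iff)
  qed (auto simp: power_divide)
  also have "\<dots> = 1" using power_half_series sums_unique by metis
  finally show "bin_value \<omega> \<le> 1" .
qed

lemma bin_value_less_1: "\<not> \<omega> k \<Longrightarrow> bin_value \<omega> < 1"
proof (induction k arbitrary: \<omega>)
  case 0
  thus ?case using bin_value_rec[of \<omega>] bin_value_bounds(2)[of "\<lambda>k. \<omega> (Suc k)"] by simp
next
  case (Suc k)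
  from Suc.IH[of "\<lambda>k. \<omega> (Suc k)"] Suc.prems show ?case using bin_value_rec[of \<omega>] by (cases "\<omega> 0") simp_all
qed

text \<open>Infinitely many zeros keep every shifted tail strictly below 1, so the floor reads off
  the digits of \<omega> itself. A tail of ones starting after a zero would give a dyadic rational,
  whose finite expansion would be read instead.\<close>

lemma bdigit_bin_value:
  assumes "\<And>N. \<exists>n\<ge>N. \<not> \<omega> n"
  shows "bdigit (Suc j) (bin_value \<omega>) = (if \<omega> j then 1 else 0)"
proof -
  have lt: "bin_value (\<lambda>k. \<omega> (k + j)) < 1" for j
    using assms[of j] bin_value_less_1[of "\<lambda>k. \<omega> (k + j)"] by (metis le_add_diff_inverse2)
  have rec: "2 * bin_value (\<lambda>k. \<omega> (k + j)) = (if \<omega> j then 1 else 0) + bin_value (\<lambda>k. \<omega> (k + Suc j))" for j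
    using bin_value_rec[of "\<lambda>k. \<omega> (k + j)"] by simp
  \<comment> \<open>Multiplication by 2^j moves the first j digits into the integer m and leaves the
    shifted tail.\<close>
  have "\<exists>m::int. bin_value \<omega> * 2 ^ j = of_int m + bin_value (\<lambda>k. \<omega> (k + j))" for j
  proof (induction j)
    case 0
    thus ?case by (intro exI[of _ 0]) simp
  next
    case (Suc j)
    then obtain m :: int where "bin_value \<omega> * 2 ^ j = of_int m + bin_value (\<lambda>k. \<omega> (k + j))" by blast
    hence "bin_value \<omega> * 2 ^ Suc j = 2 * of_int m + 2 * bin_value (\<lambda>k. \<omega> (k + j))"
      by (simp add: algebra_simps)
    hence "bin_value \<omega> * 2 ^ Suc j = of_int (2 * m + (if \<omega> j then 1 else 0)) + bin_value (\<lambda>k. \<omega> (k + Suc j))"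
      unfolding rec by simp
    thus ?case by blast
  qed
  then obtain m :: int where "bin_value \<omega> * 2 ^ j = of_int m + bin_value (\<lambda>k. \<omega> (k + j))" by blast
  hence "bin_value \<omega> * 2 ^ Suc j = 2 * of_int m + 2 * bin_value (\<lambda>k. \<omega> (k + j))"
    by (simp add: algebra_simps)
  hence "bin_value \<omega> * 2 ^ Suc j = of_int (2 * m + (if \<omega> j then 1 else 0)) + bin_value (\<lambda>k. \<omega> (k + Suc j))"
    unfolding rec by simp
  hence "\<lfloor>bin_value \<omega> * 2 ^ Suc j\<rfloor> = 2 * m + (if \<omega> j then 1 else 0)"
    using lt[of "Suc j"] bin_value_bounds(1)[of "\<lambda>k. \<omega> (k + Suc j)"] by (intro floor_unique) auto
  moreover have "bin_value \<omega> \<noteq> 1" using lt[of 0] by simp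
  ultimately show ?thesis by (auto simp: bdigit_def)
qed

abbreviation coins :: "(nat \<Rightarrow> bool) measure" where
  "coins \<equiv> (\<Pi>\<^sub>M k\<in>(UNIV::nat set). measure_pmf (bernoulli_pmf (1 / real (prime_seq (Suc k)))))"

lemma inverse_prime_seq_le: "1 / real (prime_seq i) \<le> 1 / 2"
proof -
  have "real (prime_seq i) \<ge> 2" using prime_seq_gt_1[of i] by simp
  thus ?thesis by (intro divide_left_mono) auto
qed

lemma inverse_prime_seq_le_1: "1 / real (prime_seq i) \<le> 1"
  using inverse_prime_seq_le[of i] by linarith

lemma prob_space_coins: "prob_space coins"
  by (intro prob_space_PiM) (rule measure_pmf.prob_space_axioms)

lemma measurable_coins_component [measurable]:
  "(\<lambda>\<omega>. \<omega> n) \<in> coins \<rightarrow>\<^sub>M count_space UNIV"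
  using measurable_component_singleton[of n UNIV "\<lambda>k. measure_pmf (bernoulli_pmf (1 / real (prime_seq (Suc k))))"]
  by simp

lemma prob_coins:
  assumes "finite J"
  shows "measure coins {\<omega>\<in>space coins. \<forall>k\<in>J. \<omega> k = b k} =
    (\<Prod>k\<in>J. if b k then 1 / prime_seq (Suc k) else 1 - 1 / prime_seq (Suc k))"
proof -
  interpret product_prob_space "\<lambda>k. measure_pmf (bernoulli_pmf (1 / real (prime_seq (Suc k))))" UNIV
    by unfold_locales
  have "emeasure coins {\<omega>\<in>space coins. \<forall>k\<in>J. \<omega> k \<in> {b k}} =
     (\<Prod>k\<in>J. emeasure (measure_pmf (bernoulli_pmf (1 / real (prime_seq (Suc k))))) {b k})"
    by (rule emeasure_PiM_Collect) (use assms in auto)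
  also have "\<dots> = (\<Prod>k\<in>J. ennreal (if b k then 1 / prime_seq (Suc k) else 1 - 1 / prime_seq (Suc k)))"
  proof (intro prod.cong refl)
    fix k
    define p where "p = 1 / real (prime_seq (Suc k))"
    have "0 \<le> p" "p \<le> 1" using inverse_prime_seq_le[of "Suc k"] by (auto simp: p_def)
    thus "emeasure (measure_pmf (bernoulli_pmf (1 / real (prime_seq (Suc k))))) {b k} =
        ennreal (if b k then 1 / prime_seq (Suc k) else 1 - 1 / prime_seq (Suc k))"
      unfolding p_def[symmetric] by (cases "b k") (simp_all add: emeasure_pmf_single)
  qed
  also have "\<dots> = ennreal (\<Prod>k\<in>J. if b k then 1 / prime_seq (Suc k) else 1 - 1 / prime_seq (Suc k))"
    by (intro prod_ennreal) (auto intro: inverse_prime_seq_le_1)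
  finally show ?thesis
    by (subst (asm) emeasure_eq_measure)
      (subst (asm) ennreal_inj; auto intro!: prod_nonneg intro: inverse_prime_seq_le_1)
qed

text \<open>Since 1/p_i \<le> 1/2, m consecutive ones from N on have probability at most 2^(-m), for
  every m; only countably many N have to be treated.\<close>

lemma AE_coins_infinitely_many_False: "AE \<omega> in coins. \<forall>N. \<exists>n\<ge>N. \<not> \<omega> n"
proof (subst AE_all_countable, intro allI)
  interpret prob_space coins by (rule prob_space_coins)
  fix N
  let ?A = "{\<omega>\<in>space coins. \<forall>n\<ge>N. \<omega> n}"
  have meas: "?A \<in> sets coins" by measurable
  have "prob ?A \<le> (1/2) ^ m" for m
  proof -
    have "{\<omega>\<in>space coins. \<forall>k\<in>{N..<N+m}. \<omega> k = True} \<in> sets coins" by measurable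
    hence "prob ?A \<le> prob {\<omega>\<in>space coins. \<forall>k\<in>{N..<N+m}. \<omega> k = True}"
      by (intro finite_measure_mono) auto
    also have "\<dots> = (\<Prod>k\<in>{N..<N+m}. 1 / prime_seq (Suc k))"
      by (subst prob_coins) auto
    also have "\<dots> \<le> (\<Prod>k\<in>{N..<N+m}. 1 / 2)"
      by (intro prod_mono conjI inverse_prime_seq_le) auto
    finally show ?thesis by (simp add: power_divide)
  qed
  moreover have "(\<lambda>m. (1/2::real) ^ m) \<longlonglongrightarrow> 0" by (intro LIMSEQ_power_zero) auto
  ultimately have "prob ?A \<le> 0" by (intro LIMSEQ_le_const) auto
  hence "emeasure coins ?A = 0" by (simp add: emeasure_eq_measure measure_le_0_iff)
  thus "AE \<omega> in coins. \<exists>n\<ge>N. \<not> \<omega> n"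
    by (intro AE_I[of _ _ ?A] meas) auto
qed

lemma bin_value_meas [measurable]: "bin_value \<in> coins \<rightarrow>\<^sub>M borel01"
proof -
  have "bin_value \<in> coins \<rightarrow>\<^sub>M borel"
    unfolding bin_value_def[abs_def] by measurable
  thus ?thesis unfolding borel01_def
    by (intro measurable_restrict_space2) (auto simp: bin_value_bounds)
qed

global_interpretation nu: law01 nu
proof -
  interpret prob_space coins by (rule prob_space_coins)
  interpret nu: prob_space nu unfolding nu_def by (rule prob_space_distr) measurable
  show "law01 nu" by unfold_locales (simp add: nu_def)
qed

text \<open>Outside the null set of coin sequences that are eventually all ones, the digits of
  \<open>bin_value\<close> are the coins, so the pattern probability is a finite product.\<close>

lemma nu_digit_pattern:
  assumes "finite J" "0 \<notin> J"
  shows "measure nu {u\<in>space nu. \<forall>i\<in>J. bdigit i u = 1 \<longleftrightarrow> i \<in> B} =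
    (\<Prod>i\<in>J. if i \<in> B then 1 / prime_seq i else 1 - 1 / prime_seq i)"
proof -
  interpret prob_space coins by (rule prob_space_coins)
  define b where "b = (\<lambda>k. Suc k \<in> B)"
  \<comment> \<open>Coin k carries digit k + 1, so positions are shifted down by one;
    \<open>0 \<notin> J\<close> makes the shift invertible.\<close>
  define J' where "J' = (\<lambda>i. i - 1) ` J"
  have J: "J = Suc ` J'"
  proof -
    have "Suc (i - 1) = i" if "i \<in> J" for i using that assms(2) by (cases i) auto
    thus ?thesis unfolding J'_def image_image by simp
  qed
  have finJ': "finite J'" using assms by (simp add: J'_def)
  have mset: "{u\<in>space nu. \<forall>i\<in>J. bdigit i u = 1 \<longleftrightarrow> i \<in> B} \<in> sets nu"
    using assms(1) by measurable
  hence mset': "{u\<in>space nu. \<forall>i\<in>J. bdigit i u = 1 \<longleftrightarrow> i \<in> B} \<in> sets borel01" by (simp add: nu_def)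
  have distr: "measure nu A = prob (bin_value -` A \<inter> space coins)" if "A \<in> sets borel01" for A
    using that by (simp add: nu_def measure_distr)
  have "measure nu {u\<in>space nu. \<forall>i\<in>J. bdigit i u = 1 \<longleftrightarrow> i \<in> B} =
      prob (bin_value -` {u\<in>space nu. \<forall>i\<in>J. bdigit i u = 1 \<longleftrightarrow> i \<in> B} \<inter> space coins)"
    by (rule distr[OF mset'])
  also have "\<dots> = prob {\<omega>\<in>space coins. \<forall>k\<in>J'. \<omega> k = b k}"
  proof (rule measure_eq_AE)
    show "{\<omega>\<in>space coins. \<forall>k\<in>J'. \<omega> k = b k} \<in> events" using finJ' by measurable
    show "bin_value -` {u\<in>space nu. \<forall>i\<in>J. bdigit i u = 1 \<longleftrightarrow> i \<in> B} \<inter> space coins \<in> events"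
      using mset' by (intro measurable_sets[OF bin_value_meas])
    show "AE \<omega> in coins. (\<omega> \<in> bin_value -` {u\<in>space nu. \<forall>i\<in>J. bdigit i u = 1 \<longleftrightarrow> i \<in> B} \<inter> space coins) =
        (\<omega> \<in> {\<omega>\<in>space coins. \<forall>k\<in>J'. \<omega> k = b k})"
      using AE_coins_infinitely_many_False AE_space
    proof eventually_elim
      case (elim \<omega>)
      have "bdigit (Suc j) (bin_value \<omega>) = (if \<omega> j then 1 else 0)" for j
        using bdigit_bin_value elim(1) by blast
      thus ?case using elim(2) by (auto simp: J b_def bin_value_bounds nu.space_mu split: if_splits)
    qed
  qed
  also have "\<dots> = (\<Prod>k\<in>J'. if b k then 1 / prime_seq (Suc k) else 1 - 1 / prime_seq (Suc k))"
    by (rule prob_coins[OF finJ'])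
  also have "\<dots> = (\<Prod>i\<in>J. if i \<in> B then 1 / prime_seq i else 1 - 1 / prime_seq i)"
    unfolding J by (subst prod.reindex) (auto simp: b_def)
  finally show ?thesis .
qed

lemma marg_nu:
  assumes "S \<in> Pow {1..k}" shows "marg nu k S = wt k S"
proof -
  have "{u \<in> space nu. digits k u = S} = {u\<in>space nu. \<forall>i\<in>{1..k}. bdigit i u = 1 \<longleftrightarrow> i \<in> S}"
    using digits_eq_iff[OF assms] by blast
  thus ?thesis unfolding marg_def wt_def using nu_digit_pattern[of "{1..k}" S] by simp
qed

section \<open>Relative entropy with respect to nu\<close>

text \<open>The densities of the laws with finite relative entropy. Nonnegativity is required
  everywhere, not only almost everywhere, so that the inequalities for square roots and logarithms
  apply pointwise.\<close>

definition fin_ent :: "(real \<Rightarrow> real) \<Rightarrow> bool" where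
  "fin_ent g \<longleftrightarrow> g \<in> borel_measurable nu \<and> (\<forall>x. 0 \<le> g x) \<and> integrable nu g \<and> (\<integral>x. g x \<partial>nu) = 1
     \<and> integrable nu (\<lambda>x. g x * ln (g x))"

definition ent :: "(real \<Rightarrow> real) \<Rightarrow> real" where
  "ent g = (\<integral>x. g x * ln (g x) \<partial>nu)"

abbreviation law :: "(real \<Rightarrow> real) \<Rightarrow> real measure" where
  "law g \<equiv> density nu (\<lambda>x. ennreal (g x))"

definition coprime_frac :: "real measure \<Rightarrow> real" where
  "coprime_frac \<mu> = (\<integral>u. (\<integral>v. fcop u v \<partial>\<mu>) \<partial>\<mu>)"

lemma sets_nu: "sets nu = sets borel01" by (simp add: nu_def)

lemma law01_law:
  assumes "fin_ent g" shows "law01 (law g)"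
proof -
  have g: "g \<in> borel_measurable nu" "\<And>x. 0 \<le> g x" "integrable nu g" "(\<integral>x. g x \<partial>nu) = 1"
    using assms by (auto simp: fin_ent_def)
  have "emeasure (law g) (space (law g)) = (\<integral>\<^sup>+x. ennreal (g x) \<partial>nu)"
    using g(1) by (simp add: emeasure_density cong: nn_integral_cong)
  also have "\<dots> = 1" using nn_integral_eq_integral[OF g(3)] g(2,4) by simp
  finally interpret prob_space "law g" by (rule prob_spaceI)
  show ?thesis by unfold_locales (simp add: sets_nu)
qed

lemma integral_law:
  assumes "fin_ent g" "f \<in> borel_measurable nu"
  shows "(\<integral>x. f x \<partial>law g) = (\<integral>x. g x * f x \<partial>nu)" "integrable (law g) f \<longleftrightarrow> integrable nu (\<lambda>x. g x * f x)"
  using assms integral_density[of f nu g] integrable_density[of f nu g] by (auto simp: fin_ent_def)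

lemma rel_entropy_law:
  assumes g: "fin_ent g" shows "rel_entropy (law g) nu = ereal (ent g)"
proof -
  have [measurable]: "g \<in> borel_measurable nu" and g0: "\<And>x. 0 \<le> g x" and i: "integrable nu (\<lambda>x. g x * ln (g x))"
    using g by (auto simp: fin_ent_def)
  have ac: "absolutely_continuous nu (law g)" by (intro absolutely_continuousI_density) simp
  have "AE x in nu. ennreal (g x) = RN_deriv nu (law g) x"
    by (rule nu.RN_deriv_unique) simp_all
  hence "AE x in nu. ln (enn2real (RN_deriv nu (law g) x)) = ln (g x)"
    by eventually_elim (metis enn2real_ennreal g0)
  hence AE: "AE x in law g. ln (enn2real (RN_deriv nu (law g) x)) = ln (g x)"
    by (intro absolutely_continuous_AE[OF _ ac]) simp_all
  have "integrable (law g) (\<lambda>x. ln (g x))"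
    using i by (subst integral_law(2)[OF g]) simp_all
  hence "integrable (law g) (\<lambda>x. ln (enn2real (RN_deriv nu (law g) x)))"
    by (subst integrable_cong_AE[OF _ _ AE]) simp_all
  moreover have "(\<integral>x. ln (enn2real (RN_deriv nu (law g) x)) \<partial>law g) = (\<integral>x. ln (g x) \<partial>law g)"
    by (rule integral_cong_AE[OF _ _ AE]) simp_all
  moreover have "\<dots> = ent g" unfolding ent_def by (rule integral_law(1)[OF g]) simp
  ultimately show ?thesis using ac by (simp add: rel_entropy_def)
qed

text \<open>Together with \<open>rel_entropy_law\<close> this lets the infimum in \<open>I1\<close>
  run over densities: integrability of the logarithm of the derivative under \<mu> is integrability
  of g ln g under \<open>nu\<close>.\<close>

lemma rel_entropy_finite_law:
  assumes "law01 \<mu>" "rel_entropy \<mu> nu < \<infinity>"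
  obtains g where "fin_ent g" "\<mu> = law g" "rel_entropy \<mu> nu = ereal (ent g)"
proof -
  interpret law01 \<mu> by fact
  define g where "g = (\<lambda>x. enn2real (RN_deriv nu \<mu> x))"
  have ac: "absolutely_continuous nu \<mu>" and i: "integrable \<mu> (\<lambda>x. ln (g x))"
    using assms(2) by (auto simp: rel_entropy_def g_def split: if_splits)
  have [measurable]: "g \<in> borel_measurable nu" unfolding g_def by measurable
  have sets: "sets \<mu> = sets nu" by (simp add: sets_mu sets_nu)
  have fin: "AE x in nu. RN_deriv nu \<mu> x \<noteq> \<infinity>"
    by (rule nu.RN_deriv_finite[OF _ ac sets]) (rule sigma_finite_measure_axioms)
  have "\<mu> = density nu (RN_deriv nu \<mu>)" using nu.density_RN_deriv[OF ac sets] by simp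
  also have "\<dots> = law g"
    using fin by (intro density_cong) (auto simp: g_def less_top[symmetric])
  finally have mu: "\<mu> = law g" .
  have g0: "\<And>x. 0 \<le> g x" by (simp add: g_def)
  have "(\<integral>\<^sup>+x. ennreal (g x) \<partial>nu) = emeasure \<mu> (space \<mu>)"
    by (subst (2) mu) (simp add: mu emeasure_density cong: nn_integral_cong)
  hence nn: "(\<integral>\<^sup>+x. ennreal (g x) \<partial>nu) = ennreal 1" using emeasure_space_1 by simp
  hence ig: "integrable nu g" by (intro integrableI_nonneg) (auto simp: g0)
  have "(\<integral>x. g x \<partial>nu) = 1"
    using nn g0 by (subst integral_eq_nn_integral) auto
  moreover have "integrable nu (\<lambda>x. g x * ln (g x))"
  proof -
    have "integrable (law g) (\<lambda>x. ln (g x))" using i mu by simp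
    thus ?thesis by (subst (asm) integrable_density) (auto simp: g0)
  qed
  ultimately have "fin_ent g" using ig g0 by (simp add: fin_ent_def)
  with mu rel_entropy_law[OF this] show ?thesis using that by metis
qed

text \<open>Apply ln t \<le> t - 1 at t = sqrt(b/a). The condition on b = 0 excludes the case in
  which the true right side is infinite, which \<open>ln 0 = 0\<close> would conceal.\<close>

lemma hellinger_le:
  assumes "a \<ge> 0" "b \<ge> 0" "b = 0 \<Longrightarrow> a = 0"
  shows "(sqrt a - sqrt b)\<^sup>2 \<le> a * ln a - a * ln b - a + (b::real)"
proof (cases "a = 0")
  case True
  thus ?thesis using assms by simp
next
  case False
  hence a: "a > 0" and b: "b > 0" using assms by (auto simp: less_le)
  have "ln (sqrt (b / a)) \<le> sqrt (b / a) - 1" using a b by (intro ln_le_minus_one) simp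
  moreover have "ln (sqrt (b / a)) = (ln b - ln a) / 2" using a b by (simp add: ln_sqrt ln_div)
  ultimately have "a * (ln b - ln a) \<le> a * (2 * (sqrt (b / a) - 1))" using a by (intro mult_left_mono) auto
  also have "\<dots> = 2 * (a * sqrt (b / a)) - 2 * a" by (simp add: algebra_simps)
  also have "a * sqrt (b / a) = sqrt a * sqrt b"
  proof -
    have "a * sqrt (b / a) = (sqrt a * sqrt a) * (sqrt b / sqrt a)" using a by (simp add: real_sqrt_divide)
    also have "\<dots> = sqrt a * sqrt b" using a by (simp del: real_sqrt_mult_self)
    finally show ?thesis .
  qed
  finally have "a * (ln b - ln a) \<le> 2 * (sqrt a * sqrt b) - 2 * a" .
  moreover have "(sqrt a - sqrt b)\<^sup>2 = a + b - 2 * (sqrt a * sqrt b)"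
    using a b by (simp add: power2_diff)
  ultimately show ?thesis by (simp add: algebra_simps)
qed

lemma gibbs_pointwise:
  assumes "a \<ge> 0" "b \<ge> 0" "b = 0 \<Longrightarrow> a = 0"
  shows "a * ln b \<le> a * ln a - a + (b::real)"
  using hellinger_le[OF assms] zero_le_power2[of "sqrt a - sqrt b"] by linarith

text \<open>|a - b| is s t with s = |sqrt a - sqrt b| and t = sqrt a + sqrt b, and s t \<le> s^2/(4
  \<eta>) + \<eta> t^2. After integration an L1 distance is bounded by an entropy increment over 4
  \<eta> plus a multiple of \<eta>.\<close>

lemma abs_diff_le_entropy:
  assumes "a \<ge> 0" "b \<ge> 0" "b = 0 \<Longrightarrow> a = 0" "\<eta> > 0"
  shows "\<bar>a - b\<bar> \<le> (a * ln a - a * ln b - a + b) / (4 * \<eta>) + 2 * \<eta> * (a + (b::real))"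
proof -
  define s t where "s = \<bar>sqrt a - sqrt b\<bar>" and "t = sqrt a + sqrt b"
  have "a - b = (sqrt a - sqrt b) * (sqrt a + sqrt b)" using assms by (simp add: algebra_simps)
  hence ab: "\<bar>a - b\<bar> = s * t" using assms by (simp add: s_def t_def abs_mult)
  have "0 \<le> (s - 2 * \<eta> * t)\<^sup>2 / (4 * \<eta>)" using assms by simp
  also have "\<dots> = s\<^sup>2 / (4 * \<eta>) + \<eta> * t\<^sup>2 - s * t" using assms
    by (simp add: power2_eq_square field_simps)
  finally have 1: "s * t \<le> s\<^sup>2 / (4 * \<eta>) + \<eta> * t\<^sup>2" by simp
  have "0 \<le> (sqrt a - sqrt b)\<^sup>2" by simp
  hence "t\<^sup>2 \<le> 2 * (a + b)" using assms by (simp add: t_def power2_sum power2_diff)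
  hence 2: "\<eta> * t\<^sup>2 \<le> \<eta> * (2 * (a + b))" using assms by (intro mult_left_mono) auto
  have 3: "s\<^sup>2 / (4 * \<eta>) \<le> (a * ln a - a * ln b - a + b) / (4 * \<eta>)"
    using hellinger_le[OF assms(1-3)] assms(4) by (intro divide_right_mono) (auto simp: s_def)
  have "\<eta> * (2 * (a + b)) = 2 * \<eta> * (a + b)" by simp
  with 1 2 3 ab show ?thesis by linarith
qed

text \<open>The variational inequality for a test density y of mass at most 1, by integrating
  \<open>gibbs_pointwise\<close>. The condition on the zeros of y carries over the side condition
  there.\<close>

lemma gibbs:
  assumes g: "fin_ent g" and y [measurable]: "y \<in> borel_measurable nu" and y0: "\<And>x. y x \<ge> 0"
    and iy: "integrable nu y" "(\<integral>x. y x \<partial>nu) \<le> 1"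
    and AE0: "AE x in nu. y x = 0 \<longrightarrow> g x = 0" and int: "integrable nu (\<lambda>x. g x * ln (y x))"
  shows "(\<integral>x. g x * ln (y x) \<partial>nu) \<le> ent g"
proof -
  have g': "integrable nu g" "(\<integral>x. g x \<partial>nu) = 1" "integrable nu (\<lambda>x. g x * ln (g x))" "\<And>x. 0 \<le> g x"
    using g by (auto simp: fin_ent_def)
  have "(\<integral>x. g x * ln (y x) \<partial>nu) \<le> (\<integral>x. g x * ln (g x) - g x + y x \<partial>nu)"
  proof (rule integral_mono_AE[OF int])
    show "integrable nu (\<lambda>x. g x * ln (g x) - g x + y x)"
      by (intro Bochner_Integration.integrable_add Bochner_Integration.integrable_diff g' iy)
    show "AE x in nu. g x * ln (y x) \<le> g x * ln (g x) - g x + y x"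
      using AE0 by eventually_elim (use g'(4) y0 gibbs_pointwise in blast)
  qed
  also have "\<dots> = ent g - 1 + (\<integral>x. y x \<partial>nu)"
    using g' iy by (simp add: ent_def)
  finally show ?thesis using iy by simp
qed

lemma ent_nonneg: "fin_ent g \<Longrightarrow> ent g \<ge> 0"
  using gibbs[of g "\<lambda>_. 1"] nu.prob_space by simp

text \<open>Data processing: forgetting all digits beyond k cannot increase the entropy.\<close>

lemma KL_marg_le_ent:
  assumes g: "fin_ent g"
  shows "KL (Pow {1..k}) (marg (law g) k) (wt k) \<le> ent g"
proof -
  interpret L: law01 "law g" by (rule law01_law[OF g])
  define q where "q = marg (law g) k"
  have q0: "q S \<ge> 0" for S by (simp add: q_def marg_def)
  \<comment> \<open>The test density is that of the digit marginal of \<open>law g\<close> with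
    respect to the digit marginal of \<open>nu\<close>.\<close>
  define y where "y = (\<lambda>x. q (digits k x) / wt k (digits k x))"
  have y [measurable]: "y \<in> borel_measurable nu" unfolding y_def by (rule nu.fun_digits_meas)
  have lny: "(\<lambda>x. ln (y x)) = (\<lambda>x. ln (q (digits k x) / wt k (digits k x)))" by (simp add: y_def)
  have "(\<integral>x. g x * ln (y x) \<partial>nu) \<le> ent g"
  proof (rule gibbs[OF g y])
    show "y x \<ge> 0" for x using q0 wt_pos[of k] by (simp add: y_def less_imp_le)
    show "integrable nu y" unfolding y_def by (rule nu.integral_digits(1))
    have "(\<integral>x. y x \<partial>nu) = (\<Sum>S\<in>Pow {1..k}. q S / wt k S * marg nu k S)"
      unfolding y_def by (rule nu.integral_digits(2))
    also have "\<dots> = (\<Sum>S\<in>Pow {1..k}. q S)"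
    proof (intro sum.cong refl)
      fix S assume S: "S \<in> Pow {1..k}"
      show "q S / wt k S * marg nu k S = q S"
        unfolding marg_nu[OF S] using wt_pos[of k S] by simp
    qed
    also have "\<dots> = 1" using L.distr_on_marg[of k] by (simp add: distr_on_def q_def)
    finally show "(\<integral>x. y x \<partial>nu) \<le> 1" by simp
    show "integrable nu (\<lambda>x. g x * ln (y x))"
    proof (subst integral_law(2)[OF g, symmetric])
      show "integrable (law g) (\<lambda>x. ln (y x))" unfolding lny by (rule L.integral_digits(1))
    qed simp
    \<comment> \<open>\<open>law g\<close> gives no mass to the digit patterns of marginal
      probability 0, hence g vanishes almost everywhere where y does.\<close>
    have "(\<integral>x. (if q (digits k x) = 0 then 1 else 0 :: real) \<partial>law g) =
        (\<Sum>S\<in>Pow {1..k}. (if q S = 0 then 1 else 0) * q S)"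
      unfolding q_def by (rule L.integral_digits(2))
    also have "\<dots> = 0" by (intro sum.neutral) auto
    finally have "AE x in law g. (if q (digits k x) = 0 then 1 else 0 :: real) = 0"
      by (subst (asm) integral_nonneg_eq_0_iff_AE) (auto intro: L.integral_digits(1))
    hence "AE x in nu. 0 < ennreal (g x) \<longrightarrow> (if q (digits k x) = 0 then 1 else 0 :: real) = 0"
      using g by (subst (asm) AE_density) (auto simp: fin_ent_def)
    thus "AE x in nu. y x = 0 \<longrightarrow> g x = 0"
    proof eventually_elim
      case (elim x)
      have "g x \<ge> 0" using g by (simp add: fin_ent_def)
      thus ?case using elim wt_pos[of k "digits k x"] by (auto simp: y_def less_le split: if_splits)
    qed
  qed
  also have "(\<integral>x. g x * ln (y x) \<partial>nu) = (\<integral>x. ln (y x) \<partial>law g)"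
    by (rule integral_law(1)[OF g, symmetric]) simp
  also have "\<dots> = (\<Sum>S\<in>Pow {1..k}. ln (q S / wt k S) * q S)"
    unfolding lny unfolding q_def by (rule L.integral_digits(2))
  also have "\<dots> = KL (Pow {1..k}) (marg (law g) k) (wt k)"
    by (simp add: KL_def q_def mult.commute)
  finally show ?thesis .
qed

text \<open>The counterpart for laws of \<open>prob_many_multiples_fixed\<close>: the test density
  tilts \<open>nu\<close> by e^\<theta> for each digit 1 in T, and entropy takes the place of the
  exponential rate.\<close>

lemma sum_large_digit_prob_le:
  assumes g: "fin_ent g" and T: "finite T" "0 \<notin> T" and th: "\<theta> > 1"
    and large: "\<And>i. i \<in> T \<Longrightarrow> digit_prob (law g) i > exp \<theta> / prime_seq i"
  shows "(\<theta> - 1) * (\<Sum>i\<in>T. digit_prob (law g) i) \<le> ent g"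
proof -
  interpret L: law01 "law g" by (rule law01_law[OF g])
  define B where "B = (\<lambda>i. {u\<in>space nu. bdigit i u = 1})"
  have B [measurable]: "B i \<in> sets nu" for i unfolding B_def by measurable
  define s where "s = (\<Sum>i\<in>T. 1 / real (prime_seq i))"
  let ?c = "\<lambda>x. card {i\<in>T. x \<in> B i}"
  have pr: "measure nu {x \<in> space nu. \<forall>i\<in>S. x \<in> B i} \<le> (\<Prod>i\<in>S. 1 / real (prime_seq i))" if "S \<subseteq> T" for S
  proof -
    have "{x \<in> space nu. \<forall>i\<in>S. x \<in> B i} = {u\<in>space nu. \<forall>i\<in>S. bdigit i u = 1 \<longleftrightarrow> i \<in> S}"
      by (auto simp: B_def)
    moreover have "finite S" "0 \<notin> S" using that T finite_subset by auto
    ultimately show ?thesis using nu_digit_pattern[of S S] by simp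
  qed
  have mom: "integrable nu (\<lambda>x. exp (\<theta> * ?c x))" "(\<integral>x. exp (\<theta> * ?c x) \<partial>nu) \<le> exp ((exp \<theta> - 1) * s)"
    unfolding s_def using nu.exp_card_moment[OF T(1) B _ pr, of \<theta>] th by auto
  define y where "y = (\<lambda>x. exp (\<theta> * ?c x) / exp ((exp \<theta> - 1) * s))"
  have ceq: "real (?c x) = (\<Sum>i\<in>T. indicator (B i) x)" for x
    using T(1) by (simp add: indicator_def sum.If_cases Int_def)
  have y [measurable]: "y \<in> borel_measurable nu" unfolding y_def ceq by measurable
  have lny: "ln (y x) = \<theta> * (\<Sum>i\<in>T. indicator (B i) x) - (exp \<theta> - 1) * s" for x
    by (simp add: y_def ln_div flip: ceq)
  have int: "integrable (law g) (\<lambda>x. indicator (B i) x :: real)" for i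
    by (intro integrable_real_indicator) (auto simp: L.emeasure_eq_measure)
  have "(\<integral>x. g x * ln (y x) \<partial>nu) \<le> ent g"
  proof (rule gibbs[OF g y])
    show "integrable nu y" unfolding y_def by (intro integrable_divide mom)
    show "(\<integral>x. y x \<partial>nu) \<le> 1" using mom(2) by (simp add: y_def)
    show "AE x in nu. y x = 0 \<longrightarrow> g x = 0" by (simp add: y_def)
    show "integrable nu (\<lambda>x. g x * ln (y x))"
    proof (subst integral_law(2)[OF g, symmetric])
      show "integrable (law g) (\<lambda>x. ln (y x))"
        unfolding lny
        by (intro Bochner_Integration.integrable_diff integrable_mult_right Bochner_Integration.integrable_sum int L.integrable_const)
    qed simp
  qed (simp add: y_def)
  also have "(\<integral>x. g x * ln (y x) \<partial>nu) = (\<integral>x. ln (y x) \<partial>law g)"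
    by (rule integral_law(1)[OF g, symmetric]) simp
  also have "\<dots> = \<theta> * (\<Sum>i\<in>T. digit_prob (law g) i) - (exp \<theta> - 1) * s"
  proof -
    have "(\<integral>x. indicator (B i) x \<partial>law g) = digit_prob (law g) i" for i
      by (simp add: digit_prob_def B_def Int_absorb2)
    thus ?thesis unfolding lny using int L.prob_space
      by (simp add: Bochner_Integration.integral_diff Bochner_Integration.integral_sum)
  qed
  finally have 1: "\<theta> * (\<Sum>i\<in>T. digit_prob (law g) i) - (exp \<theta> - 1) * s \<le> ent g" .
  \<comment> \<open>Above the threshold, e^\<theta> s is at most the total digit probability; this
    absorbs the normalisation and leaves the factor \<theta> - 1.\<close>
  have "exp \<theta> * s \<le> (\<Sum>i\<in>T. digit_prob (law g) i)"
    unfolding s_def sum_distrib_left using large by (intro sum_mono) (auto simp: less_imp_le)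
  moreover have "s \<ge> 0" unfolding s_def by (intro sum_nonneg) auto
  ultimately show ?thesis using 1 by (simp add: algebra_simps)
qed

text \<open>k0 depends on \<epsilon> and c but not on g. This uniformity is what allows limits in g
  to be interchanged with k tending to infinity.\<close>

lemma trunc_frac_uniform:
  assumes "\<epsilon> > 0"
  shows "\<exists>k0. \<forall>k\<ge>k0. \<forall>g. fin_ent g \<longrightarrow> ent g \<le> c \<longrightarrow> \<bar>trunc_frac k (marg (law g) k) - coprime_frac (law g)\<bar> \<le> \<epsilon>"
proof -
  \<comment> \<open>Makes (\<theta> - 1) \<epsilon>/2 equal to |c| + 1; the added 1 keeps \<theta> >
    1 also when c = 0.\<close>
  define \<theta> where "\<theta> = 1 + (2 / \<epsilon>) * (\<bar>c\<bar> + 1)"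
  have th: "\<theta> > 1" using assms by (simp add: \<theta>_def)
  define A where "A = exp \<theta>"
  obtain k0 where k0: "real k0 > 2 * A\<^sup>2 / \<epsilon>" using reals_Archimedean2 by blast
  show ?thesis
  proof (intro exI[of _ "max 1 k0"] allI impI)
    fix k g assume k: "max 1 k0 \<le> k" and g: "fin_ent g" "ent g \<le> c"
    interpret L: law01 "law g" by (rule law01_law[OF g(1)])
    let ?d = "digit_prob (law g)"
    have "2 * A\<^sup>2 / \<epsilon> < real k" using k0 k by linarith
    hence Ak: "A\<^sup>2 / k \<le> \<epsilon> / 2" using assms k by (simp add: field_simps)
    show "\<bar>trunc_frac k (marg (law g) k) - coprime_frac (law g)\<bar> \<le> \<epsilon>"
      unfolding coprime_frac_def
    proof (rule L.trunc_frac_error_le)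
      fix K
      let ?T = "{i\<in>{k<..K}. ?d i > A / prime_seq i}"
      have "(\<theta> - 1) * sum ?d ?T \<le> ent g"
        by (rule sum_large_digit_prob_le[OF g(1) _ _ th]) (auto simp: A_def)
      also have "\<dots> \<le> \<bar>c\<bar> + 1" using g by linarith
      finally have "sum ?d ?T * (2 / \<epsilon> * (\<bar>c\<bar> + 1)) \<le> \<epsilon> / 2 * (2 / \<epsilon> * (\<bar>c\<bar> + 1))"
        using assms by (simp add: \<theta>_def mult.commute)
      hence "sum ?d ?T \<le> \<epsilon> / 2"
        using assms by (subst (asm) mult_le_cancel_right) (auto simp: zero_less_mult_iff add_nonneg_pos)
      moreover have "(\<Sum>i\<in>{k<..K}. (?d i)\<^sup>2) \<le> A\<^sup>2 / k + sum ?d ?T"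
        by (rule sum_squares_le_split) (use k in \<open>auto simp: A_def digit_prob_def\<close>)
      ultimately show "(\<Sum>i\<in>{k<..K}. (?d i)\<^sup>2) \<le> \<epsilon>" using Ak by linarith
    qed
  qed
qed

section \<open>Laws with a prescribed marginal on the first k digits\<close>

lemma marg_law:
  assumes "fin_ent g" "S \<in> Pow {1..k}"
  shows "marg (law g) k S = (\<integral>x. g x * (if digits k x = S then 1 else 0) \<partial>nu)"
proof -
  interpret L: law01 "law g" by (rule law01_law) fact
  have "marg (law g) k S = (\<integral>x. (if digits k x = S then 1 else 0) \<partial>law g)"
    by (subst L.integral_digits(2)[of "\<lambda>T. if T = S then 1 else 0"])
       (use assms in \<open>simp add: if_distrib[of "\<lambda>x. x * _"] sum.delta' cong: if_cong\<close>)
  also have "\<dots> = (\<integral>x. g x * (if digits k x = S then 1 else 0) \<partial>nu)"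
    by (rule integral_law(1)[OF assms(1)]) (rule nu.fun_digits_meas[of "\<lambda>T. if T = S then 1 else 0"])
  finally show ?thesis .
qed

text \<open>The density of the law that has digit marginal q and, given the first k digits,
  distributes the remaining ones as \<open>nu\<close> does.\<close>

definition step_density :: "nat \<Rightarrow> (nat set \<Rightarrow> real) \<Rightarrow> real \<Rightarrow> real" where
  "step_density k q x = q (digits k x) / wt k (digits k x)"

text \<open>The equality case of \<open>KL_marg_le_ent\<close>: each law on the finite alphabet
  lifts to a law on [0,1] without additional entropy. This carries the finite problem back to
  \<open>I1\<close>.\<close>

lemma step_density_props:
  assumes q: "distr_on (Pow {1..k}) q"
  shows "fin_ent (step_density k q)" "ent (step_density k q) = KL (Pow {1..k}) q (wt k)"
    "\<And>S. S \<in> Pow {1..k} \<Longrightarrow> marg (law (step_density k q)) k S = q S"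
proof -
  have q0: "q (digits k x) \<ge> 0" for x using q digits_subset[of k x] by (auto simp: distr_on_def)
  have s0: "step_density k q x \<ge> 0" for x using q0 wt_pos[of k] by (simp add: step_density_def less_imp_le)
  have m: "step_density k q \<in> borel_measurable nu"
    unfolding step_density_def[abs_def] by (rule nu.fun_digits_meas)
  have int: "integrable nu (\<lambda>x. step_density k q x * h (digits k x))"
    and integ: "(\<integral>x. step_density k q x * h (digits k x) \<partial>nu) = (\<Sum>S\<in>Pow {1..k}. h S * q S)" for h :: "nat set \<Rightarrow> real"
  proof -
    show "integrable nu (\<lambda>x. step_density k q x * h (digits k x))"
      unfolding step_density_def by (rule nu.integral_digits(1))
    have "(\<integral>x. step_density k q x * h (digits k x) \<partial>nu) = (\<Sum>S\<in>Pow {1..k}. q S / wt k S * h S * marg nu k S)"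
      unfolding step_density_def by (rule nu.integral_digits(2))
    also have "\<dots> = (\<Sum>S\<in>Pow {1..k}. h S * q S)"
    proof (intro sum.cong refl)
      fix S assume S: "S \<in> Pow {1..k}"
      show "q S / wt k S * h S * marg nu k S = h S * q S"
        unfolding marg_nu[OF S] using wt_pos[of k S] by simp
    qed
    finally show "(\<integral>x. step_density k q x * h (digits k x) \<partial>nu) = (\<Sum>S\<in>Pow {1..k}. h S * q S)" .
  qed
  have ln: "(\<lambda>x. step_density k q x * ln (step_density k q x)) = (\<lambda>x. step_density k q x * (\<lambda>S. ln (q S / wt k S)) (digits k x))"
    by (simp add: step_density_def)
  show fe: "fin_ent (step_density k q)"
    unfolding fin_ent_def ln using m s0 int[of "\<lambda>_. 1"] integ[of "\<lambda>_. 1"] int q by (auto simp: distr_on_def)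
  show "ent (step_density k q) = KL (Pow {1..k}) q (wt k)"
    unfolding ent_def ln KL_def using integ[of "\<lambda>S. ln (q S / wt k S)"] by (simp add: mult.commute)
  fix S assume S: "S \<in> Pow {1..k}"
  have "marg (law (step_density k q)) k S = (\<integral>x. step_density k q x * (\<lambda>T. if T = S then 1 else 0) (digits k x) \<partial>nu)"
    by (rule marg_law[OF fe S])
  also have "\<dots> = (\<Sum>T\<in>Pow {1..k}. (if T = S then 1 else 0) * q T)" by (rule integ)
  also have "\<dots> = q S"
    using S by (simp add: if_distrib[of "\<lambda>x. x * _"] sum.delta' cong: if_cong)
  finally show "marg (law (step_density k q)) k S = q S" .
qed

section \<open>Lower semicontinuity of the rate function\<close>

lemma continuous_on_x_ln_x: "continuous_on {0..} (\<lambda>x::real. x * ln x)"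
proof (unfold continuous_on_def, intro ballI)
  fix x :: real assume x: "x \<in> {0..}"
  show "((\<lambda>x. x * ln x) \<longlongrightarrow> x * ln x) (at x within {0..})"
  proof (cases "x = 0")
    case True
    have "((\<lambda>x::real. x * ln x) \<longlongrightarrow> 0) (at_right 0)" by real_asymp
    thus ?thesis using True by (simp add: at_within_Ici_at_right)
  next
    case False
    thus ?thesis using x by (intro tendsto_intros) auto
  qed
qed

lemma tendsto_x_ln_x:
  fixes f :: "'a \<Rightarrow> real"
  assumes "(f \<longlongrightarrow> a) F" "a \<ge> 0" "\<And>x. f x \<ge> 0"
  shows "((\<lambda>x. f x * ln (f x)) \<longlongrightarrow> a * ln a) F"
  by (rule continuous_on_tendsto_compose[OF continuous_on_x_ln_x assms(1)]) (use assms in auto)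

lemma fatou_real:
  fixes f :: "nat \<Rightarrow> 'a \<Rightarrow> real"
  assumes f: "\<And>i. f i \<in> borel_measurable M" "\<And>i x. f i x \<ge> 0" and F: "F \<in> borel_measurable M" "\<And>x. F x \<ge> 0"
    and lim: "AE x in M. (\<lambda>i. f i x) \<longlonglongrightarrow> F x"
    and le: "\<forall>\<^sub>F i in sequentially. integrable M (f i) \<and> (\<integral>x. f i x \<partial>M) \<le> C"
  shows "integrable M F" "(\<integral>x. F x \<partial>M) \<le> C"
proof -
  have "(\<integral>\<^sup>+x. ennreal (F x) \<partial>M) = (\<integral>\<^sup>+x. liminf (\<lambda>i. ennreal (f i x)) \<partial>M)"
  proof (rule nn_integral_cong_AE)
    show "AE x in M. ennreal (F x) = liminf (\<lambda>i. ennreal (f i x))"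
      using lim by eventually_elim (intro lim_imp_Liminf[symmetric] tendsto_ennrealI; simp)
  qed
  also have "\<dots> \<le> liminf (\<lambda>i. \<integral>\<^sup>+x. ennreal (f i x) \<partial>M)"
    by (rule nn_integral_liminf) (use f in measurable)
  also have "\<dots> \<le> limsup (\<lambda>i. \<integral>\<^sup>+x. ennreal (f i x) \<partial>M)" by (rule Liminf_le_Limsup) simp
  also have "\<dots> \<le> ennreal C"
  proof (rule Limsup_bounded)
    show "\<forall>\<^sub>F i in sequentially. (\<integral>\<^sup>+x. ennreal (f i x) \<partial>M) \<le> ennreal C"
      using le by eventually_elim (subst nn_integral_eq_integral; use f in \<open>auto intro: ennreal_leI\<close>)
  qed
  finally have *: "(\<integral>\<^sup>+x. ennreal (F x) \<partial>M) \<le> ennreal C" .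
  show int: "integrable M F"
    using * F by (intro integrableI_nonneg) (auto simp: order_le_less_trans ennreal_less_top)
  obtain i where "integrable M (f i)" "(\<integral>x. f i x \<partial>M) \<le> C" using eventually_happens[OF le] by auto
  moreover have "(\<integral>x. f i x \<partial>M) \<ge> 0" using f by (intro Bochner_Integration.integral_nonneg) auto
  ultimately have "C \<ge> 0" by linarith
  have "ennreal (\<integral>x. F x \<partial>M) \<le> ennreal C"
    using * F by (subst nn_integral_eq_integral[symmetric, OF int]) auto
  thus "(\<integral>x. F x \<partial>M) \<le> C" using \<open>C \<ge> 0\<close> by simp
qed

lemma x_ln_x_ge: "(x::real) \<ge> 0 \<Longrightarrow> x * ln x \<ge> - 1"
  using gibbs_pointwise[of x 1] by simp

lemma KL_cong: "(\<And>a. a \<in> A \<Longrightarrow> q a = q' a) \<Longrightarrow> KL A q w = KL A q' w"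
  by (simp add: KL_def)

text \<open>The step densities \<open>G k\<close> have increasing entropies \<open>H k\<close>
  bounded by c. The increment \<open>H l - H k\<close> is the integral of G_l ln(G_l/G_k) and
  controls the L1 distance, so \<open>G\<close> is Cauchy in L1. The limit keeps the marginals by L1
  convergence and the entropy bound by Fatou's lemma.\<close>

lemma consistent_marginals_density:
  assumes q: "\<And>k. distr_on (Pow {1..k}) (q k)"
    and cons: "\<And>k l S. k \<le> l \<Longrightarrow> S \<in> Pow {1..k} \<Longrightarrow>
      q k S = (\<Sum>T\<in>Pow {1..l}. if T \<inter> {1..k} = S then q l T else 0)"
    and le: "\<And>k. KL (Pow {1..k}) (q k) (wt k) \<le> c"
  obtains g where "fin_ent g" "ent g \<le> c" "\<And>k S. S \<in> Pow {1..k} \<Longrightarrow> marg (law g) k S = q k S"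
proof -
  define H where "H = (\<lambda>k. KL (Pow {1..k}) (q k) (wt k))"
  define G where "G = (\<lambda>k. step_density k (q k))"
  have fe: "fin_ent (G k)" and ent: "ent (G k) = H k" for k
    unfolding G_def H_def by (rule step_density_props[OF q])+
  have G [measurable]: "G k \<in> borel_measurable nu" and G0: "G k x \<ge> 0" and Gi: "integrable nu (G k)"
    and G1: "(\<integral>x. G k x \<partial>nu) = 1" and Gln: "integrable nu (\<lambda>x. G k x * ln (G k x))" for k x
    using fe[of k] by (auto simp: fin_ent_def)
  have marg: "marg (law (G l)) k S = q k S" if "k \<le> l" "S \<in> Pow {1..k}" for k l S
  proof -
    interpret L: law01 "law (G l)" by (rule law01_law[OF fe])
    show ?thesis unfolding L.marg_pushforward[OF that(1)] cons[OF that]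
      by (intro sum.cong refl if_cong) (simp add: G_def step_density_props(3)[OF q])
  qed
  have mono: "H k \<le> H l" if "k \<le> l" for k l
  proof -
    have "KL (Pow {1..k}) (marg (law (G l)) k) (wt k) \<le> ent (G l)" by (rule KL_marg_le_ent[OF fe])
    moreover have "KL (Pow {1..k}) (marg (law (G l)) k) (wt k) = H k"
      unfolding H_def by (rule KL_cong) (rule marg[OF that])
    ultimately show ?thesis using ent by simp
  qed
  \<comment> \<open>A digit pattern of probability 0 has only extensions of probability 0; this is
    the side condition of \<open>abs_diff_le_entropy\<close>.\<close>
  have zero: "G l x = 0" if "k \<le> l" "G k x = 0" for k l x
  proof -
    have "q k (digits k x) = 0" using that(2) wt_pos[of k "digits k x"] by (simp add: G_def step_density_def)
    hence "(\<Sum>T\<in>Pow {1..l}. if T \<inter> {1..k} = digits k x then q l T else 0) = 0"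
      using cons[OF that(1) digits_subset] by simp
    hence "(if digits l x \<inter> {1..k} = digits k x then q l (digits l x) else 0) = 0"
      by (subst (asm) sum_nonneg_eq_0_iff) (use q[of l] digits_subset[of l x] in \<open>auto simp: distr_on_def\<close>)
    moreover have "digits k x = digits l x \<inter> {1..k}" using that(1) by (auto simp: digits_def)
    ultimately show ?thesis by (simp add: G_def step_density_def)
  qed
  \<comment> \<open>\<open>ln (G k x)\<close> sees only the first k digits, whose marginal under
    \<open>law (G l)\<close> is \<open>q k\<close>: the martingale property in integrated
    form.\<close>
  have cross: "integrable nu (\<lambda>x. G l x * ln (G k x))" "(\<integral>x. G l x * ln (G k x) \<partial>nu) = H k" if "k \<le> l" for k l
  proof -
    interpret L: law01 "law (G l)" by (rule law01_law[OF fe])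
    have ln: "(\<lambda>x. ln (G k x)) = (\<lambda>x. ln (q k (digits k x) / wt k (digits k x)))" by (simp add: G_def step_density_def)
    show "integrable nu (\<lambda>x. G l x * ln (G k x))"
    proof (subst integral_law(2)[OF fe, symmetric])
      show "integrable (law (G l)) (\<lambda>x. ln (G k x))" unfolding ln by (rule L.integral_digits(1))
    qed simp
    have "(\<integral>x. G l x * ln (G k x) \<partial>nu) = (\<integral>x. ln (G k x) \<partial>law (G l))"
      by (rule integral_law(1)[OF fe, symmetric]) simp
    also have "\<dots> = (\<Sum>S\<in>Pow {1..k}. ln (q k S / wt k S) * marg (law (G l)) k S)"
      unfolding ln by (rule L.integral_digits(2))
    also have "\<dots> = H k"
      unfolding H_def KL_def using marg[OF that] by (intro sum.cong refl) (simp add: mult.commute)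
    finally show "(\<integral>x. G l x * ln (G k x) \<partial>nu) = H k" .
  qed
  have L1: "(\<integral>x. \<bar>G l x - G k x\<bar> \<partial>nu) \<le> (H l - H k) / (4 * \<eta>) + 4 * \<eta>" if "k \<le> l" "\<eta> > 0" for k l \<eta>
  proof -
    have "(\<integral>x. \<bar>G l x - G k x\<bar> \<partial>nu) \<le> (\<integral>x. (G l x * ln (G l x) - G l x * ln (G k x) - G l x + G k x) / (4 * \<eta>)
        + 2 * \<eta> * (G l x + G k x) \<partial>nu)"
    proof (rule integral_mono)
      show "\<bar>G l x - G k x\<bar> \<le> (G l x * ln (G l x) - G l x * ln (G k x) - G l x + G k x) / (4 * \<eta>)
        + 2 * \<eta> * (G l x + G k x)" for x
        by (rule abs_diff_le_entropy) (use G0 zero that in auto)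
    qed (use Gi Gln cross(1)[OF that(1)] in \<open>auto intro!: integrable_abs\<close>)
    also have "\<dots> = (H l - H k - 1 + 1) / (4 * \<eta>) + 2 * \<eta> * (1 + 1)"
      using Gi Gln cross[OF that(1)] G1 ent by (simp add: ent_def)
    finally show ?thesis by simp
  qed
  have "Cauchy H"
  proof (rule convergent_Cauchy)
    show "convergent H"
      by (rule incseq_convergent[of H c]) (use mono le in \<open>auto simp: incseq_def H_def convergent_def\<close>)
  qed
  have cauchy: "\<exists>N. \<forall>i\<ge>N. \<forall>j\<ge>N. (\<integral>x. norm (G i x - G j x) \<partial>nu) < e" if e: "e > 0" for e
  proof -
    \<comment> \<open>Then 4 \<eta> = e/4, and an increment of H below 4 \<eta> (e/4) adds less than
      another e/4.\<close>
    define \<eta> where "\<eta> = e / 16"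
    have eta: "\<eta> > 0" using e by (simp add: \<eta>_def)
    obtain N where N: "\<And>i j. i \<ge> N \<Longrightarrow> j \<ge> N \<Longrightarrow> \<bar>H i - H j\<bar> < 4 * \<eta> * (e / 4)"
    proof -
      have "4 * \<eta> * (e / 4) > 0" using eta e by simp
      from metric_CauchyD[OF \<open>Cauchy H\<close> this] that show ?thesis
        unfolding dist_real_def by blast
    qed
    have *: "(\<integral>x. norm (G l x - G k x) \<partial>nu) < e" if "N \<le> k" "k \<le> l" for k l
    proof -
      have "H l - H k < 4 * \<eta> * (e / 4)" using N[of l k] that by auto
      hence "(H l - H k) / (4 * \<eta>) < e / 4" using eta by (simp add: field_simps)
      moreover have "4 * \<eta> = e / 4" by (simp add: \<eta>_def)
      ultimately show ?thesis using L1[OF that(2) eta] e unfolding real_norm_def by linarith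
    qed
    show ?thesis
    proof (intro exI[of _ N] allI impI)
      fix i j assume "N \<le> i" "N \<le> j"
      thus "(\<integral>x. norm (G i x - G j x) \<partial>nu) < e"
        using *[of i j] *[of j i] by (cases "i \<le> j") (simp_all add: abs_minus_commute)
    qed
  qed
  obtain r where r: "strict_mono r" and AEc: "AE x in nu. Cauchy (\<lambda>i. G (r i) x)"
    using cauchy_L1_AE_cauchy_subseq[of nu G] Gi cauchy by blast
  \<comment> \<open>Cutting at 0 makes g nonnegative also on the null set where the subsequence may
    fail to converge.\<close>
  define g where "g = (\<lambda>x. max 0 (lim (\<lambda>i. G (r i) x)))"
  have g [measurable]: "g \<in> borel_measurable nu" unfolding g_def by measurable
  have g0: "g x \<ge> 0" for x by (simp add: g_def)
  have lim: "AE x in nu. (\<lambda>i. G (r i) x) \<longlonglongrightarrow> g x"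
    using AEc
  proof eventually_elim
    case (elim x)
    hence 1: "(\<lambda>i. G (r i) x) \<longlonglongrightarrow> lim (\<lambda>i. G (r i) x)"
      by (simp add: Cauchy_convergent convergent_LIMSEQ_iff[symmetric])
    moreover have "lim (\<lambda>i. G (r i) x) \<ge> 0" by (rule LIMSEQ_le_const[OF 1]) (use G0 in auto)
    ultimately show ?case by (simp add: g_def)
  qed
  have dist: "\<exists>N. \<forall>j\<ge>N. integrable nu (\<lambda>x. \<bar>G (r j) x - g x\<bar>) \<and> (\<integral>x. \<bar>G (r j) x - g x\<bar> \<partial>nu) \<le> e" if e: "e > 0" for e
  proof -
    obtain N where N: "\<And>i j. i \<ge> N \<Longrightarrow> j \<ge> N \<Longrightarrow> (\<integral>x. norm (G i x - G j x) \<partial>nu) < e" using cauchy[OF e] by blast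
    have "integrable nu (\<lambda>x. \<bar>G (r j) x - g x\<bar>) \<and> (\<integral>x. \<bar>G (r j) x - g x\<bar> \<partial>nu) \<le> e" if j: "j \<ge> N" for j
    proof -
      have AE: "AE x in nu. (\<lambda>i. \<bar>G (r j) x - G (r i) x\<bar>) \<longlonglongrightarrow> \<bar>G (r j) x - g x\<bar>"
        using lim by eventually_elim (intro tendsto_intros)
      have ev: "\<forall>\<^sub>F i in sequentially. integrable nu (\<lambda>x. \<bar>G (r j) x - G (r i) x\<bar>) \<and> (\<integral>x. \<bar>G (r j) x - G (r i) x\<bar> \<partial>nu) \<le> e"
        using eventually_ge_at_top[of N]
      proof eventually_elim
        case (elim i)
        have "r j \<ge> N" "r i \<ge> N" using seq_suble[OF r, of i] seq_suble[OF r, of j] elim j by linarith+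
        from N[OF this] show ?case using Gi by (auto intro!: integrable_abs)
      qed
      show ?thesis
        by (intro conjI fatou_real[where f = "\<lambda>i x. \<bar>G (r j) x - G (r i) x\<bar>", OF _ _ _ _ AE ev]) auto
    qed
    thus ?thesis by blast
  qed
  have ig: "integrable nu g"
  proof -
    obtain j where "integrable nu (\<lambda>x. \<bar>G (r j) x - g x\<bar>)" using dist[of 1] by auto
    hence "integrable nu (\<lambda>x. G (r j) x - g x)" by (subst (asm) integrable_abs_iff) measurable
    from Bochner_Integration.integrable_diff[OF Gi this, of "r j"] show ?thesis by simp
  qed
  \<comment> \<open>L1 convergence passes to bounded test functions, against which the integrals of
    \<open>G j\<close> are constant from k on. The choice h = 1 gives total mass 1, digit indicators
    give the marginals.\<close>
  have conv: "(\<integral>x. g x * h x \<partial>nu) = C"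
    if h [measurable]: "h \<in> borel_measurable nu" and h1: "\<And>x. \<bar>h x\<bar> \<le> 1"
      and C: "\<And>j. j \<ge> k \<Longrightarrow> (\<integral>x. G j x * h x \<partial>nu) = C" for h C k
  proof -
    have ih: "integrable nu (\<lambda>x. u x * h x)" if "integrable nu u" for u
      by (rule Bochner_Integration.integrable_bound[OF that])
        (use that h1 in \<open>auto simp: abs_mult intro!: AE_I2 mult_left_le\<close>)
    have "\<bar>(\<integral>x. g x * h x \<partial>nu) - C\<bar> \<le> e" if e: "e > 0" for e
    proof -
      obtain N where N: "\<And>j. j \<ge> N \<Longrightarrow> (\<integral>x. \<bar>G (r j) x - g x\<bar> \<partial>nu) \<le> e" using dist[OF e] by blast
      define j where "j = max N k"
      have jr: "r j \<ge> k" using seq_suble[OF r, of j] by (simp add: j_def)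
      have "(\<integral>x. g x * h x \<partial>nu) - C = (\<integral>x. g x * h x - G (r j) x * h x \<partial>nu)"
        using C[OF jr] ih[OF ig] ih[OF Gi] by simp
      also have "\<bar>\<dots>\<bar> \<le> (\<integral>x. \<bar>g x * h x - G (r j) x * h x\<bar> \<partial>nu)"
        by (rule integral_abs_bound)
      also have "\<dots> \<le> (\<integral>x. \<bar>G (r j) x - g x\<bar> \<partial>nu)"
      proof (rule integral_mono)
        fix x
        have "\<bar>g x * h x - G (r j) x * h x\<bar> = \<bar>G (r j) x - g x\<bar> * \<bar>h x\<bar>"
          by (simp add: abs_mult[symmetric] algebra_simps abs_minus_commute)
        also have "\<dots> \<le> \<bar>G (r j) x - g x\<bar>" using h1[of x] by (intro mult_left_le) auto
        finally show "\<bar>g x * h x - G (r j) x * h x\<bar> \<le> \<bar>G (r j) x - g x\<bar>" .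
      qed (use ih[OF ig] ih[OF Gi] ig Gi in auto)
      also have "\<dots> \<le> e" using N[of j] by (simp add: j_def)
      finally show ?thesis .
    qed
    hence "\<bar>(\<integral>x. g x * h x \<partial>nu) - C\<bar> \<le> 0" by (rule field_le_epsilon[of _ 0, simplified])
    thus ?thesis by simp
  qed
  have int1: "(\<integral>x. g x \<partial>nu) = 1" using conv[of "\<lambda>_. 1" 0 1] G1 by simp
  \<comment> \<open>Adding 1 makes x ln x + 1 nonnegative, as Fatou's lemma requires.\<close>
  have entle: "integrable nu (\<lambda>x. g x * ln (g x) + 1)" "(\<integral>x. g x * ln (g x) + 1 \<partial>nu) \<le> c + 1"
  proof -
    have AE: "AE x in nu. (\<lambda>i. G (r i) x * ln (G (r i) x) + 1) \<longlonglongrightarrow> g x * ln (g x) + 1"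
      using lim by eventually_elim (intro tendsto_intros tendsto_x_ln_x; use g0 G0 in auto)
    have ev: "\<forall>\<^sub>F i in sequentially. integrable nu (\<lambda>x. G (r i) x * ln (G (r i) x) + 1) \<and> (\<integral>x. G (r i) x * ln (G (r i) x) + 1 \<partial>nu) \<le> c + 1"
    proof (intro always_eventually allI conjI)
      fix i
      show "integrable nu (\<lambda>x. G (r i) x * ln (G (r i) x) + 1)" using Gln by simp
      show "(\<integral>x. G (r i) x * ln (G (r i) x) + 1 \<partial>nu) \<le> c + 1"
        using Gln nu.prob_space ent[of "r i"] le[of "r i"] by (simp add: ent_def H_def)
    qed
    have nonneg: "0 \<le> G k x * ln (G k x) + 1" "0 \<le> g x * ln (g x) + 1" for k x
      using x_ln_x_ge[OF G0[of k x]] x_ln_x_ge[OF g0[of x]] by simp_all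
    show "integrable nu (\<lambda>x. g x * ln (g x) + 1)"
      by (rule fatou_real(1)[where f = "\<lambda>i x. G (r i) x * ln (G (r i) x) + 1", OF _ _ _ _ AE ev])
        (simp_all add: nonneg)
    show "(\<integral>x. g x * ln (g x) + 1 \<partial>nu) \<le> c + 1"
      by (rule fatou_real(2)[where f = "\<lambda>i x. G (r i) x * ln (G (r i) x) + 1", OF _ _ _ _ AE ev])
        (simp_all add: nonneg)
  qed
  have igl: "integrable nu (\<lambda>x. g x * ln (g x))"
    using Bochner_Integration.integrable_diff[OF entle(1) nu.integrable_const[of 1]] by simp
  have feg: "fin_ent g" using g g0 ig int1 igl by (simp add: fin_ent_def)
  show ?thesis
  proof (rule that[OF feg])
    show "ent g \<le> c" using entle(2) igl nu.prob_space by (simp add: ent_def)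
    fix k :: nat and S assume S: "S \<in> Pow {1..k}"
    show "marg (law g) k S = q k S"
      unfolding marg_law[OF feg S]
    proof (rule conv[where k = k])
      show "(\<integral>x. G j x * (if digits k x = S then 1 else 0) \<partial>nu) = q k S" if "j \<ge> k" for j
        using marg_law[OF fe S, of j] marg[OF that S] by simp
      show "(\<lambda>x. if digits k x = S then 1 else 0) \<in> borel_measurable nu"
        by (rule nu.fun_digits_meas[of "\<lambda>T. if T = S then 1 else 0"])
    qed auto
  qed
qed

section \<open>The rate function in terms of densities, and limits of marginals\<close>

lemma I1_le:
  assumes "fin_ent g" shows "I1 (coprime_frac (law g)) \<le> ereal (ent g)"
proof -
  interpret L: law01 "law g" by (rule law01_law[OF assms])
  have "prob_space (law g)" by (rule L.prob_space_axioms)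
  moreover have "sets (law g) = sets borel01" by (rule L.sets_mu)
  ultimately show ?thesis unfolding I1_def
    by (intro INF_lower2[of "law g"]) (auto simp: coprime_frac_def rel_entropy_law[OF assms])
qed

text \<open>A strict bound on an infimum always has a witness; its entropy is below c and hence
  finite, so it has a density.\<close>

lemma I1_lessE:
  assumes "I1 x < c"
  obtains g where "fin_ent g" "ereal (ent g) < c" "coprime_frac (law g) = x"
proof -
  obtain \<mu> where mu: "prob_space \<mu>" "sets \<mu> = sets borel01" "(\<integral>u. (\<integral>v. fcop u v \<partial>\<mu>) \<partial>\<mu>) = x" "rel_entropy \<mu> nu < c"
    using assms unfolding I1_def INF_less_iff by blast
  have "law01 \<mu>" using mu by (simp add: law01_def law01_axioms_def)
  moreover have "rel_entropy \<mu> nu < \<infinity>" using mu(4) by (rule order_less_le_trans) simp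
  ultimately obtain g where "fin_ent g" "\<mu> = law g" "rel_entropy \<mu> nu = ereal (ent g)"
    by (rule rel_entropy_finite_law)
  thus ?thesis using mu that by (simp add: coprime_frac_def)
qed

lemma I1_nonneg: "0 \<le> I1 x"
proof (rule ccontr)
  assume "\<not> 0 \<le> I1 x"
  hence "I1 x < 0" by simp
  then obtain g where "fin_ent g" "ereal (ent g) < 0" by (rule I1_lessE)
  thus False using ent_nonneg[of g] by simp
qed

text \<open>Marginal probabilities lie in [0,1], so compactness of the product gives one subsequence
  that works for all k and S at once.\<close>

lemma convergent_marginals_subseq:
  fixes g :: "nat \<Rightarrow> real \<Rightarrow> real"
  assumes "\<And>m. fin_ent (g m)"
  obtains r q where "strict_mono r"
    "\<And>k S. S \<in> Pow {1..k} \<Longrightarrow> (\<lambda>i. marg (law (g (r i))) k S) \<longlonglongrightarrow> q k S"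
proof -
  \<comment> \<open>Finite digit sets are represented by lists, so that the index type is countable.\<close>
  define p where "p = (\<lambda>m (k, xs). marg (law (g m)) k (set xs))"
  let ?C = "PiE UNIV (\<lambda>_. {0..1}) :: (nat \<times> nat list \<Rightarrow> real) set"
  have "compact ?C"
    using compactin_PiE[of "\<lambda>_. euclidean :: real topology" "UNIV :: (nat \<times> nat list) set" "\<lambda>_. {0..1}"]
    by (simp add: euclidean_product_topology)
  moreover have "p m \<in> ?C" for m
  proof -
    interpret L: law01 "law (g m)" by (rule law01_law[OF assms])
    show ?thesis by (auto simp: p_def marg_def)
  qed
  ultimately obtain l r where r: "strict_mono r" "(p \<circ> r) \<longlonglongrightarrow> l"
    using seq_compactE[OF compact_imp_seq_compact, of ?C p] by blast
  have *: "(\<lambda>i. p (r i) a) \<longlonglongrightarrow> l a" for a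
  proof -
    have "continuous_on UNIV (\<lambda>x::nat \<times> nat list \<Rightarrow> real. x a)"
      by (rule continuous_on_product_coordinates)
    from continuous_on_tendsto_compose[OF this r(2)] show ?thesis by (simp add: o_def)
  qed
  show ?thesis
  proof (rule that[OF r(1)])
    fix k S assume "S \<in> Pow {1..k::nat}"
    hence "finite S" using finite_subset by auto
    thus "(\<lambda>i. marg (law (g (r i))) k S) \<longlonglongrightarrow> l (k, sorted_list_of_set S)"
      using *[of "(k, sorted_list_of_set S)"] by (simp add: p_def)
  qed
qed

lemma KL_tendsto:
  assumes "\<And>a. a \<in> A \<Longrightarrow> (\<lambda>i. p i a) \<longlonglongrightarrow> q a" "\<And>i a. a \<in> A \<Longrightarrow> p i a \<ge> 0" "\<And>a. a \<in> A \<Longrightarrow> w a > 0"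
  shows "(\<lambda>i. KL A (p i) w) \<longlonglongrightarrow> KL A q w"
  unfolding KL_def
proof (intro tendsto_sum)
  fix a assume a: "a \<in> A"
  have q0: "q a \<ge> 0" by (rule LIMSEQ_le_const[OF assms(1)[OF a]]) (use assms(2) a in auto)
  have eq: "x * ln (x / w a) = x * ln x - x * ln (w a)" if "x \<ge> 0" for x
    using that assms(3)[OF a] by (cases "x = 0") (auto simp: ln_div algebra_simps)
  have "(\<lambda>i. p i a * ln (p i a) - p i a * ln (w a)) \<longlonglongrightarrow> q a * ln (q a) - q a * ln (w a)"
    by (intro tendsto_intros tendsto_x_ln_x assms(1) a q0) (use assms(2) a in auto)
  thus "(\<lambda>i. p i a * ln (p i a / w a)) \<longlonglongrightarrow> q a * ln (q a / w a)"
    using eq q0 assms(2)[OF a] by simp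
qed

lemma trunc_frac_tendsto_marg:
  assumes "\<And>S. S \<in> Pow {1..k} \<Longrightarrow> (\<lambda>i. p i S) \<longlonglongrightarrow> q S"
  shows "(\<lambda>i. trunc_frac k (p i)) \<longlonglongrightarrow> trunc_frac k q"
  unfolding trunc_frac_def using assms by (intro tendsto_sum) (auto intro!: tendsto_mult)

lemma I1_lower_semicontinuous:
  assumes x: "X \<longlonglongrightarrow> x" and le: "\<And>m. I1 (X m) \<le> ereal c"
  shows "I1 x \<le> ereal c"
proof -
  \<comment> \<open>The slack 1/(m + 1) stands in for a minimiser of the infimum and vanishes along
    the subsequence.\<close>
  have "\<exists>g. fin_ent g \<and> ent g \<le> c + 1 / Suc m \<and> coprime_frac (law g) = X m" for m
  proof -
    have "I1 (X m) < ereal (c + 1 / Suc m)" by (rule order_le_less_trans[OF le]) simp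
    from I1_lessE[OF this] show ?thesis by (metis ereal_less_eq(3) less_imp_le)
  qed
  then obtain g where g: "\<And>m. fin_ent (g m)" "\<And>m. ent (g m) \<le> c + 1 / Suc m" "\<And>m. coprime_frac (law (g m)) = X m"
    by metis
  obtain r q where r: "strict_mono r"
    and q: "\<And>k S. S \<in> Pow {1..k} \<Longrightarrow> (\<lambda>i. marg (law (g (r i))) k S) \<longlonglongrightarrow> q k S"
    using convergent_marginals_subseq[of g, OF g(1)] by blast
  have nn: "marg \<mu> k S \<ge> 0" for \<mu> k S by (simp add: marg_def)
  have L: "law01 (law (g m))" for m by (rule law01_law[OF g(1)])
  have dq: "distr_on (Pow {1..k}) (q k)" for k
  proof -
    have "(\<lambda>i. sum (marg (law (g (r i))) k) (Pow {1..k})) \<longlonglongrightarrow> sum (q k) (Pow {1..k})"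
      by (intro tendsto_sum q)
    moreover have "sum (marg (law (g (r i))) k) (Pow {1..k}) = 1" for i
      using law01.distr_on_marg[OF L] by (simp add: distr_on_def)
    ultimately have "sum (q k) (Pow {1..k}) = 1" by (simp add: LIMSEQ_const_iff)
    moreover have "q k S \<ge> 0" if "S \<in> Pow {1..k}" for S
      by (rule LIMSEQ_le_const[OF q[OF that]]) (use nn in auto)
    ultimately show ?thesis by (simp add: distr_on_def)
  qed
  have cons: "q k S = (\<Sum>T\<in>Pow {1..l}. if T \<inter> {1..k} = S then q l T else 0)" if "k \<le> l" "S \<in> Pow {1..k}" for k l S
  proof (rule LIMSEQ_unique)
    show "(\<lambda>i. marg (law (g (r i))) k S) \<longlonglongrightarrow> q k S" by (rule q[OF that(2)])
    have "(\<lambda>i. \<Sum>T\<in>Pow {1..l}. if T \<inter> {1..k} = S then marg (law (g (r i))) l T else 0) \<longlonglongrightarrow>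
      (\<Sum>T\<in>Pow {1..l}. if T \<inter> {1..k} = S then q l T else 0)"
      by (intro tendsto_sum) (use q in auto)
    thus "(\<lambda>i. marg (law (g (r i))) k S) \<longlonglongrightarrow> (\<Sum>T\<in>Pow {1..l}. if T \<inter> {1..k} = S then q l T else 0)"
      unfolding law01.marg_pushforward[OF L that(1)] .
  qed
  have KLle: "KL (Pow {1..k}) (q k) (wt k) \<le> c" for k
  proof (rule LIMSEQ_le)
    show "(\<lambda>i. KL (Pow {1..k}) (marg (law (g (r i))) k) (wt k)) \<longlonglongrightarrow> KL (Pow {1..k}) (q k) (wt k)"
      by (intro KL_tendsto q nn wt_pos)
    have "(\<lambda>m. c + 1 / real (Suc m)) \<longlonglongrightarrow> c + 0" by (intro tendsto_intros LIMSEQ_Suc[OF lim_1_over_n])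
    from LIMSEQ_subseq_LIMSEQ[OF this r] show "(\<lambda>i. c + 1 / real (Suc (r i))) \<longlonglongrightarrow> c" by (simp add: o_def)
    show "\<exists>N. \<forall>i\<ge>N. KL (Pow {1..k}) (marg (law (g (r i))) k) (wt k) \<le> c + 1 / real (Suc (r i))"
      using KL_marg_le_ent[OF g(1)] g(2) by (meson order_trans)
  qed
  obtain h where h: "fin_ent h" "ent h \<le> c" "\<And>k S. S \<in> Pow {1..k} \<Longrightarrow> marg (law h) k S = q k S"
    using consistent_marginals_density[of q c, OF dq cons KLle] by blast
  have "\<bar>x - coprime_frac (law h)\<bar> \<le> 0 + e" if e: "e > 0" for e
  proof -
    \<comment> \<open>Every \<open>g m\<close> and the limit density h have entropy at most c + 1,
      so a single k serves them all.\<close>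
    obtain k where k: "\<And>g. fin_ent g \<Longrightarrow> ent g \<le> c + 1 \<Longrightarrow> \<bar>trunc_frac k (marg (law g) k) - coprime_frac (law g)\<bar> \<le> e / 2"
      using trunc_frac_uniform[of "e / 2" "c + 1"] e by auto
    have 1: "\<bar>trunc_frac k (q k) - coprime_frac (law h)\<bar> \<le> e / 2"
    proof -
      have "trunc_frac k (q k) = trunc_frac k (marg (law h) k)" unfolding trunc_frac_def using h(3) by (intro sum.cong refl if_cong) auto
      thus ?thesis using k[of h] h by simp
    qed
    have "\<bar>trunc_frac k (q k) - x\<bar> \<le> e / 2"
    proof (rule LIMSEQ_le_const2)
      have "(\<lambda>i. X (r i)) \<longlonglongrightarrow> x" using LIMSEQ_subseq_LIMSEQ[OF x r] by (simp add: o_def)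
      thus "(\<lambda>i. \<bar>trunc_frac k (marg (law (g (r i))) k) - X (r i)\<bar>) \<longlonglongrightarrow> \<bar>trunc_frac k (q k) - x\<bar>"
        by (intro tendsto_intros trunc_frac_tendsto_marg q)
      have "ent (g m) \<le> c + 1" for m by (rule order_trans[OF g(2)]) simp
      thus "\<exists>N. \<forall>i\<ge>N. \<bar>trunc_frac k (marg (law (g (r i))) k) - X (r i)\<bar> \<le> e / 2"
        using k[OF g(1)] g(3) by metis
    qed
    with 1 show ?thesis by linarith
  qed
  hence "\<bar>x - coprime_frac (law h)\<bar> \<le> 0" by (rule field_le_epsilon)
  hence "x = coprime_frac (law h)" by simp
  thus ?thesis using I1_le[OF h(1)] h(2) by (metis ereal_less_eq(3) order_trans)
qed

section \<open>The large deviation principle\<close>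

definition coprime_pairs :: "nat \<Rightarrow> (nat \<Rightarrow> nat) \<Rightarrow> real" where
  "coprime_pairs n X = (\<Sum>i<n. \<Sum>j<n. if gcd (X i) (X j) = 1 then 1 else 0) / (real n)\<^sup>2"

abbreviation emp_idx :: "nat \<Rightarrow> nat \<Rightarrow> (nat \<Rightarrow> nat) \<Rightarrow> nat set \<Rightarrow> real" where
  "emp_idx n k X \<equiv> emp n (prime_idx k \<circ> X)"

lemma measure_Pn: "measure_pmf.prob (Pn n) A = measure_pmf.prob (sample n) {X. coprime_pairs n X \<in> A}"
  by (simp add: Pn_def coprime_pairs_def vimage_def)

lemma coprime_pairs_bounds: "coprime_pairs n X \<in> {0..1}"
proof -
  have "(\<Sum>i<n. \<Sum>j<n. if gcd (X i) (X j) = 1 then 1 else 0 :: real) \<le> (\<Sum>i<n. \<Sum>j<n. 1)"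
    by (intro sum_mono) auto
  also have "\<dots> = (real n)\<^sup>2" by (simp add: power2_eq_square)
  finally have "coprime_pairs n X \<le> (real n)\<^sup>2 / (real n)\<^sup>2"
    unfolding coprime_pairs_def by (intro divide_right_mono) auto
  also have "\<dots> \<le> 1" by simp
  finally show ?thesis by (auto simp: coprime_pairs_def intro!: divide_nonneg_nonneg sum_nonneg)
qed

lemma prime_idx_subset: "prime_idx k m \<in> Pow {1..k}" by (auto simp: prime_idx_def)

lemma prime_idx_range: "(prime_idx k \<circ> X) ` {..<n} \<subseteq> Pow {1..k}"
  using prime_idx_subset by auto

lemma trunc_frac_emp:
  assumes "n > 0"
  shows "trunc_frac k (emp_idx n k X) =
    (\<Sum>i<n. \<Sum>j<n. if prime_idx k (X i) \<inter> prime_idx k (X j) = {} then 1 else 0) / (real n)\<^sup>2"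
proof -
  note se = sum_emp[OF assms _ prime_idx_range[of k X n]]
  let ?e = "emp_idx n k X"
  have "(\<Sum>i<n. \<Sum>j<n. if prime_idx k (X i) \<inter> prime_idx k (X j) = {} then 1 else 0 :: real) =
      (\<Sum>i<n. n * (\<Sum>T\<in>Pow {1..k}. ?e T * (if prime_idx k (X i) \<inter> T = {} then 1 else 0)))"
    using se[of "\<lambda>T. if _ \<inter> T = {} then 1 else 0"] by simp
  also have "\<dots> = n * (\<Sum>S\<in>Pow {1..k}. ?e S * (n * (\<Sum>T\<in>Pow {1..k}. ?e T * (if S \<inter> T = {} then 1 else 0))))"
    using se[of "\<lambda>S. n * (\<Sum>T\<in>Pow {1..k}. ?e T * (if S \<inter> T = {} then 1 else 0))"] by simp
  also have "\<dots> = (real n)\<^sup>2 * (\<Sum>S\<in>Pow {1..k}. \<Sum>T\<in>Pow {1..k}. ?e S * (?e T * (if S \<inter> T = {} then 1 else 0)))"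
    by (simp add: sum_distrib_left power2_eq_square mult_ac)
  also have "(\<Sum>S\<in>Pow {1..k}. \<Sum>T\<in>Pow {1..k}. ?e S * (?e T * (if S \<inter> T = {} then 1 else 0))) = trunc_frac k ?e"
    unfolding trunc_frac_def by (intro sum.cong refl) auto
  finally show ?thesis using assms by simp
qed

text \<open>The truncation misjudges a pair only if its members share a prime of index beyond k, and
  that index is at most n because p_l > l. Summed over all pairs, the product of the two
  divisibility indicators becomes the square of a count.\<close>

lemma coprime_pairs_approx:
  assumes n: "n > 0" and X: "\<And>i. i < n \<Longrightarrow> X i \<in> {1..n}"
  shows "\<bar>coprime_pairs n X - trunc_frac k (emp_idx n k X)\<bar> \<le> (\<Sum>l\<in>{k<..n}. (frac_dvd n X l)\<^sup>2)"
proof -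
  let ?c = "\<lambda>i l. if prime_seq l dvd X i then 1 else 0 :: real"
  let ?g = "\<lambda>i j. if gcd (X i) (X j) = 1 then 1 else 0 :: real"
  let ?f = "\<lambda>i j. if prime_idx k (X i) \<inter> prime_idx k (X j) = {} then 1 else 0 :: real"
  have pair: "\<bar>?g i j - ?f i j\<bar> \<le> (\<Sum>l\<in>{k<..n}. ?c i l * ?c j l)" if ij: "i < n" "j < n" for i j
  proof (cases "gcd (X i) (X j) = 1")
    case True
    have "prime_idx k (X i) \<inter> prime_idx k (X j) = {}"
    proof (rule ccontr)
      assume "prime_idx k (X i) \<inter> prime_idx k (X j) \<noteq> {}"
      then obtain l where "prime_seq l dvd X i" "prime_seq l dvd X j" by (auto simp: prime_idx_def)
      hence "prime_seq l dvd gcd (X i) (X j)" by simp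
      thus False using True prime_seq_gt_1[of l] by simp
    qed
    thus ?thesis using True by (simp add: sum_nonneg)
  next
    case False
    show ?thesis
    proof (cases "prime_idx k (X i) \<inter> prime_idx k (X j) = {}")
      case True
      obtain p where p: "prime p" "p dvd gcd (X i) (X j)" using False prime_factor_nat by blast
      obtain l where l: "l \<ge> 1" "prime_seq l = p" using prime_seq_surj[OF p(1)] by blast
      have dvd: "prime_seq l dvd X i" "prime_seq l dvd X j" using p l by auto
      have "l > k"
      proof (rule ccontr)
        assume "\<not> l > k"
        hence "l \<in> prime_idx k (X i) \<inter> prime_idx k (X j)" using l dvd by (auto simp: prime_idx_def)
        thus False using True by blast
      qed
      moreover have "l \<le> n"
      proof -
        have "l < prime_seq l" by (rule prime_seq_gt[OF l(1)])
        also have "\<dots> \<le> X i" using dvd(1) X[OF ij(1)] by (intro dvd_imp_le) auto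
        also have "\<dots> \<le> n" using X[OF ij(1)] by simp
        finally show ?thesis by simp
      qed
      ultimately have "?c i l * ?c j l \<le> (\<Sum>l\<in>{k<..n}. ?c i l * ?c j l)"
        by (intro member_le_sum) auto
      thus ?thesis using True False dvd by simp
    next
      case False': False
      thus ?thesis using False by (simp add: sum_nonneg)
    qed
  qed
  have cnt: "(\<Sum>i<n. ?c i l) = n * frac_dvd n X l" for l
    using n by (simp add: frac_dvd_def sum.If_cases Int_def)
  have "\<bar>\<Sum>i<n. \<Sum>j<n. ?g i j - ?f i j\<bar> \<le> (\<Sum>i<n. \<Sum>j<n. \<bar>?g i j - ?f i j\<bar>)"
    by (rule order_trans[OF sum_abs]) (intro sum_mono sum_abs)
  also have "\<dots> \<le> (\<Sum>i<n. \<Sum>j<n. \<Sum>l\<in>{k<..n}. ?c i l * ?c j l)"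
    by (rule sum_mono, rule sum_mono, rule pair) auto
  also have "\<dots> = (\<Sum>i<n. \<Sum>l\<in>{k<..n}. \<Sum>j<n. ?c i l * ?c j l)"
    by (rule sum.cong[OF refl], rule sum.swap)
  also have "\<dots> = (\<Sum>l\<in>{k<..n}. \<Sum>i<n. \<Sum>j<n. ?c i l * ?c j l)"
    by (rule sum.swap)
  also have "\<dots> = (\<Sum>l\<in>{k<..n}. (real n * frac_dvd n X l)\<^sup>2)"
    by (intro sum.cong refl) (simp only: power2_eq_square cnt[symmetric] sum_product)
  also have "\<dots> = (real n)\<^sup>2 * (\<Sum>l\<in>{k<..n}. (frac_dvd n X l)\<^sup>2)"
    by (simp add: power_mult_distrib sum_distrib_left)
  finally have "\<bar>\<Sum>i<n. \<Sum>j<n. ?g i j - ?f i j\<bar> / (real n)\<^sup>2 \<le> (\<Sum>l\<in>{k<..n}. (frac_dvd n X l)\<^sup>2)"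
    using n by (simp add: divide_le_eq mult.commute)
  moreover have "coprime_pairs n X - trunc_frac k (emp_idx n k X) = (\<Sum>i<n. \<Sum>j<n. ?g i j - ?f i j) / (real n)\<^sup>2"
    by (simp add: coprime_pairs_def trunc_frac_emp[OF n] sum_subtractf diff_divide_distrib)
  ultimately show ?thesis by (simp only: abs_divide abs_power2)
qed

lemma exponential_approx:
  assumes "\<epsilon> > 0"
  shows "\<exists>k0. \<forall>k\<ge>k0. \<forall>n>0. measure_pmf.prob (sample n)
    {X. \<bar>coprime_pairs n X - trunc_frac k (emp_idx n k X)\<bar> > \<epsilon>} \<le> exp (- real n * M)"
proof -
  obtain k0 where k0: "\<And>k n. k \<ge> k0 \<Longrightarrow> n > 0 \<Longrightarrow>
      measure_pmf.prob (sample n) {X. (\<Sum>i\<in>{k<..n}. (frac_dvd n X i)\<^sup>2) > \<epsilon>} \<le> exp (- real n * M)"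
    using prob_sum_squares_tail[OF assms, of M] by blast
  show ?thesis
  proof (intro exI[of _ k0] allI impI)
    fix k n assume k: "k \<ge> k0" and n: "(n::nat) > 0"
    have "measure_pmf.prob (sample n) {X. \<bar>coprime_pairs n X - trunc_frac k (emp_idx n k X)\<bar> > \<epsilon>} \<le>
      measure_pmf.prob (sample n) {X. (\<Sum>i\<in>{k<..n}. (frac_dvd n X i)\<^sup>2) > \<epsilon>}"
    \<comment> \<open>The values lie in {1..n} only on the support of the sample, so the events are
      compared almost surely.\<close>
    proof (rule measure_pmf.finite_measure_mono_AE, rule AE_pmfI, rule impI)
      fix X assume X: "X \<in> set_pmf (sample n)" "X \<in> {X. \<bar>coprime_pairs n X - trunc_frac k (emp_idx n k X)\<bar> > \<epsilon>}"
      have Xr: "X i \<in> {1..n}" if "i < n" for i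
        using X(1) set_Pi_pmf_subset'[OF finite_lessThan, of n 0 "\<lambda>_. unif n"] that n by (auto simp: PiE_dflt_def)
      have "\<bar>coprime_pairs n X - trunc_frac k (emp_idx n k X)\<bar> \<le> (\<Sum>i\<in>{k<..n}. (frac_dvd n X i)\<^sup>2)"
        by (rule coprime_pairs_approx[OF n]) (rule Xr)
      with X(2) show "X \<in> {X. (\<Sum>i\<in>{k<..n}. (frac_dvd n X i)\<^sup>2) > \<epsilon>}" by auto
    qed simp
    also have "\<dots> \<le> exp (- real n * M)" by (rule k0[OF k n])
    finally show "measure_pmf.prob (sample n) {X. \<bar>coprime_pairs n X - trunc_frac k (emp_idx n k X)\<bar> > \<epsilon>} \<le> exp (- real n * M)" .
  qed
qed

abbreviation idx_pmf :: "nat \<Rightarrow> nat \<Rightarrow> nat set pmf" where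
  "idx_pmf k n \<equiv> map_pmf (prime_idx k) (unif n)"

text \<open>The image of the sample is an i.i.d. sample from the finite alphabet. The default value
  outside {..<n} becomes \<open>prime_idx k 0\<close>, the full set {1..k}, as every prime divides
  0; \<open>emp\<close> does not look there.\<close>

lemma prob_emp_idx:
  "measure_pmf.prob (sample n) {X. P (emp_idx n k X)} =
   measure_pmf.prob (Pi_pmf {..<n} (prime_idx k 0) (\<lambda>_. idx_pmf k n)) {s. P (emp n s)}"
  by (subst Pi_pmf_map) (auto simp: vimage_def)

lemma set_idx_pmf: "set_pmf (idx_pmf k n) \<subseteq> Pow {1..k}"
  using prime_idx_subset by auto

lemma trunc_frac_lipschitz:
  fixes \<delta> :: real
  assumes p: "distr_on (Pow {1..k}) p" and q: "distr_on (Pow {1..k}) q"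
    and d: "\<And>S. S \<in> Pow {1..k} \<Longrightarrow> \<bar>p S - q S\<bar> \<le> \<delta>"
  shows "\<bar>trunc_frac k p - trunc_frac k q\<bar> \<le> (card (Pow {1..k}))\<^sup>2 * (2 * \<delta>)"
proof -
  let ?A = "Pow {1..k}"
  have A: "finite ?A" by simp
  have pt: "\<bar>p S * p T - q S * q T\<bar> \<le> 2 * \<delta>" if "S \<in> ?A" "T \<in> ?A" for S T
  proof -
    have b: "0 \<le> p S" "p S \<le> 1" "0 \<le> q T" "q T \<le> 1"
      using p q that distr_on_le_1[OF A p] distr_on_le_1[OF A q] by (auto simp: distr_on_def)
    have "p S * p T - q S * q T = p S * (p T - q T) + q T * (p S - q S)" by (simp add: algebra_simps)
    also have "\<bar>\<dots>\<bar> \<le> \<bar>p S * (p T - q T)\<bar> + \<bar>q T * (p S - q S)\<bar>" by (rule abs_triangle_ineq)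
    also have "\<dots> = p S * \<bar>p T - q T\<bar> + q T * \<bar>p S - q S\<bar>" using b by (simp add: abs_mult)
    also have "\<dots> \<le> 1 * \<delta> + 1 * \<delta>" using b d that by (intro add_mono mult_mono) auto
    finally show ?thesis by simp
  qed
  have d0: "\<delta> \<ge> 0" using d[of "{}"] by simp
  have "trunc_frac k p - trunc_frac k q = (\<Sum>S\<in>?A. \<Sum>T\<in>?A. if S \<inter> T = {} then p S * p T - q S * q T else 0)"
    unfolding trunc_frac_def sum_subtractf[symmetric] by (intro sum.cong refl) auto
  also have "\<bar>\<dots>\<bar> \<le> (\<Sum>S\<in>?A. \<Sum>T\<in>?A. \<bar>if S \<inter> T = {} then p S * p T - q S * q T else 0\<bar>)"
    by (rule order_trans[OF sum_abs]) (intro sum_mono sum_abs)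
  also have "\<dots> \<le> (\<Sum>S\<in>?A. \<Sum>T\<in>?A. 2 * \<delta>)"
    using pt d0 by (intro sum_mono) auto
  also have "\<dots> = (card ?A)\<^sup>2 * (2 * \<delta>)" by (simp add: power2_eq_square)
  finally show ?thesis by simp
qed

lemma closed_I1_sublevel: "closed {x. I1 x \<le> ereal c}"
  unfolding closed_sequential_limits using I1_lower_semicontinuous by blast

text \<open>Either the truncation is off by more than \<epsilon> or the type lies in
  \<open>E\<close>. Each event has probability at most exp(-n (c - \<eta>)) eventually, whence the
  factor 2.\<close>

lemma prob_upper:
  assumes C: "compact C" and A: "A \<subseteq> C" and c: "\<And>x. x \<in> C \<Longrightarrow> I1 x > ereal c" and eta: "\<eta> > 0"
  shows "\<forall>\<^sub>F n in sequentially. measure_pmf.prob (Pn n) A \<le> 2 * exp (- real n * (c - \<eta>))"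
proof -
  have "C \<inter> {x. I1 x \<le> ereal c} = {}" using c by (auto simp: not_le[symmetric])
  then obtain d where d: "d > 0" "\<And>x y. x \<in> C \<Longrightarrow> I1 y \<le> ereal c \<Longrightarrow> d \<le> dist x y"
    using separate_compact_closed[OF C closed_I1_sublevel[of c]] by blast
  \<comment> \<open>Two errors of this size must stay below d: from the point of C to the truncated
    value of the type, and from there to the double integral of a law.\<close>
  define \<epsilon> where "\<epsilon> = d / 3"
  have eps: "\<epsilon> > 0" using d by (simp add: \<epsilon>_def)
  obtain k1 where k1: "\<And>k g. k \<ge> k1 \<Longrightarrow> fin_ent g \<Longrightarrow> ent g \<le> c \<Longrightarrow> \<bar>trunc_frac k (marg (law g) k) - coprime_frac (law g)\<bar> \<le> \<epsilon>"
    using trunc_frac_uniform[OF eps, of c] by blast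
  obtain k2 where k2: "\<And>k n. k \<ge> k2 \<Longrightarrow> n > 0 \<Longrightarrow> measure_pmf.prob (sample n)
    {X. \<bar>coprime_pairs n X - trunc_frac k (emp_idx n k X)\<bar> > \<epsilon>} \<le> exp (- real n * c)"
    using exponential_approx[OF eps, of c] by blast
  define k where "k = max k1 k2"
  define E where "E = (\<lambda>q. \<exists>x\<in>C. \<bar>x - trunc_frac k q\<bar> \<le> \<epsilon>)"
  \<comment> \<open>Otherwise the step density of q would give a point of the sublevel set at c
    closer than d to C.\<close>
  have KL: "KL (Pow {1..k}) q (wt k) \<ge> c" if q: "distr_on (Pow {1..k}) q" "E q" for q
  proof (rule ccontr)
    assume less: "\<not> KL (Pow {1..k}) q (wt k) \<ge> c"
    note s = step_density_props[OF q(1)]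
    have e: "ent (step_density k q) \<le> c" using less s(2) by simp
    have "trunc_frac k (marg (law (step_density k q)) k) = trunc_frac k q"
      unfolding trunc_frac_def using s(3) by (intro sum.cong refl if_cong) auto
    hence 1: "\<bar>trunc_frac k q - coprime_frac (law (step_density k q))\<bar> \<le> \<epsilon>" using k1[OF _ s(1) e, of k] by (simp add: k_def)
    obtain x where x: "x \<in> C" "\<bar>x - trunc_frac k q\<bar> \<le> \<epsilon>" using q(2) by (auto simp: E_def)
    have "I1 (coprime_frac (law (step_density k q))) \<le> ereal c"
      using I1_le[OF s(1)] e by (metis ereal_less_eq(3) order_trans)
    hence "d \<le> \<bar>x - coprime_frac (law (step_density k q))\<bar>" using d(2)[OF x(1)] by (simp add: dist_real_def)
    thus False using 1 x(2) d(1) unfolding \<epsilon>_def by linarith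
  qed
  have "\<forall>\<^sub>F n in sequentially. measure_pmf.prob (Pi_pmf {..<n} (prime_idx k 0) (\<lambda>_. idx_pmf k n)) {s. E (emp n s)}
      \<le> exp (- real n * (c - \<eta>))"
    by (rule sanov_upper[OF _ pmf_prime_idx_tendsto wt_pos set_idx_pmf eta KL]) simp_all
  thus ?thesis using eventually_gt_at_top[of 0]
  proof eventually_elim
    case (elim n)
    have "measure_pmf.prob (Pn n) A \<le> measure_pmf.prob (sample n)
      ({X. \<bar>coprime_pairs n X - trunc_frac k (emp_idx n k X)\<bar> > \<epsilon>} \<union> {X. E (emp_idx n k X)})"
      unfolding measure_Pn
      by (intro measure_pmf.finite_measure_mono) (use A in \<open>force simp: E_def\<close>)+
    also have "\<dots> \<le> measure_pmf.prob (sample n) {X. \<bar>coprime_pairs n X - trunc_frac k (emp_idx n k X)\<bar> > \<epsilon>}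
      + measure_pmf.prob (sample n) {X. E (emp_idx n k X)}"
      by (rule measure_Un_le) auto
    also have "\<dots> \<le> exp (- real n * c) + exp (- real n * (c - \<eta>))"
      unfolding prob_emp_idx using elim k2[of k n] by (intro add_mono) (auto simp: k_def)
    also have "exp (- real n * c) \<le> exp (- real n * (c - \<eta>))"
      using eta by (simp add: mult_left_mono)
    finally show ?case by simp
  qed
qed

text \<open>The radius 3 \<epsilon> adds up three errors: sample against the truncated value of its
  type, type against the marginal q, and q against x.\<close>

lemma prob_lower:
  assumes x: "I1 x < ereal h" and eps: "\<epsilon> > 0" and A: "\<And>y. y \<in> {0..1} \<Longrightarrow> \<bar>y - x\<bar> \<le> 3 * \<epsilon> \<Longrightarrow> y \<in> A"
  shows "\<forall>\<^sub>F n in sequentially. measure_pmf.prob (Pn n) A \<ge> exp (- real n * h) / 2"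
proof -
  obtain g where g: "fin_ent g" "ent g < h" "coprime_frac (law g) = x" using I1_lessE[OF x] by auto
  interpret L: law01 "law g" by (rule law01_law[OF g(1)])
  obtain k1 where k1: "\<And>k. k \<ge> k1 \<Longrightarrow> \<bar>trunc_frac k (marg (law g) k) - x\<bar> \<le> \<epsilon>"
    using trunc_frac_uniform[OF eps, of h] g by (metis less_imp_le)
  \<comment> \<open>The rate h + 1 makes the failure probability at most half of exp(-n h), since
    exp(-n) \<le> 1/2 for n > 0.\<close>
  obtain k2 where k2: "\<And>k n. k \<ge> k2 \<Longrightarrow> n > 0 \<Longrightarrow> measure_pmf.prob (sample n)
    {X. \<bar>coprime_pairs n X - trunc_frac k (emp_idx n k X)\<bar> > \<epsilon>} \<le> exp (- real n * (h + 1))"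
    using exponential_approx[OF eps, of "h + 1"] by blast
  define k where "k = max k1 k2"
  define q where "q = marg (law g) k"
  have q: "distr_on (Pow {1..k}) q" unfolding q_def by (rule L.distr_on_marg)
  have Fq: "\<bar>trunc_frac k q - x\<bar> \<le> \<epsilon>" using k1[of k] by (simp add: k_def q_def)
  define N where "N = (real (card (Pow {1..k})))\<^sup>2"
  have N: "N > 0" by (simp add: N_def card_Pow)
  \<comment> \<open>Solves N (2 \<delta>) = \<epsilon>, the bound of
    \<open>trunc_frac_lipschitz\<close>.\<close>
  define \<delta> where "\<delta> = \<epsilon> / (2 * N)"
  have delta: "\<delta> > 0" using N eps by (simp add: \<delta>_def)
  \<comment> \<open>The positive gap between h and this divergence becomes the slack in
    \<open>sanov_lower\<close>, so that the exponent there is exactly h.\<close>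
  have KL: "KL (Pow {1..k}) q (wt k) < h" using KL_marg_le_ent[OF g(1), of k] g(2) by (simp add: q_def)
  let ?E = "\<lambda>p. \<forall>S\<in>Pow {1..k}. \<bar>p S - q S\<bar> \<le> \<delta>"
  have "\<forall>\<^sub>F n in sequentially. measure_pmf.prob (Pi_pmf {..<n} (prime_idx k 0) (\<lambda>_. idx_pmf k n)) {s. ?E (emp n s)}
      \<ge> exp (- real n * (KL (Pow {1..k}) q (wt k) + (h - KL (Pow {1..k}) q (wt k))))"
    by (rule sanov_lower[OF _ pmf_prime_idx_tendsto wt_pos set_idx_pmf _ delta q]) (use KL in simp_all)
  thus ?thesis using eventually_gt_at_top[of 0]
  proof eventually_elim
    case (elim n)
    let ?B = "{X. \<bar>coprime_pairs n X - trunc_frac k (emp_idx n k X)\<bar> > \<epsilon>}"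
    have sub: "{X. ?E (emp_idx n k X)} \<subseteq> {X. coprime_pairs n X \<in> A} \<union> ?B"
    proof
      fix X assume X: "X \<in> {X. ?E (emp_idx n k X)}"
      have "distr_on (Pow {1..k}) (emp_idx n k X)"
        by (rule distr_on_emp[OF _ _ prime_idx_range]) (use elim in auto)
      from trunc_frac_lipschitz[OF this q, of \<delta>] X have "\<bar>trunc_frac k (emp_idx n k X) - trunc_frac k q\<bar> \<le> N * (2 * \<delta>)"
        by (simp add: N_def)
      also have "\<dots> = \<epsilon>" using N by (simp add: \<delta>_def)
      finally have 1: "\<bar>trunc_frac k (emp_idx n k X) - trunc_frac k q\<bar> \<le> \<epsilon>" .
      show "X \<in> {X. coprime_pairs n X \<in> A} \<union> ?B"
      proof (cases "X \<in> ?B")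
        case False
        hence "\<bar>coprime_pairs n X - x\<bar> \<le> 3 * \<epsilon>" using 1 Fq by simp
        thus ?thesis using A[OF coprime_pairs_bounds] by blast
      qed simp
    qed
    have "exp (- real n * h) \<le> measure_pmf.prob (sample n) {X. ?E (emp_idx n k X)}"
      unfolding prob_emp_idx[where P = ?E] using elim(1) by simp
    also have "\<dots> \<le> measure_pmf.prob (sample n) ({X. coprime_pairs n X \<in> A} \<union> ?B)"
      by (intro measure_pmf.finite_measure_mono sub) auto
    also have "\<dots> \<le> measure_pmf.prob (Pn n) A + measure_pmf.prob (sample n) ?B"
      unfolding measure_Pn by (rule measure_Un_le) auto
    also have "measure_pmf.prob (sample n) ?B \<le> exp (- real n * (h + 1))"
      using k2[of k n] elim by (simp add: k_def)
    also have "\<dots> = exp (- real n * h) * exp (- real n)" by (simp add: exp_add[symmetric] algebra_simps)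
    also have "\<dots> \<le> exp (- real n * h) * (1 / 2)"
    proof (intro mult_left_mono)
      have "2 \<le> 1 + real n" using elim by simp
      also have "\<dots> \<le> exp (real n)" by (rule exp_ge_add_one_self)
      finally show "exp (- real n) \<le> 1 / 2" by (simp add: exp_minus field_simps)
    qed simp
    finally show ?case by simp
  qed
qed

section \<open>From probability bounds to exponential rates\<close>

lemma eln_le:
  assumes "n > 0" "0 \<le> p" "p \<le> 2 * exp (- real n * c)"
  shows "ereal (1 / real n) * eln p \<le> ereal (ln 2 / n - c)"
proof (cases "p = 0")
  case True
  thus ?thesis using assms by (simp add: eln_def)
next
  case False
  hence "ln p \<le> ln (2 * exp (- real n * c))" using assms by (subst ln_le_cancel_iff) auto
  also have "\<dots> = ln 2 - n * c" by (simp add: ln_mult)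
  finally have "ln p / n \<le> (ln 2 - n * c) / n" by (intro divide_right_mono) auto
  also have "\<dots> = ln 2 / n - c" using assms by (simp add: diff_divide_distrib)
  finally show ?thesis using False by (simp add: eln_def)
qed

lemma eln_ge:
  assumes "n > 0" "exp (- real n * h) / 2 \<le> p"
  shows "ereal (- ln 2 / n - h) \<le> ereal (1 / real n) * eln p"
proof -
  have p: "p > 0" using assms(2) by (rule order_less_le_trans[rotated]) simp
  hence "ln (exp (- real n * h) / 2) \<le> ln p" using assms by (subst ln_le_cancel_iff) auto
  hence "(- n * h - ln 2) / n \<le> ln p / n" by (intro divide_right_mono) (simp_all add: ln_div)
  moreover have "(- n * h - ln 2) / n = - ln 2 / n - h" using assms by (simp add: diff_divide_distrib)
  ultimately show ?thesis using p by (simp add: eln_def)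
qed

lemma limsup_eln_le:
  assumes p: "\<And>n. p n \<ge> 0" and le: "\<And>\<eta>. \<eta> > 0 \<Longrightarrow> \<forall>\<^sub>F n in sequentially. p n \<le> 2 * exp (- real n * (c - \<eta>))"
  shows "limsup (\<lambda>n. ereal (1 / real n) * eln (p n)) \<le> ereal (- c)"
proof (rule ereal_le_epsilon2)
  fix e :: real assume e: "e > 0"
  have "(\<lambda>n. ln 2 / real n) \<longlonglongrightarrow> 0" by real_asymp
  hence "\<forall>\<^sub>F n in sequentially. ln 2 / real n < e / 2" using e by (intro order_tendstoD(2)) auto
  moreover have "\<forall>\<^sub>F n in sequentially. p n \<le> 2 * exp (- real n * (c - e / 2))" using e by (intro le) auto
  ultimately have "\<forall>\<^sub>F n in sequentially. ereal (1 / real n) * eln (p n) \<le> ereal (- c + e)"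
    using eventually_gt_at_top[of 0]
  proof eventually_elim
    case (elim n)
    have "ereal (1 / real n) * eln (p n) \<le> ereal (ln 2 / n - (c - e / 2))"
      by (rule eln_le) (use elim p in auto)
    also have "\<dots> \<le> ereal (- c + e)" unfolding ereal_less_eq using elim(1) by linarith
    finally show ?case .
  qed
  thus "limsup (\<lambda>n. ereal (1 / real n) * eln (p n)) \<le> ereal (- c) + ereal e"
    unfolding plus_ereal.simps by (rule Limsup_bounded)
qed

lemma liminf_eln_ge:
  assumes ge: "\<forall>\<^sub>F n in sequentially. exp (- real n * h) / 2 \<le> p n"
  shows "ereal (- h) \<le> liminf (\<lambda>n. ereal (1 / real n) * eln (p n))"
proof (rule ereal_le_epsilon2)
  fix e :: real assume e: "e > 0"
  have "(\<lambda>n. ln 2 / real n) \<longlonglongrightarrow> 0" by real_asymp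
  hence "\<forall>\<^sub>F n in sequentially. ln 2 / real n < e" using e by (intro order_tendstoD(2)) auto
  with ge have "\<forall>\<^sub>F n in sequentially. ereal (- h - e) \<le> ereal (1 / real n) * eln (p n)"
    using eventually_gt_at_top[of 0]
  proof eventually_elim
    case (elim n)
    have "ereal (- h - e) \<le> ereal (- ln 2 / n - h)" using elim by simp
    also have "\<dots> \<le> ereal (1 / real n) * eln (p n)" by (rule eln_ge) (use elim in auto)
    finally show ?case .
  qed
  hence "ereal (- h - e) \<le> liminf (\<lambda>n. ereal (1 / real n) * eln (p n))" by (rule Liminf_bounded)
  hence "ereal (- h - e) + ereal e \<le> liminf (\<lambda>n. ereal (1 / real n) * eln (p n)) + ereal e"
    by (rule add_right_mono)
  thus "ereal (- h) \<le> liminf (\<lambda>n. ereal (1 / real n) * eln (p n)) + ereal e" by simp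
qed

theorem theorem2p2:
  shows "LDP_on {0..1::real} (\<lambda>n. measure_pmf (Pn n)) I1"
  unfolding LDP_on_def
proof (intro conjI ballI allI impI)
  show "0 \<le> I1 x" for x by (rule I1_nonneg)
  show "lsc_on {0..1} I1"
    unfolding lsc_on_def
  proof
    fix c
    show "closedin (top_of_set {0..1}) {x \<in> {0..1}. I1 x \<le> c}"
    proof (cases c)
      case (real r)
      have "{x \<in> {0..1}. I1 x \<le> c} = {0..1} \<inter> {x. I1 x \<le> ereal r}" using real by auto
      thus ?thesis using closedin_closed_Int[OF closed_I1_sublevel] by simp
    next
      case PInf
      hence "{x \<in> {0..1}. I1 x \<le> c} = {0..1}" by auto
      thus ?thesis by simp
    next
      case MInf
      have "I1 x \<noteq> -\<infinity>" for x using I1_nonneg[of x] by auto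
      hence "{x \<in> {0..1}. I1 x \<le> c} = {}" using MInf by auto
      thus ?thesis by (metis closedin_empty)
    qed
  qed
next
  fix A :: "real set" assume "A \<in> sets (restrict_space borel {0..1})"
  hence A: "A \<subseteq> {0..1}" by (auto simp: sets_restrict_space)
  let ?a = "\<lambda>n. ereal (1 / real n) * eln (measure_pmf.prob (Pn n) A)"
  show "liminf ?a \<le> limsup ?a" by (rule Liminf_le_Limsup) simp
  show "- (INF x\<in>top_of_set {0..1} interior_of A. I1 x) \<le> liminf ?a"
  proof -
    have "- liminf ?a \<le> I1 x" if x: "x \<in> top_of_set {0..1} interior_of A" for x
    \<comment> \<open>Testing against real upper bounds h of \<open>I1 x\<close> disposes of the
      points of infinite rate.\<close>
    proof (rule ereal_le_real)
      have "x \<in> {0..1}" using x interior_of_subset_topspace[of "top_of_set {0..1}" A] by auto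
      obtain e where e: "e > 0" "ball x e \<inter> {0..1} \<subseteq> A"
      proof -
        have "openin (top_of_set {0..1}) (top_of_set {0..1} interior_of A)" by (rule openin_interior_of)
        then obtain e where "e > 0" "ball x e \<inter> {0..1} \<subseteq> top_of_set {0..1} interior_of A"
          using x unfolding openin_contains_ball by blast
        thus ?thesis using that interior_of_subset[of "top_of_set {0..1}" A] by blast
      qed
      fix h assume h: "I1 x \<le> ereal h"
      show "- liminf ?a \<le> ereal h"
      proof (rule ereal_le_epsilon2)
        fix \<eta> :: real assume "\<eta> > 0"
        with h have "I1 x < ereal (h + \<eta>)" using order_le_less_trans[of "I1 x" "ereal h" "ereal (h + \<eta>)"] by simp
        hence "\<forall>\<^sub>F n in sequentially. measure_pmf.prob (Pn n) A \<ge> exp (- real n * (h + \<eta>)) / 2"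
          \<comment> \<open>As 3 (e/4) < e, the closed interval of \<open>prob_lower\<close> lies
            inside the ball.\<close>
          by (rule prob_lower[of _ _ "e / 4"]) (use e in \<open>auto simp: dist_real_def abs_minus_commute subset_iff\<close>)
        hence "ereal (- (h + \<eta>)) \<le> liminf ?a" by (rule liminf_eln_ge)
        hence "- liminf ?a \<le> - ereal (- (h + \<eta>))" by (subst ereal_minus_le_minus)
        thus "- liminf ?a \<le> ereal h + ereal \<eta>" by (simp add: add.commute)
      qed
    qed
    hence "- liminf ?a \<le> (INF x\<in>top_of_set {0..1} interior_of A. I1 x)" by (rule INF_greatest)
    thus ?thesis by (simp add: ereal_uminus_le_reorder)
  qed
  show "limsup ?a \<le> - (INF x\<in>top_of_set {0..1} closure_of A. I1 x)"
  proof -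
    let ?C = "top_of_set {0..1} closure_of A"
    have "closedin (top_of_set {0..1}) ?C" by (rule closedin_closure_of)
    hence C: "compact ?C" by (rule closedin_compact[rotated]) simp
    have AC: "A \<subseteq> ?C" using A by (intro closure_of_subset) simp
    have "(INF x\<in>?C. I1 x) \<le> - limsup ?a"
    \<comment> \<open>A level z strictly below the infimum gives the strict inequality on the
      closure that \<open>prob_upper\<close> requires, and also covers an infinite infimum.\<close>
    proof (rule dense_le)
      fix z assume z: "z < (INF x\<in>?C. I1 x)"
      show "z \<le> - limsup ?a"
      proof (cases z)
        case (real c)
        have "limsup ?a \<le> ereal (- c)"
        proof (rule limsup_eln_le)
          fix \<eta> :: real assume "\<eta> > 0"
          thus "\<forall>\<^sub>F n in sequentially. measure_pmf.prob (Pn n) A \<le> 2 * exp (- real n * (c - \<eta>))"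
            using z real by (intro prob_upper[OF C AC]) (auto dest: less_INF_D)
        qed simp
        hence "- ereal (- c) \<le> - limsup ?a" by (subst ereal_minus_le_minus)
        thus ?thesis using real by simp
      qed (use z in auto)
    qed
    hence "- (- limsup ?a) \<le> - (INF x\<in>?C. I1 x)" by (subst ereal_minus_le_minus)
    thus ?thesis by simp
  qed
qed

end
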